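(* Let $R$ be the exterior algebra in $3$ indeterminates and let $X$ be an indecomposable $R$-module of complexity one or two. Then $\operatorname{Ext}^1_R(X,X)\ne 0$.
   Context: $\Bbbk$ is an algebraically closed field and $R$ is the exterior algebra over $\Bbbk$ in three indeterminates, graded with the indeterminates in degree $1$. All modules are finitely generated graded (right) $R$-modules; $\operatorname{Hom}_R$ denotes degree zero homomorphisms and $\operatorname{Ext}^i_R$ the derived functors of this graded $\operatorname{Hom}$. The $i$-th Betti number $\beta_i(X)$ is the rank of the $i$-th module in a minimal graded free resolution of $X$. The complexity of $X$ is the infimum of the $d\in\mathbb N=\{0,1,2,\dots\}$ for which there is a positive $c\in\mathbb Q$ with $\beta_i(X)\le c\,i^{d-1}$ for all $i\ge 1$. *)

theory Defs
  imports
    "HOL-Algebra.Coset"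
    "HOL-Computational_Algebra.Polynomial"
    "HOL-Library.Numeral_Type"
    "HOL-Library.Function_Algebras"
    "HOL-Library.Extended_Nat"
begin

section \<open>The exterior algebra\<close>

text \<open>
  The exterior algebra over \<open>'k\<close> in indeterminates \<open>x\<^sub>i\<close>, \<open>i :: 'n\<close>.  It has the basis
  \<open>x\<^sub>S = x\<^sub>i\<^sub>1 \<cdots> x\<^sub>i\<^sub>r\<close> for \<open>S = {i\<^sub>1 < \<cdots> < i\<^sub>r}\<close>, and an element is recorded by its
  coefficients with respect to this basis.
\<close>

datatype ('k, 'n) exterior = Exterior (coeff_ext: "'n set \<Rightarrow> 'k")

lemma exterior_eqI: "(\<And>S. coeff_ext a S = coeff_ext b S) \<Longrightarrow> a = b"
  by (cases a; cases b) auto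

text \<open>For disjoint \<open>S\<close> and \<open>T\<close> one has \<open>x\<^sub>S x\<^sub>T = ext_sign S T \<cdot> x\<^bsub>S \<union> T\<^esub>\<close>.\<close>

definition ext_sign :: "'n::linorder set \<Rightarrow> 'n set \<Rightarrow> 'k::comm_ring_1" where
  "ext_sign S T = (- 1) ^ card {(i, j). i \<in> S \<and> j \<in> T \<and> j < i}"

instantiation exterior :: (comm_ring_1, "{finite, linorder}") ring_1
begin

definition "0 = Exterior (\<lambda>_. 0)"
definition "1 = Exterior (\<lambda>S. if S = {} then 1 else 0)"
definition "a + b = Exterior (\<lambda>S. coeff_ext a S + coeff_ext b S)"
definition "a - b = Exterior (\<lambda>S. coeff_ext a S - coeff_ext b S)"
definition "- a = Exterior (\<lambda>S. - coeff_ext a S)"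
definition "a * b = Exterior (\<lambda>U. \<Sum>S\<in>Pow U. ext_sign S (U - S) * coeff_ext a S * coeff_ext b (U - S))"

lemma ext_sign_empty [simp]: "ext_sign {} T = 1" "ext_sign S {} = 1"
  by (auto simp: ext_sign_def)

lemma ext_sign_Un_left:
  fixes S T U :: "'n::{finite,linorder} set"
  assumes "S \<inter> T = {}"
  shows "(ext_sign (S \<union> T) U :: 'k::comm_ring_1) = ext_sign S U * ext_sign T U"
proof -
  have "{(i, j). i \<in> S \<union> T \<and> j \<in> U \<and> j < i} =
      {(i, j). i \<in> S \<and> j \<in> U \<and> j < i} \<union> {(i, j). i \<in> T \<and> j \<in> U \<and> j < i}" by auto
  moreover have "{(i, j). i \<in> S \<and> j \<in> U \<and> j < i} \<inter> {(i, j). i \<in> T \<and> j \<in> U \<and> j < i} = {}"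
    using assms by auto
  ultimately show ?thesis
    by (simp add: ext_sign_def card_Un_disjoint power_add)
qed

lemma ext_sign_Un_right:
  fixes S T U :: "'n::{finite,linorder} set"
  assumes "T \<inter> U = {}"
  shows "(ext_sign S (T \<union> U) :: 'k::comm_ring_1) = ext_sign S T * ext_sign S U"
proof -
  have "{(i, j). i \<in> S \<and> j \<in> T \<union> U \<and> j < i} =
      {(i, j). i \<in> S \<and> j \<in> T \<and> j < i} \<union> {(i, j). i \<in> S \<and> j \<in> U \<and> j < i}" by auto
  moreover have "{(i, j). i \<in> S \<and> j \<in> T \<and> j < i} \<inter> {(i, j). i \<in> S \<and> j \<in> U \<and> j < i} = {}"
    using assms by auto
  ultimately show ?thesis
    by (simp add: ext_sign_def card_Un_disjoint power_add)
qed

instance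
proof
  fix a b c :: "('a, 'b) exterior"
  show "a * b * c = a * (b * c)"
  proof (rule exterior_eqI)
    fix U
    let ?t = "\<lambda>S T V. ext_sign S T * ext_sign S V * ext_sign T V
        * (coeff_ext a S * coeff_ext b T * coeff_ext c V) :: 'a"
    have "coeff_ext (a * b * c) U =
        (\<Sum>W\<in>Pow U. \<Sum>S\<in>Pow W. ext_sign W (U - W) * (ext_sign S (W - S) * coeff_ext a S
          * coeff_ext b (W - S)) * coeff_ext c (U - W))"
      by (simp add: times_exterior_def sum_distrib_left sum_distrib_right)
    also have "\<dots> = (\<Sum>W\<in>Pow U. \<Sum>S\<in>Pow W. ?t S (W - S) (U - W))"
    proof (intro sum.cong refl)
      fix W S assume "W \<in> Pow U" "S \<in> Pow W"
      hence "W = S \<union> (W - S)" by auto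
      hence "ext_sign W (U - W) = (ext_sign S (U - W) * ext_sign (W - S) (U - W) :: 'a)"
        by (metis Diff_disjoint ext_sign_Un_left)
      thus "ext_sign W (U - W) * (ext_sign S (W - S) * coeff_ext a S
          * coeff_ext b (W - S)) * coeff_ext c (U - W) = ?t S (W - S) (U - W)"
        by (simp add: mult_ac)
    qed
    also have "\<dots> = (\<Sum>(W, S)\<in>(SIGMA W:Pow U. Pow W). ?t S (W - S) (U - W))"
      by (simp add: sum.Sigma)
    also have "\<dots> = (\<Sum>(S, T)\<in>(SIGMA S:Pow U. Pow (U - S)). ?t S T (U - S - T))"
      by (rule sum.reindex_bij_witness[where i = "\<lambda>(S, T). (S \<union> T, S)" and j = "\<lambda>(W, S). (S, W - S)"])
        (auto simp: Diff_eq intro!: arg_cong2[where f = "(*)"] arg_cong2[where f = ext_sign]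
          arg_cong[where f = "coeff_ext c"])
    also have "\<dots> = (\<Sum>S\<in>Pow U. \<Sum>T\<in>Pow (U - S). ?t S T (U - S - T))"
      by (simp add: sum.Sigma)
    also have "\<dots> = (\<Sum>S\<in>Pow U. \<Sum>T\<in>Pow (U - S). ext_sign S (U - S) * coeff_ext a S *
        (ext_sign T (U - S - T) * coeff_ext b T * coeff_ext c (U - S - T)))"
    proof (intro sum.cong refl)
      fix S T assume "S \<in> Pow U" "T \<in> Pow (U - S)"
      hence "U - S = T \<union> (U - S - T)" by auto
      hence "ext_sign S (U - S) = (ext_sign S T * ext_sign S (U - S - T) :: 'a)"
        by (metis Diff_disjoint ext_sign_Un_right)
      thus "?t S T (U - S - T) = ext_sign S (U - S) * coeff_ext a S *
        (ext_sign T (U - S - T) * coeff_ext b T * coeff_ext c (U - S - T))"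
        by (simp add: mult_ac)
    qed
    also have "\<dots> = coeff_ext (a * (b * c)) U"
      by (simp add: times_exterior_def sum_distrib_left)
    finally show "coeff_ext (a * b * c) U = coeff_ext (a * (b * c)) U" .
  qed
  show "1 * a = a"
  proof (rule exterior_eqI)
    fix U
    have "coeff_ext (1 * a) U = (\<Sum>S\<in>Pow U. if S = {} then coeff_ext a U else 0)"
      unfolding times_exterior_def exterior.sel
      by (intro sum.cong refl) (auto simp: one_exterior_def)
    thus "coeff_ext (1 * a) U = coeff_ext a U" by (simp add: sum.delta)
  qed
  show "a * 1 = a"
  proof (rule exterior_eqI)
    fix U
    have "coeff_ext (a * 1) U = (\<Sum>S\<in>Pow U. if S = U then coeff_ext a U else 0)"
      unfolding times_exterior_def exterior.sel
      by (intro sum.cong refl) (auto simp: one_exterior_def)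
    thus "coeff_ext (a * 1) U = coeff_ext a U" by (simp add: sum.delta)
  qed
  show "(a + b) * c = a * c + b * c"
    by (auto simp: times_exterior_def plus_exterior_def algebra_simps sum.distrib)
  show "a * (b + c) = a * b + a * c"
    by (auto simp: times_exterior_def plus_exterior_def algebra_simps sum.distrib)
  show "(0 :: ('a, 'b) exterior) \<noteq> 1"
    by (auto simp: zero_exterior_def one_exterior_def fun_eq_iff)
qed (auto simp: zero_exterior_def plus_exterior_def minus_exterior_def uminus_exterior_def
      algebra_simps)

end

definition ext_var :: "'n \<Rightarrow> ('k::comm_ring_1, 'n::{finite,linorder}) exterior" where
  "ext_var i = Exterior (\<lambda>S. if S = {i} then 1 else 0)"

lemma ext_var_square: "ext_var i * ext_var i = 0"
  by (auto simp: ext_var_def times_exterior_def zero_exterior_def fun_eq_iff intro!: sum.neutral)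

lemma coeff_ext_var_mult:
  assumes "i \<noteq> j"
  shows "coeff_ext (ext_var i * ext_var j) U =
    (if U = {i, j} then if j < i then - 1 else 1 else 0)"
proof (cases "U = {i, j}")
  case True
  have "{(i', j'). i' \<in> {i} \<and> j' \<in> {j} \<and> j' < i'} = (if j < i then {(i, j)} else {})"
    by auto
  hence sgn: "ext_sign {i} {j} = (if j < i then - 1 else 1 :: 'b)"
    by (simp add: ext_sign_def)
  have "coeff_ext (ext_var i * ext_var j) U =
      (\<Sum>S\<in>Pow U. if S = {i} then ext_sign {i} {j} else (0 :: 'b))"
    unfolding times_exterior_def exterior.sel
    by (intro sum.cong refl) (use True assms in \<open>auto simp: ext_var_def insert_Diff_if\<close>)
  thus ?thesis using True sgn by (simp add: sum.delta)
next
  case False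
  have "coeff_ext (ext_var i) S * coeff_ext (ext_var j) (U - S) = (0 :: 'b)"
    if "S \<in> Pow U" for S
    using that False by (auto simp: ext_var_def)
  thus ?thesis using False
    by (auto simp: times_exterior_def mult.assoc intro!: sum.neutral)
qed

lemma ext_var_anticommute: "ext_var i * ext_var j = - (ext_var j * ext_var i)"
proof (cases "i = j")
  case True
  thus ?thesis by (simp add: ext_var_square)
next
  case False
  thus ?thesis
    by (intro exterior_eqI)
      (auto simp: coeff_ext_var_mult uminus_exterior_def insert_commute)
qed

definition ext_grade :: "int \<Rightarrow> ('k::comm_ring_1, 'n::{finite,linorder}) exterior set" where
  "ext_grade n = {a. \<forall>S. coeff_ext a S \<noteq> 0 \<longrightarrow> int (card S) = n}"

text \<open>The ideal generated by the indeterminates.\<close>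

definition ext_aug :: "('k::comm_ring_1, 'n::{finite,linorder}) exterior set" where
  "ext_aug = {a. coeff_ext a {} = 0}"


section \<open>Graded right modules\<close>

text \<open>
  \<open>grade M n\<close> is the homogeneous component of degree \<open>n\<close> and \<open>act M x a\<close> is \<open>x \<cdot> a\<close>.  Addition is
  that of the ambient type.
\<close>

record ('k, 'n, 'm) gmod = "'m partial_object" +
  grade :: "int \<Rightarrow> 'm set"
  act :: "'m \<Rightarrow> ('k, 'n) exterior \<Rightarrow> 'm"

definition add_subgroup :: "'m::ab_group_add set \<Rightarrow> bool" where
  "add_subgroup A \<longleftrightarrow> 0 \<in> A \<and> (\<forall>x\<in>A. \<forall>y\<in>A. x + y \<in> A) \<and> (\<forall>x\<in>A. - x \<in> A)"

locale graded_module =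
  fixes M :: "('k::field, 'n::{finite,linorder}, 'm::ab_group_add) gmod"
  assumes carrier_subgroup: "add_subgroup (carrier M)"
    and act_closed: "x \<in> carrier M \<Longrightarrow> act M x a \<in> carrier M"
    and act_add_left: "\<lbrakk>x \<in> carrier M; y \<in> carrier M\<rbrakk> \<Longrightarrow> act M (x + y) a = act M x a + act M y a"
    and act_add_right: "x \<in> carrier M \<Longrightarrow> act M x (a + b) = act M x a + act M x b"
    and act_mult: "x \<in> carrier M \<Longrightarrow> act M x (a * b) = act M (act M x a) b"
    and act_one: "x \<in> carrier M \<Longrightarrow> act M x 1 = x"
    and grade_subgroup: "add_subgroup (grade M n)"
    and grade_subset: "grade M n \<subseteq> carrier M"
    and grade_direct_sum: "x \<in> carrier M \<Longrightarrow>
      \<exists>!c. finite {n. c n \<noteq> 0} \<and> (\<forall>n. c n \<in> grade M n) \<and> x = (\<Sum>n | c n \<noteq> 0. c n)"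
    and act_grade: "\<lbrakk>x \<in> grade M m; a \<in> ext_grade n\<rbrakk> \<Longrightarrow> act M x a \<in> grade M (m + n)"

definition finitely_generated ::
    "('k::field, 'n::{finite,linorder}, 'm::ab_group_add) gmod \<Rightarrow> bool" where
  "finitely_generated M \<longleftrightarrow>
    (\<exists>G. finite G \<and> G \<subseteq> carrier M \<and> (\<forall>x\<in>carrier M. \<exists>a. x = (\<Sum>g\<in>G. act M g (a g))))"

definition graded_submodule ::
    "'m set \<Rightarrow> ('k::field, 'n::{finite,linorder}, 'm::ab_group_add) gmod \<Rightarrow> bool" where
  "graded_submodule A M \<longleftrightarrow>
    A \<subseteq> carrier M \<and> graded_module (M\<lparr>carrier := A, grade := \<lambda>n. grade M n \<inter> A\<rparr>)"

definition indecomposable ::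
    "('k::field, 'n::{finite,linorder}, 'm::ab_group_add) gmod \<Rightarrow> bool" where
  "indecomposable M \<longleftrightarrow> carrier M \<noteq> {0} \<and>
    (\<forall>A B. graded_submodule A M \<and> graded_submodule B M \<and>
      carrier M = {a + b | a b. a \<in> A \<and> b \<in> B} \<and> A \<inter> B = {0} \<longrightarrow> A = {0} \<or> B = {0})"

text \<open>
  Homomorphisms are homogeneous of degree zero.  They are required to vanish outside the carrier, so
  that they are determined by their values on it and form a group under pointwise addition.
\<close>

definition graded_hom ::
    "('k::field, 'n::{finite,linorder}, 'm::ab_group_add) gmod \<Rightarrow>
     ('k, 'n, 'p::ab_group_add) gmod \<Rightarrow> ('m \<Rightarrow> 'p) set" where
  "graded_hom M N = {f.
    (\<forall>x\<in>carrier M. f x \<in> carrier N) \<and>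
    (\<forall>x\<in>carrier M. \<forall>y\<in>carrier M. f (x + y) = f x + f y) \<and>
    (\<forall>x\<in>carrier M. \<forall>a. f (act M x a) = act N (f x) a) \<and>
    (\<forall>n. \<forall>x\<in>grade M n. f x \<in> grade N n) \<and>
    (\<forall>x. x \<notin> carrier M \<longrightarrow> f x = 0)}"


section \<open>Free resolutions\<close>

text \<open>
  The graded free module with basis \<open>e\<^sub>0, \<dots>, e\<^bsub>r - 1\<^esub>\<close>, where \<open>r = length ds\<close> and \<open>e\<^sub>j\<close> has degree
  \<open>ds ! j\<close>; the function \<open>v\<close> stands for \<open>\<Sum>\<^sub>j e\<^sub>j \<cdot> v j\<close>.
\<close>

definition free_gmod ::
    "int list \<Rightarrow> ('k::field, 'n::{finite,linorder}, nat \<Rightarrow> ('k, 'n) exterior) gmod" where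
  "free_gmod ds = \<lparr>
    carrier = {v. \<forall>j\<ge>length ds. v j = 0},
    grade = (\<lambda>n. {v. (\<forall>j\<ge>length ds. v j = 0) \<and> (\<forall>j<length ds. v j \<in> ext_grade (n - ds ! j))}),
    act = (\<lambda>v a j. v j * a)\<rparr>"

text \<open>
  A resolution \<open>\<cdots> \<rightarrow> F\<^sub>1 \<rightarrow> F\<^sub>0 \<rightarrow> X \<rightarrow> 0\<close>: the free module \<open>F\<^sub>i\<close> is \<open>free_gmod (degs F i)\<close>, \<open>diff F i\<close> is the
  map \<open>F\<^bsub>i + 1\<^esub> \<rightarrow> F\<^sub>i\<close>, and \<open>aug F\<close> is the map \<open>F\<^sub>0 \<rightarrow> X\<close>.
\<close>

record ('k, 'n, 'm) res =
  degs :: "nat \<Rightarrow> int list"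
  diff :: "nat \<Rightarrow> (nat \<Rightarrow> ('k, 'n) exterior) \<Rightarrow> nat \<Rightarrow> ('k, 'n) exterior"
  aug :: "(nat \<Rightarrow> ('k, 'n) exterior) \<Rightarrow> 'm"

abbreviation res_mod ::
    "('k::field, 'n::{finite,linorder}, 'm::ab_group_add) res \<Rightarrow> nat \<Rightarrow>
     ('k, 'n, nat \<Rightarrow> ('k, 'n) exterior) gmod" where
  "res_mod F i \<equiv> free_gmod (degs F i)"

definition free_resolution ::
    "('k::field, 'n::{finite,linorder}, 'm::ab_group_add) gmod \<Rightarrow> ('k, 'n, 'm) res \<Rightarrow> bool" where
  "free_resolution X F \<longleftrightarrow>
    aug F \<in> graded_hom (res_mod F 0) X \<and>
    (\<forall>i. diff F i \<in> graded_hom (res_mod F (Suc i)) (res_mod F i)) \<and>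
    aug F ` carrier (res_mod F 0) = carrier X \<and>
    diff F 0 ` carrier (res_mod F 1) = {v \<in> carrier (res_mod F 0). aug F v = 0} \<and>
    (\<forall>i. diff F (Suc i) ` carrier (res_mod F (Suc (Suc i))) =
      {v \<in> carrier (res_mod F (Suc i)). diff F i v = 0})"

definition minimal_free_resolution ::
    "('k::field, 'n::{finite,linorder}, 'm::ab_group_add) gmod \<Rightarrow> ('k, 'n, 'm) res \<Rightarrow> bool" where
  "minimal_free_resolution X F \<longleftrightarrow> free_resolution X F \<and>
    (\<forall>i. \<forall>v\<in>carrier (res_mod F (Suc i)). \<forall>j. diff F i v j \<in> ext_aug)"

text \<open>Minimal resolutions are unique up to isomorphism, so the choice is immaterial.\<close>

definition betti ::
    "nat \<Rightarrow> ('k::field, 'n::{finite,linorder}, 'm::ab_group_add) gmod \<Rightarrow> nat" where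
  "betti i X = length (degs (SOME F. minimal_free_resolution X F) i)"

text \<open>The infimum is taken in \<^typ>\<open>enat\<close>, so that it is \<open>\<infinity>\<close> over the empty set.\<close>

definition complexity ::
    "('k::field, 'n::{finite,linorder}, 'm::ab_group_add) gmod \<Rightarrow> enat" where
  "complexity X = Inf (enat ` {d. \<exists>c::rat. c > 0 \<and>
    (\<forall>i\<ge>1. of_nat (betti i X) \<le> c * of_nat i powi (int d - 1))})"


section \<open>Ext groups\<close>

text \<open>
  \<open>Ext\<^sup>i(X, Y)\<close> is the \<open>i\<close>-th cohomology group of the complex \<open>Hom(F\<^sub>0, Y) \<rightarrow> Hom(F\<^sub>1, Y) \<rightarrow> \<cdots>\<close> for some
  free resolution \<open>F\<close> of \<open>X\<close>; up to isomorphism the choice is immaterial.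
\<close>

definition cocycles ::
    "('k::field, 'n::{finite,linorder}, 'm::ab_group_add) res \<Rightarrow> nat \<Rightarrow>
     ('k, 'n, 'p::ab_group_add) gmod \<Rightarrow> ((nat \<Rightarrow> ('k, 'n) exterior) \<Rightarrow> 'p) set" where
  "cocycles F i Y = {f \<in> graded_hom (res_mod F i) Y. f \<circ> diff F i = 0}"

definition coboundaries ::
    "('k::field, 'n::{finite,linorder}, 'm::ab_group_add) res \<Rightarrow> nat \<Rightarrow>
     ('k, 'n, 'p::ab_group_add) gmod \<Rightarrow> ((nat \<Rightarrow> ('k, 'n) exterior) \<Rightarrow> 'p) set" where
  "coboundaries F i Y =
    (case i of 0 \<Rightarrow> {0} | Suc j \<Rightarrow> (\<lambda>g. g \<circ> diff F j) ` graded_hom (res_mod F j) Y)"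

definition Ext_group ::
    "nat \<Rightarrow> ('k::field, 'n::{finite,linorder}, 'm::ab_group_add) gmod \<Rightarrow>
     ('k, 'n, 'p::ab_group_add) gmod \<Rightarrow> ((nat \<Rightarrow> ('k, 'n) exterior) \<Rightarrow> 'p) set monoid" where
  "Ext_group i X Y =
    (let F = SOME F. free_resolution X F
     in \<lparr>carrier = cocycles F i Y, monoid.mult = (+), one = 0\<rparr> Mod coboundaries F i Y)"

end

theory Submission
  imports Defs
begin

text \<open>
  Extensions are computed by Koszul cochains: \<open>Ext\<^sup>n(X, Y)\<close> is the degree \<open>n\<close> cohomology of the
  polynomials in \<open>Y\<^sub>i\<close> with coefficients in \<open>Hom\<^sub>k(X, Y)\<close>, with differential the supercommutator with
  \<open>Q = \<Sum>\<^sub>i Y\<^sub>i x\<^sub>i\<close>.  If the Betti numbers of \<open>X\<close> grow at most linearly, then so does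
  \<open>dim Ext\<^sup>n(X, X)\<close>, while the space of ternary forms of degree \<open>n\<close> grows quadratically; hence
  \<open>f \<cdot> id = [Q, h]\<close> for some form \<open>f \<noteq> 0\<close>, and at a point with \<open>f \<noteq> 0\<close> this contracts the complex of
  multiplications by the corresponding linear form \<open>\<ell>\<close>: its kernel on \<open>X\<close> equals its image.  If
  \<open>Ext\<^sup>1(X, X) = 0\<close>, then \<open>X\<close> does not change under linear substitutions, so that no linear form
  is distinguished.  In infinitesimal form this propagates the exactness of \<open>\<ell>\<close> to the other two
  indeterminates, which forces \<open>X\<close> to be free and hence of complexity zero.
\<close>

section \<open>Scalars, contractions and monomials\<close>

text \<open>The obstacle is that Ext^1(X, X) = 0 gives only first order information, and in positive
  characteristic a first order coordinate change cannot be exponentiated. Let \<ell> be the exact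
  linear form, scaled so that \<ell>, x_1, x_2 is a basis of the linear forms. Solving one linear
  problem after another yields maps u_n, starting with the identity, such that the formal series
  sum_n eps^n u_n intertwines the action of x_i + eps mu_i \<ell> with that of x_i; no denominators
  occur. As End_k(X) is finite dimensional, a linear relation among the u_n turns the series into a
  finite chain of maps from a nonzero scalar to 0. Induction along the chain, starting at its zero
  end, transports divisibility: x_1 becomes exact on X\<ell>, and x_2 becomes exact on X\<ell>x_1.
  Hence x_0 x_1 x_2 kills only elements of the radical of X. A nonzero kernel of the minimal cover
  would contain this monomial applied to a nonzero vector of scalars, and that vector would then
  contradict minimality.\<close>

definition ext_const :: "'k \<Rightarrow> ('k::comm_ring_1, 'n::{finite,linorder}) exterior" where
  "ext_const c = Exterior (\<lambda>S. if S = {} then c else 0)"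

lemma coeff_ext_zero [simp]: "coeff_ext 0 S = 0"
  by (simp add: zero_exterior_def)

lemma coeff_ext_add [simp]: "coeff_ext (a + b) S = coeff_ext a S + coeff_ext b S"
  by (simp add: plus_exterior_def)

lemma coeff_ext_minus [simp]: "coeff_ext (- a) S = - coeff_ext a S"
  by (simp add: uminus_exterior_def)

lemma coeff_ext_diff [simp]: "coeff_ext (a - b) S = coeff_ext a S - coeff_ext b S"
  by (simp add: minus_exterior_def)

lemma coeff_ext_sum: "coeff_ext (sum f A) S = (\<Sum>x\<in>A. coeff_ext (f x) S)"
  by (induction A rule: infinite_finite_induct) auto

lemma coeff_ext_const: "coeff_ext (ext_const c) S = (if S = {} then c else 0)"
  by (simp add: ext_const_def)

lemma ext_eq_iff: "a = b \<longleftrightarrow> (\<forall>S. coeff_ext a S = coeff_ext b S)"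
  using exterior_eqI by auto

lemma coeff_mult_const [simp]: "coeff_ext (a * ext_const c) S = coeff_ext a S * c"
proof -
  have "coeff_ext (a * ext_const c) S = (\<Sum>T\<in>Pow S. if T = S then coeff_ext a S * c else 0)"
    unfolding times_exterior_def exterior.sel
    by (intro sum.cong refl) (auto simp: coeff_ext_const)
  then show ?thesis by (simp add: sum.delta)
qed

lemma coeff_const_mult [simp]: "coeff_ext (ext_const c * a) S = c * coeff_ext a S"
proof -
  have "coeff_ext (ext_const c * a) S = (\<Sum>T\<in>Pow S. if T = {} then c * coeff_ext a S else 0)"
    unfolding times_exterior_def exterior.sel
    by (intro sum.cong refl) (auto simp: coeff_ext_const)
  then show ?thesis by (simp add: sum.delta)
qed

lemma ext_const_commute: "ext_const c * a = a * ext_const c"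
  by (rule exterior_eqI) (simp add: mult.commute)

lemma ext_const_0 [simp]: "ext_const 0 = 0"
  by (rule exterior_eqI) (simp add: coeff_ext_const)

lemma ext_const_1 [simp]: "ext_const 1 = 1"
  by (rule exterior_eqI) (simp add: coeff_ext_const one_exterior_def)

lemma ext_const_add: "ext_const (c + d) = ext_const c + ext_const d"
  by (rule exterior_eqI) (simp add: coeff_ext_const)

lemma ext_const_mult: "ext_const (c * d) = ext_const c * ext_const d"
  by (rule exterior_eqI) (simp add: coeff_ext_const)

lemma coeff_mult_var:
  "coeff_ext (a * ext_var i) S =
    (if i \<in> S then ext_sign (S - {i}) {i} * coeff_ext a (S - {i}) else 0)"
proof -
  have "coeff_ext (a * ext_var i) S =
      (\<Sum>T\<in>Pow S. if T = S - {i} then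
        if i \<in> S then ext_sign (S - {i}) {i} * coeff_ext a (S - {i}) else 0 else 0)"
    unfolding times_exterior_def exterior.sel
  proof (intro sum.cong refl)
    fix T assume "T \<in> Pow S"
    then have "S - T = {i} \<longleftrightarrow> T = S - {i} \<and> i \<in> S" by auto
    then show "ext_sign T (S - T) * coeff_ext a T * coeff_ext (ext_var i) (S - T) =
      (if T = S - {i} then if i \<in> S then ext_sign (S - {i}) {i} * coeff_ext a (S - {i}) else 0 else 0)"
      by (auto simp: ext_var_def)
  qed
  also have "\<dots> = (if i \<in> S then ext_sign (S - {i}) {i} * coeff_ext a (S - {i}) else 0)"
    by (subst sum.delta) auto
  finally show ?thesis .
qed

lemma ext_sign_square [simp]: "ext_sign S T * ext_sign S T = (1 :: 'k::comm_ring_1)"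
  unfolding ext_sign_def by (rule minus_one_mult_self)

lemma ext_sign_neq_0 [simp]: "ext_sign S T \<noteq> (0 :: 'k::field)"
  by (simp add: ext_sign_def)

lemma ext_sign_singleton:
  fixes i j :: "'n::linorder"
  assumes "i \<noteq> j"
  shows "ext_sign {i} {j} * ext_sign {j} {i} = (- 1 :: 'k::comm_ring_1)"
proof -
  have "ext_sign {i} {j} = (if j < i then - 1 else 1 :: 'k)" for i j :: 'n
  proof -
    have "{(i', j'). i' \<in> {i} \<and> j' \<in> {j} \<and> j' < i'} = (if j < i then {(i, j)} else {})"
      by auto
    then show ?thesis by (simp add: ext_sign_def)
  qed
  then show ?thesis using assms by auto
qed

text \<open>The contraction from the right: it sends x_S x_i to x_S for i outside S and kills the
  monomials without x_i. The sign comes from moving x_i to the last place.\<close>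

definition ext_contr :: "'n \<Rightarrow> ('k::comm_ring_1, 'n::{finite,linorder}) exterior \<Rightarrow> ('k, 'n) exterior" where
  "ext_contr i a = Exterior (\<lambda>S. if i \<in> S then 0 else ext_sign S {i} * coeff_ext a (insert i S))"

lemma coeff_ext_contr:
  "coeff_ext (ext_contr i a) S = (if i \<in> S then 0 else ext_sign S {i} * coeff_ext a (insert i S))"
  by (simp add: ext_contr_def)

lemma ext_contr_add: "ext_contr i (a + b) = ext_contr i a + ext_contr i b"
  by (rule exterior_eqI) (simp add: coeff_ext_contr algebra_simps)

lemma ext_contr_const: "ext_contr i (a * ext_const c) = ext_contr i a * ext_const c"
  by (rule exterior_eqI) (simp add: coeff_ext_contr algebra_simps)

lemma ext_contr_zero [simp]: "ext_contr i 0 = 0"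
  by (rule exterior_eqI) (simp add: coeff_ext_contr)

text \<open>The Clifford relation between contraction and multiplication. It makes contraction a
  homotopy for the Koszul differential of a free module.\<close>

lemma ext_contr_var:
  "ext_contr i a * ext_var j + ext_contr i (a * ext_var j) = (if i = j then a else 0)"
proof (rule exterior_eqI)
  fix S :: "'b set"
  consider "i = j" | "i \<noteq> j" "i \<in> S" | "i \<noteq> j" "i \<notin> S" "j \<notin> S" | "i \<noteq> j" "i \<notin> S" "j \<in> S" by blast
  then show "coeff_ext (ext_contr i a * ext_var j + ext_contr i (a * ext_var j)) S =
      coeff_ext (if i = j then a else 0) S"
  proof cases
    case 1
    then show ?thesis
      by (auto simp: coeff_mult_var coeff_ext_contr insert_absorb simp flip: mult.assoc)
  next
    \<comment> \<open>The only case with i different from j in which both terms can be nonzero; x_i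
      and x_j pass each other with opposite signs.\<close>
    case 4
    define T where "T = S - {j}"
    have S: "S = insert j T" "j \<notin> T" "i \<notin> T" using 4 by (auto simp: T_def)
    have 1: "ext_sign (insert j T) {i} = (ext_sign T {i} * ext_sign {j} {i} :: 'a)"
      using ext_sign_Un_left[of T "{j}" "{i}"] S by simp
    have 2: "ext_sign (insert i T) {j} = (ext_sign T {j} * ext_sign {i} {j} :: 'a)"
      using ext_sign_Un_left[of T "{i}" "{j}"] S by simp
    have "insert i S - {j} = insert i T" using S 4 by auto
    moreover have "S - {j} = T" using S by auto
    ultimately have "coeff_ext (ext_contr i a * ext_var j + ext_contr i (a * ext_var j)) S =
      ext_sign T {j} * ext_sign T {i} * coeff_ext a (insert i T) +
       (ext_sign {i} {j} * ext_sign {j} {i}) * (ext_sign T {j} * ext_sign T {i} * coeff_ext a (insert i T))"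
      using 4 S(3) by (simp add: coeff_mult_var coeff_ext_contr 1 2 S(1) mult_ac)
    then show ?thesis using 4 by (simp add: ext_sign_singleton)
  qed (auto simp: coeff_mult_var coeff_ext_contr)
qed

lemma ext_const_grade: "ext_const c \<in> ext_grade 0"
  by (auto simp: ext_grade_def coeff_ext_const)

lemma ext_var_grade: "ext_var i \<in> ext_grade 1"
  by (auto simp: ext_grade_def ext_var_def)

lemma ext_contr_grade:
  assumes "a \<in> ext_grade n" shows "ext_contr i a \<in> ext_grade (n - 1)"
  unfolding ext_grade_def
proof (intro CollectI allI impI)
  fix S assume "coeff_ext (ext_contr i a) S \<noteq> 0"
  then have "i \<notin> S" "coeff_ext a (insert i S) \<noteq> 0"
    by (auto simp: coeff_ext_contr split: if_splits)
  then have "int (card (insert i S)) = n" "i \<notin> S" using assms unfolding ext_grade_def by blast+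
  then show "int (card S) = n - 1" by simp
qed

lemma ext_mult_grade:
  fixes a b :: "('k::comm_ring_1, 'n::{finite,linorder}) exterior"
  assumes a: "a \<in> ext_grade m" and b: "b \<in> ext_grade n" shows "a * b \<in> ext_grade (m + n)"
  unfolding ext_grade_def
proof (intro CollectI allI impI)
  fix U assume "coeff_ext (a * b) U \<noteq> 0"
  then obtain S where S: "S \<subseteq> U" and nz: "ext_sign S (U - S) * coeff_ext a S * coeff_ext b (U - S) \<noteq> 0"
    unfolding times_exterior_def exterior.sel by (metis (no_types, lifting) PowD sum.neutral)
  from nz have "coeff_ext a S \<noteq> 0" "coeff_ext b (U - S) \<noteq> 0" by auto
  then have "int (card S) = m" "int (card (U - S)) = n" using a b by (auto simp: ext_grade_def)
  moreover have "card U = card S + card (U - S)"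
    using S by (simp add: card_Diff_subset finite_subset[of S U] card_mono)
  ultimately show "int (card U) = m + n" by simp
qed

text \<open>A monomial arises from a scalar by multiplying indeterminates on the right. The sign
  that appears is absorbed into the scalar, which therefore stays arbitrary in the inner
  induction.\<close>

lemma exterior_induct [case_names const add var]:
  fixes a :: "('k::comm_ring_1, 'n::{finite,linorder}) exterior"
  assumes const: "\<And>c. P (ext_const c)"
    and add: "\<And>a b. P a \<Longrightarrow> P b \<Longrightarrow> P (a + b)"
    and var: "\<And>a i. P a \<Longrightarrow> P (a * ext_var i)"
  shows "P a"
proof -
  have mono: "P (Exterior (\<lambda>T. if T = S then c else 0))" for S c
  proof (induction S arbitrary: c rule: finite_induct[OF finite])
    case 1
    then show ?case using const[of c] by (simp add: ext_const_def)
  next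
    case (2 i S)
    have "Exterior (\<lambda>T. if T = insert i S then c else 0) =
        Exterior (\<lambda>T. if T = S then ext_sign S {i} * c else 0) * ext_var i"
      by (rule exterior_eqI) (use 2 in \<open>auto simp: coeff_mult_var simp flip: mult.assoc\<close>)
    then show ?case using var[OF "2.IH"] by simp
  qed
  have "P (\<Sum>S\<in>A. Exterior (\<lambda>T. if T = S then coeff_ext a S else 0))" for A
  proof (induction A rule: infinite_finite_induct)
    case (insert x F)
    then show ?case using add[OF mono] by simp
  qed (use const[of 0] in auto)
  moreover have "a = (\<Sum>S\<in>UNIV. Exterior (\<lambda>T. if T = S then coeff_ext a S else 0))"
    by (rule exterior_eqI) (simp add: coeff_ext_sum sum.delta)
  ultimately show ?thesis by (rule back_subst[where P=P, OF _ sym])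
qed

section \<open>Modules without grading\<close>

text \<open>In the bound on Ext, syzygies are free modules whose carrier is replaced while the
  grading is left as it was, so only these axioms are available for them.\<close>

locale ext_module =
  fixes M :: "('k::field, 'n::{finite,linorder}, 'm::ab_group_add) gmod"
  assumes carrier_subgroup: "add_subgroup (carrier M)"
    and act_closed: "x \<in> carrier M \<Longrightarrow> act M x a \<in> carrier M"
    and act_add_left: "\<lbrakk>x \<in> carrier M; y \<in> carrier M\<rbrakk> \<Longrightarrow> act M (x + y) a = act M x a + act M y a"
    and act_add_right: "x \<in> carrier M \<Longrightarrow> act M x (a + b) = act M x a + act M x b"
    and act_mult: "x \<in> carrier M \<Longrightarrow> act M x (a * b) = act M (act M x a) b"
    and act_one: "x \<in> carrier M \<Longrightarrow> act M x 1 = x"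
begin

lemma zero_closed [simp]: "0 \<in> carrier M"
  and add_closed: "x \<in> carrier M \<Longrightarrow> y \<in> carrier M \<Longrightarrow> x + y \<in> carrier M"
  and minus_closed: "x \<in> carrier M \<Longrightarrow> - x \<in> carrier M"
  using carrier_subgroup by (auto simp: add_subgroup_def)

lemma diff_closed: "x \<in> carrier M \<Longrightarrow> y \<in> carrier M \<Longrightarrow> x - y \<in> carrier M"
  using add_closed[of x "- y"] minus_closed[of y] by simp

lemma sum_closed: "(\<And>i. i \<in> A \<Longrightarrow> f i \<in> carrier M) \<Longrightarrow> sum f A \<in> carrier M"
  by (induction A rule: infinite_finite_induct) (auto intro: add_closed)

lemma act_zero_left [simp]: "act M 0 a = 0"
  using act_add_left[of 0 0 a] by simp

lemma act_zero_right: "x \<in> carrier M \<Longrightarrow> act M x 0 = 0"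
  using act_add_right[of x 0 0] by simp

lemma act_minus_left: "x \<in> carrier M \<Longrightarrow> act M (- x) a = - act M x a"
  using act_add_left[of x "- x" a] minus_closed[of x] by (simp add: eq_neg_iff_add_eq_0 add.commute)

lemma act_minus_right: "x \<in> carrier M \<Longrightarrow> act M x (- a) = - act M x a"
  using act_add_right[of x a "- a"] by (simp add: act_zero_right eq_neg_iff_add_eq_0 add.commute)

lemma act_diff_left:
  "x \<in> carrier M \<Longrightarrow> y \<in> carrier M \<Longrightarrow> act M (x - y) a = act M x a - act M y a"
  using act_add_left[of x "- y" a] minus_closed[of y] by (simp add: act_minus_left)

lemma act_sum_left:
  "(\<And>i. i \<in> A \<Longrightarrow> f i \<in> carrier M) \<Longrightarrow> act M (sum f A) a = (\<Sum>i\<in>A. act M (f i) a)"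
  by (induction A rule: infinite_finite_induct) (auto simp: act_add_left sum_closed)

lemma act_sum_right: "x \<in> carrier M \<Longrightarrow> act M x (sum a A) = (\<Sum>i\<in>A. act M x (a i))"
  by (induction A rule: infinite_finite_induct) (auto simp: act_add_right act_zero_right)

lemma act_var_anticommute:
  "x \<in> carrier M \<Longrightarrow> act M (act M x (ext_var i)) (ext_var j) = - act M (act M x (ext_var j)) (ext_var i)"
  using act_mult[of x "ext_var i" "ext_var j"] act_mult[of x "ext_var j" "ext_var i"]
    ext_var_anticommute[of i j] act_minus_right[of x] by metis

lemma act_var_square: "x \<in> carrier M \<Longrightarrow> act M (act M x (ext_var i)) (ext_var i) = 0"
  by (simp add: act_zero_right ext_var_square flip: act_mult)

lemma act_const_commute:
  "x \<in> carrier M \<Longrightarrow> act M (act M x (ext_const c)) a = act M (act M x a) (ext_const c)"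
  by (simp add: ext_const_commute flip: act_mult)

lemma act_const_const:
  "x \<in> carrier M \<Longrightarrow> act M (act M x (ext_const c)) (ext_const d) = act M x (ext_const (c * d))"
  by (simp add: ext_const_mult act_mult)

end

lemma graded_module_ext_module: "graded_module M \<Longrightarrow> ext_module M"
  unfolding graded_module_def ext_module_def by simp

text \<open>These maps are the coefficients of Koszul cochains; their homogeneity is tracked
  separately by \<open>shifts\<close>.\<close>

definition klinear :: "('k::field, 'n::{finite,linorder}, 'm::ab_group_add) gmod \<Rightarrow>
    ('k, 'n, 'p::ab_group_add) gmod \<Rightarrow> ('m \<Rightarrow> 'p) \<Rightarrow> bool" where
  "klinear M N f \<longleftrightarrow> (\<forall>x\<in>carrier M. f x \<in> carrier N) \<and>
    (\<forall>x\<in>carrier M. \<forall>y\<in>carrier M. f (x + y) = f x + f y) \<and>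
    (\<forall>x\<in>carrier M. \<forall>c. f (act M x (ext_const c)) = act N (f x) (ext_const c))"

lemma klinear_closed: "klinear M N f \<Longrightarrow> x \<in> carrier M \<Longrightarrow> f x \<in> carrier N"
  and klinear_add: "klinear M N f \<Longrightarrow> x \<in> carrier M \<Longrightarrow> y \<in> carrier M \<Longrightarrow> f (x + y) = f x + f y"
  and klinear_const: "klinear M N f \<Longrightarrow> x \<in> carrier M \<Longrightarrow>
    f (act M x (ext_const c)) = act N (f x) (ext_const c)"
  by (auto simp: klinear_def)

lemma klinear_zero: "klinear M N f \<Longrightarrow> ext_module M \<Longrightarrow> f 0 = 0"
  using klinear_add[of M N f 0 0] ext_module.zero_closed[of M] by simp

lemma klinear_minus:
  assumes "klinear M N f" "ext_module M" "x \<in> carrier M" shows "f (- x) = - f x"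
  using klinear_add[of M N f x "- x"] klinear_zero[of M N f] assms ext_module.minus_closed[of M x]
  by (simp add: eq_neg_iff_add_eq_0 add.commute)

lemma klinear_diff:
  assumes "klinear M N f" "ext_module M" "x \<in> carrier M" "y \<in> carrier M"
  shows "f (x - y) = f x - f y"
  using klinear_add[of M N f x "- y"] klinear_minus[of M N f y] assms ext_module.minus_closed[of M y]
  by simp

lemma klinear_sum:
  assumes "klinear M N f" "ext_module M" "\<And>i. i \<in> A \<Longrightarrow> g i \<in> carrier M"
  shows "f (sum g A) = (\<Sum>i\<in>A. f (g i))"
  using assms(3)
proof (induction A rule: infinite_finite_induct)
  case (insert x F)
  then show ?case
    using klinear_add[OF assms(1), of "g x" "sum g F"] ext_module.sum_closed[OF assms(2), of F g]
    by simp
qed (use klinear_zero[OF assms(1,2)] in auto)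

lemma klinear_comp: "klinear M N f \<Longrightarrow> klinear N P g \<Longrightarrow> klinear M P (\<lambda>x. g (f x))"
  by (simp add: klinear_def)

lemma klinear_id: "klinear M M (\<lambda>x. x)"
  by (simp add: klinear_def)

lemma klinear_zero_map: "ext_module N \<Longrightarrow> klinear M N (\<lambda>_. 0)"
  by (simp add: klinear_def ext_module.zero_closed ext_module.act_zero_left)

lemma klinear_add_map:
  "ext_module N \<Longrightarrow> klinear M N f \<Longrightarrow> klinear M N g \<Longrightarrow> klinear M N (\<lambda>x. f x + g x)"
  by (auto simp: klinear_def ext_module.add_closed ext_module.act_add_left)

lemma klinear_minus_map: "ext_module N \<Longrightarrow> klinear M N f \<Longrightarrow> klinear M N (\<lambda>x. - f x)"
  by (auto simp: klinear_def ext_module.minus_closed ext_module.act_minus_left)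

lemma klinear_diff_map:
  "ext_module N \<Longrightarrow> klinear M N f \<Longrightarrow> klinear M N g \<Longrightarrow> klinear M N (\<lambda>x. f x - g x)"
  using klinear_add_map[of N M f "\<lambda>x. - g x"] klinear_minus_map[of N M g] by simp

lemma klinear_sum_map:
  "ext_module N \<Longrightarrow> (\<And>i. i \<in> A \<Longrightarrow> klinear M N (f i)) \<Longrightarrow> klinear M N (\<lambda>x. \<Sum>i\<in>A. f i x)"
  by (induction A rule: infinite_finite_induct) (auto intro: klinear_zero_map klinear_add_map)

lemma klinear_act: "ext_module M \<Longrightarrow> klinear M M (\<lambda>x. act M x a)"
  by (auto simp: klinear_def ext_module.act_closed ext_module.act_add_left ext_module.act_const_commute)

lemma klinear_act_map: "ext_module N \<Longrightarrow> klinear M N f \<Longrightarrow> klinear M N (\<lambda>x. act N (f x) a)"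
  using klinear_comp klinear_act by blast

lemma klinear_subset:
  "klinear M N f \<Longrightarrow> A \<subseteq> carrier M \<Longrightarrow> klinear (M\<lparr>carrier := A\<rparr>) N f"
  by (simp add: klinear_def subset_iff)

text \<open>The indeterminates generate the algebra over the scalars, so commuting with them is all
  that has to be checked.\<close>

lemma klinear_hom:
  assumes M: "ext_module M" and N: "ext_module N" and f: "klinear M N f"
    and var: "\<And>x i. x \<in> carrier M \<Longrightarrow> f (act M x (ext_var i)) = act N (f x) (ext_var i)"
    and "x \<in> carrier M"
  shows "f (act M x a) = act N (f x) a"
proof -
  interpret M: ext_module M by fact
  interpret N: ext_module N by fact
  note fc = klinear_closed[OF f]
  have "\<forall>x\<in>carrier M. f (act M x a) = act N (f x) a"
  proof (induction a rule: exterior_induct)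
    case (const c)
    then show ?case using klinear_const[OF f] by blast
  next
    case (add a b)
    then show ?case
      using fc by (simp add: M.act_add_right N.act_add_right klinear_add[OF f] M.act_closed)
  next
    case (var a i)
    then show ?case
      using fc by (simp add: M.act_mult N.act_mult assms(4) M.act_closed)
  qed
  then show ?thesis using assms by blast
qed


section \<open>Koszul cochains\<close>

text \<open>The factor (-1)^n, as a case distinction because the ambient group has no
  scalars.\<close>

definition alt_sign :: "nat \<Rightarrow> 'm::ab_group_add \<Rightarrow> 'm" where
  "alt_sign n x = (if even n then x else - x)"

lemma alt_sign_simps [simp]:
  "alt_sign 0 x = x" "alt_sign (Suc n) x = - alt_sign n x"
  "alt_sign n (- x) = - alt_sign n x" "alt_sign n (0 :: 'm::ab_group_add) = 0"
  "alt_sign n (x + y) = alt_sign n x + alt_sign n y"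
  "alt_sign n (x - y) = alt_sign n x - alt_sign n y"
  "alt_sign n (alt_sign n x) = x"
  by (auto simp: alt_sign_def)

lemma alt_sign_sum: "alt_sign n (sum f A) = (\<Sum>i\<in>A. alt_sign n (f i))"
  by (auto simp: alt_sign_def sum_negf)

text \<open>Division of Y^\<alpha> by Y_i. Subtraction is truncated, so this is meaningful where
  \<open>0 < \<alpha> i\<close>, and the sum in \<open>kdiff\<close> runs over exactly these
  i.\<close>

abbreviation lower :: "('n \<Rightarrow> nat) \<Rightarrow> 'n \<Rightarrow> 'n \<Rightarrow> nat" where
  "lower \<alpha> i \<equiv> \<alpha>(i := \<alpha> i - 1)"

abbreviation raise :: "('n \<Rightarrow> nat) \<Rightarrow> 'n \<Rightarrow> 'n \<Rightarrow> nat" where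
  "raise \<alpha> i \<equiv> \<alpha>(i := Suc (\<alpha> i))"

definition mdeg :: "('n::finite \<Rightarrow> nat) \<Rightarrow> nat" where
  "mdeg \<alpha> = sum \<alpha> UNIV"

lemma mdeg_raise [simp]: "mdeg (raise \<alpha> i) = Suc (mdeg \<alpha>)"
  using sum.remove[of UNIV i \<alpha>] sum.remove[of UNIV i "raise \<alpha> i"]
  by (simp add: mdeg_def)

lemma mdeg_lower: "0 < \<alpha> i \<Longrightarrow> mdeg \<alpha> = Suc (mdeg (lower \<alpha> i))"
  using mdeg_raise[of "lower \<alpha> i" i] by simp

text \<open>
  A family \<open>z \<alpha> : G \<rightarrow> X\<close> stands for \<open>\<Sum>\<^sub>\<alpha> z\<^sub>\<alpha> Y\<^sup>\<alpha>\<close>, with commuting variables \<open>Y\<^sub>i\<close> dual to the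
  indeterminates \<open>x\<^sub>i\<close>.  With \<open>Q = \<Sum>\<^sub>i Y\<^sub>i x\<^sub>i\<close> the differential is the supercommutator with \<open>Q\<close>,
  where the parity is the degree in \<open>Y\<close>.  Its cohomology in degree \<open>n\<close> is \<open>Ext\<^sup>n(G, X)\<close>.
\<close>

definition kdiff :: "('k::field, 'n::{finite,linorder}, 'g::ab_group_add) gmod \<Rightarrow>
    ('k, 'n, 'm::ab_group_add) gmod \<Rightarrow> (('n \<Rightarrow> nat) \<Rightarrow> 'g \<Rightarrow> 'm) \<Rightarrow> ('n \<Rightarrow> nat) \<Rightarrow> 'g \<Rightarrow> 'm" where
  "kdiff G X z \<alpha> v = (\<Sum>i | 0 < \<alpha> i. act X (z (lower \<alpha> i) v) (ext_var i) +
    alt_sign (mdeg \<alpha>) (z (lower \<alpha> i) (act G v (ext_var i))))"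

text \<open>A family carries coefficients of all degrees at once, but the differential at \<alpha>
  sees only those of degree one less. Equalities known in a single degree can therefore be
  used.\<close>

lemma kdiff_cong:
  assumes "\<And>\<beta> w. mdeg \<alpha> = Suc (mdeg \<beta>) \<Longrightarrow> w \<in> carrier G \<Longrightarrow> z \<beta> w = z' \<beta> w"
    and "ext_module G" "v \<in> carrier G"
  shows "kdiff G X z \<alpha> v = kdiff G X z' \<alpha> v"
  unfolding kdiff_def
proof (rule sum.cong[OF refl])
  fix i assume "i \<in> {i. 0 < \<alpha> i}"
  then have "mdeg \<alpha> = Suc (mdeg (lower \<alpha> i))" by (simp add: mdeg_lower)
  then have "\<forall>w\<in>carrier G. z (lower \<alpha> i) w = z' (lower \<alpha> i) w" using assms(1) by blast
  then show "act X (z (lower \<alpha> i) v) (ext_var i) +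
    alt_sign (mdeg \<alpha>) (z (lower \<alpha> i) (act G v (ext_var i))) = act X (z' (lower \<alpha> i) v) (ext_var i) +
    alt_sign (mdeg \<alpha>) (z' (lower \<alpha> i) (act G v (ext_var i)))"
    using assms(2,3) by (simp add: ext_module.act_closed)
qed

lemma klinear_alt_sign: "ext_module N \<Longrightarrow> klinear M N f \<Longrightarrow> klinear M N (\<lambda>x. alt_sign n (f x))"
  by (cases "even n") (simp_all add: alt_sign_def klinear_minus_map)

lemma klinear_kdiff:
  assumes "ext_module G" "ext_module X" "\<And>\<alpha>. klinear G X (z \<alpha>)"
  shows "klinear G X (kdiff G X z \<alpha>)"
  unfolding kdiff_def
  by (intro klinear_sum_map klinear_add_map klinear_act_map klinear_alt_sign assms
      klinear_comp[OF klinear_act[OF assms(1)]])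

lemma kdiff_add:
  assumes "ext_module G" "ext_module X" "\<And>\<alpha>. klinear G X (z \<alpha>)" "\<And>\<alpha>. klinear G X (z' \<alpha>)" "v \<in> carrier G"
  shows "kdiff G X (\<lambda>\<alpha> v. z \<alpha> v + z' \<alpha> v) \<alpha> v = kdiff G X z \<alpha> v + kdiff G X z' \<alpha> v"
  using assms(1,2,5) unfolding kdiff_def
  by (simp add: ext_module.act_add_left klinear_closed[OF assms(3)] klinear_closed[OF assms(4)]
      add_ac flip: sum.distrib)

lemma kdiff_diff:
  assumes "ext_module G" "ext_module X" "\<And>\<alpha>. klinear G X (z \<alpha>)" "\<And>\<alpha>. klinear G X (z' \<alpha>)" "v \<in> carrier G"
  shows "kdiff G X (\<lambda>\<alpha> v. z \<alpha> v - z' \<alpha> v) \<alpha> v = kdiff G X z \<alpha> v - kdiff G X z' \<alpha> v"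
  using assms(1,2,5) unfolding kdiff_def
  by (simp add: ext_module.act_diff_left klinear_closed[OF assms(3)] klinear_closed[OF assms(4)]
      add_diff_add flip: sum_subtractf)

lemma kdiff_const:
  assumes "ext_module G" "ext_module X" "\<And>\<alpha>. klinear G X (z \<alpha>)" "v \<in> carrier G"
  shows "kdiff G X (\<lambda>\<alpha> v. act X (z \<alpha> v) (ext_const c)) \<alpha> v = act X (kdiff G X z \<alpha> v) (ext_const c)"
proof -
  interpret G: ext_module G by fact
  interpret X: ext_module X by fact
  note c = klinear_closed[OF assms(3)]
  have "act X (alt_sign n y) (ext_const c) = alt_sign n (act X y (ext_const c))"
    if "y \<in> carrier X" for y n
    using that by (auto simp: alt_sign_def X.act_minus_left)
  moreover have "alt_sign n y \<in> carrier X" if "y \<in> carrier X" for y n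
    using that by (auto simp: alt_sign_def X.minus_closed)
  ultimately show ?thesis
    unfolding kdiff_def using assms(4)
    by (subst X.act_sum_left)
      (auto simp: X.act_add_left c X.act_closed G.act_closed X.add_closed X.act_const_commute
        intro!: sum.cong)
qed

lemma kdiff_sum:
  assumes "ext_module G" "ext_module X" "\<And>j \<alpha>. j \<in> J \<Longrightarrow> klinear G X (z j \<alpha>)" "v \<in> carrier G"
  shows "kdiff G X (\<lambda>\<alpha> v. \<Sum>j\<in>J. z j \<alpha> v) \<alpha> v = (\<Sum>j\<in>J. kdiff G X (z j) \<alpha> v)"
  using assms(3)
proof (induction J rule: infinite_finite_induct)
  case (insert j J)
  then show ?case
    using kdiff_add[OF assms(1,2), of "z j" "\<lambda>\<alpha> v. \<Sum>j\<in>J. z j \<alpha> v"] klinear_sum_map[OF assms(2), of J G]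
      assms(4) by simp
qed (simp_all add: kdiff_def ext_module.act_zero_left[OF assms(2)])

text \<open>Characteristic two is allowed, where antisymmetry does not make the diagonal terms
  vanish; hence the separate hypothesis on them.\<close>

lemma antisymmetric_sum:
  fixes t :: "'n::linorder \<Rightarrow> 'n \<Rightarrow> 'm::ab_group_add"
  assumes "finite T" "\<And>i j. (i, j) \<in> T \<Longrightarrow> (j, i) \<in> T"
    and anti: "\<And>i j. (i, j) \<in> T \<Longrightarrow> t i j = - t j i" and diag: "\<And>i. (i, i) \<in> T \<Longrightarrow> t i i = 0"
  shows "(\<Sum>(i, j)\<in>T. t i j) = 0"
proof -
  let ?A = "{(i, j) \<in> T. i < j}" and ?B = "{(i, j) \<in> T. j < i}" and ?D = "{(i, j) \<in> T. i = j}"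
  have f: "finite ?A" "finite ?B" "finite ?D" using assms(1) by (auto intro: finite_subset[of _ T])
  have T: "T = ?A \<union> ?B \<union> ?D" by auto
  have "(\<Sum>(i, j)\<in>?A. t i j) = (\<Sum>(i, j)\<in>?B. - t i j)"
    by (rule sum.reindex_bij_witness[where i = "\<lambda>(i, j). (j, i)" and j = "\<lambda>(i, j). (j, i)"])
      (auto intro: assms(2) anti[symmetric])
  then have AB: "(\<Sum>(i, j)\<in>?A. t i j) + (\<Sum>(i, j)\<in>?B. t i j) = 0"
    by (simp add: case_prod_unfold sum_negf)
  have D: "(\<Sum>(i, j)\<in>?D. t i j) = 0" by (rule sum.neutral) (use diag in auto)
  have "(\<Sum>(i, j)\<in>T. t i j) = (\<Sum>(i, j)\<in>?A \<union> ?B. t i j) + (\<Sum>(i, j)\<in>?D. t i j)"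
    by (subst T, subst sum.union_disjoint) (use f in auto)
  also have "(\<Sum>(i, j)\<in>?A \<union> ?B. t i j) = (\<Sum>(i, j)\<in>?A. t i j) + (\<Sum>(i, j)\<in>?B. t i j)"
    by (subst sum.union_disjoint) (use f in auto)
  finally show ?thesis using AB D by simp
qed

text \<open>This is Q^2 = 0: the Y_i commute and the x_i anticommute. The two mixed terms, with one
  x on either side of h, are together antisymmetric in i and j.\<close>

lemma kdiff_kdiff:
  assumes "ext_module G" "ext_module X" and h: "\<And>\<alpha>. klinear G X (h \<alpha>)" and v: "v \<in> carrier G"
  shows "kdiff G X (kdiff G X h) \<alpha> v = 0"
proof -
  interpret G: ext_module G by fact
  interpret X: ext_module X by fact
  note c [simp] = klinear_closed[OF h] G.act_closed X.act_closed v
  \<comment> \<open>Ordered pairs of variables that can be removed one after the other; (i, i)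
    occurs exactly when Y_i^2 divides Y^\<alpha>.\<close>
  define T where "T = Sigma {i. 0 < \<alpha> i} (\<lambda>i. {j. 0 < (lower \<alpha> i) j})"
  define N where "N = mdeg \<alpha>"
  define t where "t i j = (let h' = h (lower (lower \<alpha> i) j) in
      act X (act X (h' v) (ext_var j)) (ext_var i)
      - alt_sign N (act X (h' (act G v (ext_var j))) (ext_var i))
      + alt_sign N (act X (h' (act G v (ext_var i))) (ext_var j))
      - h' (act G (act G v (ext_var i)) (ext_var j)))" for i j
  have sgn: "act X (alt_sign n y) a = alt_sign n (act X y a)" "alt_sign n y \<in> carrier X"
    if "y \<in> carrier X" for y n a
    using that by (auto simp: alt_sign_def X.act_minus_left X.minus_closed)
  have "act X (kdiff G X h (lower \<alpha> i) v) (ext_var i) +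
      alt_sign N (kdiff G X h (lower \<alpha> i) (act G v (ext_var i))) =
      (\<Sum>j | 0 < (lower \<alpha> i) j. t i j)" if "0 < \<alpha> i" for i
  proof -
    have N: "N = Suc (mdeg (lower \<alpha> i))" using that unfolding N_def by (rule mdeg_lower)
    have "act X (kdiff G X h (lower \<alpha> i) v) (ext_var i) =
      (\<Sum>j | 0 < (lower \<alpha> i) j. act X (act X (h (lower (lower \<alpha> i) j) v) (ext_var j) +
        alt_sign (mdeg (lower \<alpha> i)) (h (lower (lower \<alpha> i) j) (act G v (ext_var j)))) (ext_var i))"
      unfolding kdiff_def by (rule X.act_sum_left) (intro X.add_closed sgn c)
    then show ?thesis
      unfolding kdiff_def alt_sign_sum N t_def Let_def
      by (simp add: X.act_add_left sgn algebra_simps flip: sum.distrib)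
  qed
  then have "kdiff G X (kdiff G X h) \<alpha> v = (\<Sum>i | 0 < \<alpha> i. \<Sum>j | 0 < (lower \<alpha> i) j. t i j)"
    unfolding kdiff_def[of G X "kdiff G X h"] N_def by (intro sum.cong) auto
  also have "\<dots> = (\<Sum>(i, j)\<in>T. t i j)" unfolding T_def by (simp add: sum.Sigma)
  also have "\<dots> = 0"
  proof (rule antisymmetric_sum)
    show "finite T" by simp
    show "(j, i) \<in> T" if "(i, j) \<in> T" for i j
      using that by (auto simp: T_def split: if_splits)
    show "t i i = 0" for i
      using G.act_var_square[OF v] by (simp add: t_def Let_def X.act_var_square klinear_zero[OF h assms(1)])
    show "t i j = - t j i" for i j
    proof -
      have comm: "lower (lower \<alpha> i) j = lower (lower \<alpha> j) i" by (auto simp: fun_eq_iff)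
      show ?thesis
        unfolding t_def comm Let_def
        using X.act_var_anticommute[of "h (lower (lower \<alpha> j) i) v" j i]
          G.act_var_anticommute[OF v, of i j]
        by (simp add: klinear_minus[OF h assms(1)])
    qed
  qed
  finally show ?thesis .
qed

section \<open>Free modules\<close>

lemma free_gmod_simps [simp]:
  "carrier (free_gmod ds) = {v. \<forall>j\<ge>length ds. v j = 0}"
  "act (free_gmod ds) v a = (\<lambda>j. v j * a)"
  "grade (free_gmod ds) n =
    {v. (\<forall>j\<ge>length ds. v j = 0) \<and> (\<forall>j<length ds. v j \<in> ext_grade (n - ds ! j))}"
  by (simp_all add: free_gmod_def)

lemma ext_module_free: "ext_module (free_gmod ds)"
  by unfold_locales (auto simp: add_subgroup_def fun_eq_iff algebra_simps)

lemma sum_fun_apply: "sum f A x = (\<Sum>i\<in>A. f i x)"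
  by (induction A rule: infinite_finite_induct) auto

lemma add_subgroup_ext_grade: "add_subgroup (ext_grade n)"
proof -
  have "a + b \<in> ext_grade n" if "a \<in> ext_grade n" "b \<in> ext_grade n"
    for a b :: "('a, 'b) exterior"
    unfolding ext_grade_def
  proof (intro CollectI allI impI)
    fix S assume "coeff_ext (a + b) S \<noteq> 0"
    then have "coeff_ext a S \<noteq> 0 \<or> coeff_ext b S \<noteq> 0" by auto
    then show "int (card S) = n" using that by (auto simp: ext_grade_def)
  qed
  moreover have "0 \<in> ext_grade n" "a \<in> ext_grade n \<Longrightarrow> - a \<in> ext_grade n" for a :: "('a, 'b) exterior"
    by (simp_all add: ext_grade_def)
  ultimately show ?thesis by (simp add: add_subgroup_def)
qed

lemma free_grade_closed:
  "add_subgroup (grade (free_gmod ds) n)"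
  using add_subgroup_ext_grade[unfolded add_subgroup_def] unfolding add_subgroup_def free_gmod_simps
  by (simp, blast)

text \<open>The homogeneous component of degree n. The test on j places it in the free module for
  arbitrary v.\<close>

definition free_comp ::
    "int list \<Rightarrow> int \<Rightarrow> (nat \<Rightarrow> ('k::field, 'n::{finite,linorder}) exterior) \<Rightarrow> nat \<Rightarrow> ('k, 'n) exterior" where
  "free_comp ds n v j = Exterior (\<lambda>S. if j < length ds \<and> int (card S) = n - ds ! j then coeff_ext (v j) S else 0)"

text \<open>The coefficient of x_S in slot j lives in the single degree
  \<open>ds ! j + int (card S)\<close>, so a decomposition into components can be read off
  coefficientwise.\<close>

lemma free_comp_eq:
  fixes v :: "nat \<Rightarrow> ('k::field, 'n::{finite,linorder}) exterior"
  assumes "finite {n. c n \<noteq> 0}" "\<And>n. c n \<in> grade (free_gmod ds) n" "v = (\<Sum>n | c n \<noteq> 0. c n)"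
  shows "c n = free_comp ds n v"
proof (intro ext exterior_eqI)
  fix j S
  have *: "coeff_ext (c m j) S = 0" if "j \<ge> length ds \<or> m \<noteq> ds ! j + int (card S)" for m
  proof (cases "j < length ds")
    case True
    then have "c m j \<in> ext_grade (m - ds ! j)" using assms(2)[of m] by simp
    then show ?thesis using that True by (force simp: ext_grade_def)
  qed (use assms(2)[of m] in simp)
  have "coeff_ext (v j) S = (\<Sum>m | c m \<noteq> 0. coeff_ext (c m j) S)"
    by (simp add: assms(3) sum_fun_apply coeff_ext_sum)
  also have "\<dots> = (\<Sum>m | c m \<noteq> 0. if m = ds ! j + int (card S) then coeff_ext (c m j) S else 0)"
    by (intro sum.cong refl) (use * in auto)
  also have "\<dots> = coeff_ext (c (ds ! j + int (card S)) j) S"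
    using assms(1) by (subst sum.delta) auto
  finally show "coeff_ext (c n j) S = coeff_ext (free_comp ds n v j) S"
    using *[of n] by (auto simp: free_comp_def algebra_simps)
qed

lemma free_comp_grade: "free_comp ds n v \<in> grade (free_gmod ds) n"
  by (auto simp: free_comp_def ext_grade_def intro!: exterior_eqI)

lemma free_comp_finite:
  fixes v :: "nat \<Rightarrow> ('k::field, 'n::{finite,linorder}) exterior"
  shows "finite {n. free_comp ds n v \<noteq> 0}"
proof (rule finite_subset)
  show "{n. free_comp ds n v \<noteq> 0} \<subseteq> (\<lambda>(j, S :: 'n set). ds ! j + int (card S)) ` ({..<length ds} \<times> UNIV)"
  proof
    fix n assume "n \<in> {n. free_comp ds n v \<noteq> 0}"
    then obtain j S where "coeff_ext (free_comp ds n v j) S \<noteq> 0"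
      by (auto simp: fun_eq_iff ext_eq_iff)
    then have "j < length ds" "n = ds ! j + int (card S)"
      by (auto simp: free_comp_def split: if_splits)
    then show "n \<in> (\<lambda>(j, S :: 'n set). ds ! j + int (card S)) ` ({..<length ds} \<times> UNIV)"
      by (intro image_eqI[of _ _ "(j, S)"]) auto
  qed
qed auto

lemma free_comp_sum:
  assumes "v \<in> carrier (free_gmod ds)"
  shows "v = (\<Sum>n | free_comp ds n v \<noteq> 0. free_comp ds n v)"
proof (intro ext exterior_eqI)
  fix j S
  have "coeff_ext ((\<Sum>n | free_comp ds n v \<noteq> 0. free_comp ds n v) j) S =
      (\<Sum>n | free_comp ds n v \<noteq> 0. if n = ds ! j + int (card S) then
        if j < length ds then coeff_ext (v j) S else 0 else 0)"
    unfolding sum_fun_apply coeff_ext_sum by (intro sum.cong refl) (auto simp: free_comp_def)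
  also have "\<dots> = (if free_comp ds (ds ! j + int (card S)) v \<noteq> 0 \<and> j < length ds then coeff_ext (v j) S else 0)"
    by (subst sum.delta) (auto simp: free_comp_finite)
  also have "\<dots> = coeff_ext (v j) S"
  proof (cases "j < length ds \<and> coeff_ext (v j) S \<noteq> 0")
    case True
    then have "coeff_ext (free_comp ds (ds ! j + int (card S)) v j) S \<noteq> 0"
      by (simp add: free_comp_def)
    then have "free_comp ds (ds ! j + int (card S)) v \<noteq> 0" by auto
    then show ?thesis using True by simp
  next
    case False
    moreover have "v j = 0" if "\<not> j < length ds" using assms that by simp
    ultimately show ?thesis by auto
  qed
  finally show "coeff_ext (v j) S = coeff_ext ((\<Sum>n | free_comp ds n v \<noteq> 0. free_comp ds n v) j) S"
    by simp
qed

lemma graded_module_free: "graded_module (free_gmod ds :: ('k::field, 'n::{finite,linorder}, _) gmod)"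
proof -
  let ?F = "free_gmod ds :: ('k, 'n, _) gmod"
  interpret ext_module ?F by (rule ext_module_free)
  show ?thesis
  proof (intro graded_module.intro)
    fix v assume v: "v \<in> carrier ?F"
    show "\<exists>!c. finite {n. c n \<noteq> 0} \<and> (\<forall>n. c n \<in> grade ?F n) \<and> v = (\<Sum>n | c n \<noteq> 0. c n)"
    proof (rule ex1I[of _ "\<lambda>n. free_comp ds n v"])
      show "finite {n. free_comp ds n v \<noteq> 0} \<and> (\<forall>n. free_comp ds n v \<in> grade ?F n) \<and>
          v = (\<Sum>n | free_comp ds n v \<noteq> 0. free_comp ds n v)"
        using free_comp_finite free_comp_grade free_comp_sum[OF v] by blast
      show "c = (\<lambda>n. free_comp ds n v)"
        if "finite {n. c n \<noteq> 0} \<and> (\<forall>n. c n \<in> grade ?F n) \<and> v = (\<Sum>n | c n \<noteq> 0. c n)" for c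
        using that by (intro ext free_comp_eq) auto
    qed
  next
    fix x m a n assume "x \<in> grade ?F m" "a \<in> (ext_grade n :: ('k, 'n) exterior set)"
    then show "act ?F x a \<in> grade ?F (m + n)"
      using ext_mult_grade[of "x _" "m - ds ! _" a n] by (auto simp: algebra_simps)
  next
    show "add_subgroup (grade ?F n)" for n by (rule free_grade_closed)
    show "grade ?F n \<subseteq> carrier ?F" for n by auto
  qed (fact carrier_subgroup act_closed act_add_left act_add_right act_mult act_one)+
qed

section \<open>Linear algebra in free modules\<close>

definition vec_scale :: "'k \<Rightarrow> (nat \<Rightarrow> ('k::field, 'n::{finite,linorder}) exterior) \<Rightarrow> nat \<Rightarrow> ('k, 'n) exterior" where
  "vec_scale c v = (\<lambda>j. v j * ext_const c)"

text \<open>All free modules share one ambient type, so this single vector space provides bases and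
  complements for all their subspaces.\<close>

interpretation vec: vector_space vec_scale
  by unfold_locales
    (auto simp: vec_scale_def fun_eq_iff algebra_simps ext_const_add mult.commute simp flip: ext_const_mult)

interpretation vec_pair: vector_space_pair vec_scale vec_scale ..

lemma act_free_const: "act (free_gmod ds) v (ext_const c) = vec_scale c v"
  by (simp add: vec_scale_def)

lemma vec_projection:
  assumes "vec.subspace T"
  obtains p where "\<And>x y. p (x + y) = p x + p y" "\<And>c x. p (vec_scale c x) = vec_scale c (p x)"
    "\<And>x. p x \<in> T" "\<And>x. x \<in> T \<Longrightarrow> p x = x"
proof -
  obtain g where "g ` UNIV \<subseteq> T" "Vector_Spaces.linear vec_scale vec_scale g" "\<forall>v\<in>T. g (id v) = v"
    using vec_pair.linear_exists_left_inverse_on[OF vec.linear_id assms] by (auto simp: id_def)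
  then show thesis
    by (intro that[of g]) (auto simp: Vector_Spaces.linear_iff)
qed

text \<open>The ambient type of W is only a group, so preimages are first chosen arbitrarily.
  Subtracting the projection to the kernel of p makes the result independent of the choice, hence
  linear.\<close>

lemma klinear_section:
  fixes W :: "('k::field, 'n::{finite,linorder}, 'w::ab_group_add) gmod"
  assumes W: "ext_module W" and p: "klinear (free_gmod ds) W p"
    and onto: "p ` carrier (free_gmod ds) = carrier W"
  obtains g where "klinear W (free_gmod ds) g" "\<And>w. w \<in> carrier W \<Longrightarrow> p (g w) = w"
proof -
  let ?F = "free_gmod ds :: ('k, 'n, _) gmod"
  interpret F: ext_module ?F by (rule ext_module_free)
  interpret W: ext_module W by fact
  define T where "T = {v \<in> carrier ?F. p v = 0}"
  have "vec.subspace T"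
    using klinear_zero[OF p F.ext_module_axioms] klinear_add[OF p] klinear_const[OF p]
    by (auto simp: T_def vec.subspace_def vec_scale_def)
  then obtain q where q: "\<And>x y. q (x + y) = q x + q y" "\<And>c x. q (vec_scale c x) = vec_scale c (q x)"
    "\<And>x. q x \<in> T" "\<And>x. x \<in> T \<Longrightarrow> q x = x" using vec_projection by blast
  have q_diff: "q (x - y) = q x - q y" for x y using q(1)[of "x - y" y] by (simp add: algebra_simps)
  define s where "s w = (SOME v. v \<in> carrier ?F \<and> p v = w)" for w
  have s: "s w \<in> carrier ?F" "p (s w) = w" if "w \<in> carrier W" for w
  proof -
    have "\<exists>v. v \<in> carrier ?F \<and> p v = w" using that onto by (metis imageE)
    then have "s w \<in> carrier ?F \<and> p (s w) = w" unfolding s_def by (rule someI_ex)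
    then show "s w \<in> carrier ?F" "p (s w) = w" by auto
  qed
  have eq: "v - q v = v' - q v'" if "v \<in> carrier ?F" "v' \<in> carrier ?F" "p v = p v'" for v v'
  proof -
    have "v - v' \<in> T" using that klinear_diff[OF p F.ext_module_axioms] F.diff_closed[of v v']
      by (auto simp: T_def)
    then show ?thesis using q(4)[of "v - v'"] by (simp add: q_diff algebra_simps)
  qed
  have T_sub: "q x \<in> carrier ?F" "p (q x) = 0" for x using q(3)[of x] by (auto simp: T_def)
  define g where "g w = s w - q (s w)" for w
  show thesis
  proof
    show "klinear W ?F g"
      unfolding klinear_def
    proof (intro conjI ballI allI)
      fix x y assume x: "x \<in> carrier W" and y: "y \<in> carrier W"
      show "g x \<in> carrier ?F" unfolding g_def using s(1)[OF x] T_sub(1) by (rule F.diff_closed)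
      have "g (x + y) = (s x + s y) - q (s x + s y)"
        unfolding g_def using s x y W.add_closed[OF x y] F.add_closed[of "s x" "s y"]
        by (intro eq) (auto simp: klinear_add[OF p])
      then show "g (x + y) = g x + g y" by (simp add: g_def q algebra_simps)
    next
      fix x and c :: 'k assume x: "x \<in> carrier W"
      have "g (act W x (ext_const c)) = vec_scale c (s x) - q (vec_scale c (s x))"
        unfolding g_def act_free_const[symmetric, of _ _ ds]
        using s x W.act_closed[OF x] F.act_closed[of "s x"]
        by (intro eq) (auto simp: klinear_const[OF p] simp del: free_gmod_simps)
      then show "g (act W x (ext_const c)) = act ?F (g x) (ext_const c)"
        by (simp add: g_def q act_free_const vec.scale_right_diff_distrib del: free_gmod_simps)
    qed
    show "p (g w) = w" if "w \<in> carrier W" for w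
      using s[OF that] T_sub by (simp add: g_def klinear_diff[OF p F.ext_module_axioms] del: free_gmod_simps)
  qed
qed

text \<open>Precomposition with a linear projection onto A.\<close>

lemma klinear_extend:
  fixes X :: "('k::field, 'n::{finite,linorder}, 'm::ab_group_add) gmod"
  assumes A: "A \<subseteq> carrier (free_gmod ds)" "ext_module ((free_gmod ds)\<lparr>carrier := A\<rparr>)"
    and f: "klinear ((free_gmod ds)\<lparr>carrier := A\<rparr>) X f"
  obtains f' where "klinear (free_gmod ds) X f'" "\<And>v. v \<in> A \<Longrightarrow> f' v = f v"
proof -
  interpret A: ext_module "(free_gmod ds)\<lparr>carrier := A\<rparr>" by fact
  have "vec.subspace A"
    using A.zero_closed A.add_closed A.act_closed[of _ "ext_const _"]
    by (auto simp: vec.subspace_def vec_scale_def)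
  then obtain q where q: "\<And>x y. q (x + y) = q x + q y" "\<And>c x. q (vec_scale c x) = vec_scale c (q x)"
    "\<And>x. q x \<in> A" "\<And>x. x \<in> A \<Longrightarrow> q x = x" using vec_projection by blast
  have "klinear (free_gmod ds) X (\<lambda>v. f (q v))"
    using klinear_closed[OF f] klinear_add[OF f] klinear_const[OF f] q(1,3)
    unfolding klinear_def act_free_const q(2) by (simp add: vec_scale_def)
  then show thesis using q(4) by (intro that[of "\<lambda>v. f (q v)"]) auto
qed

section \<open>Exactness of the Koszul complex of a free module\<close>

definition free_contr :: "'n \<Rightarrow> (nat \<Rightarrow> ('k::field, 'n::{finite,linorder}) exterior) \<Rightarrow> nat \<Rightarrow> ('k, 'n) exterior" where
  "free_contr i v = (\<lambda>j. ext_contr i (v j))"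

lemma klinear_contr: "klinear (free_gmod ds) (free_gmod ds) (free_contr i)"
  by (auto simp: klinear_def free_contr_def ext_contr_add ext_contr_const)

lemma free_contr_act:
  "act (free_gmod ds) (free_contr i v) (ext_var j) + free_contr i (act (free_gmod ds) v (ext_var j)) =
    (if i = j then v else 0)"
  by (cases "i = j") (simp_all add: fun_eq_iff free_contr_def ext_contr_var)

text \<open>Homogeneity of degree q. It has to be carried along because Ext is formed from
  homomorphisms of degree zero.\<close>

definition shifts :: "('k::field, 'n::{finite,linorder}, 'm::ab_group_add) gmod \<Rightarrow>
    ('k, 'n, 'p::ab_group_add) gmod \<Rightarrow> int \<Rightarrow> ('m \<Rightarrow> 'p) \<Rightarrow> bool" where
  "shifts M N q f \<longleftrightarrow> (\<forall>n. \<forall>v\<in>grade M n. f v \<in> grade N (n + q))"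

lemma shifts_contr: "shifts (free_gmod ds) (free_gmod ds) (- 1) (free_contr i)"
  by (auto simp: shifts_def free_contr_def) (use ext_contr_grade in \<open>force simp: algebra_simps\<close>)

lemma shifts_act_var: "graded_module M \<Longrightarrow> shifts M M 1 (\<lambda>v. act M v (ext_var i))"
  by (auto simp: shifts_def ext_var_grade intro: graded_module.act_grade)

lemma shifts_comp: "shifts M N p f \<Longrightarrow> shifts N P q g \<Longrightarrow> shifts M P (p + q) (\<lambda>v. g (f v))"
  by (auto simp: shifts_def simp flip: add.assoc)

lemma shifts_zero_map: "graded_module N \<Longrightarrow> shifts M N q (\<lambda>_. 0)"
  using graded_module.grade_subgroup[of N] by (auto simp: shifts_def add_subgroup_def)

lemma shifts_add_map:
  "graded_module N \<Longrightarrow> shifts M N q f \<Longrightarrow> shifts M N q g \<Longrightarrow> shifts M N q (\<lambda>v. f v + g v)"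
  using graded_module.grade_subgroup[of N] by (auto simp: shifts_def add_subgroup_def)

lemma shifts_minus_map:
  "graded_module N \<Longrightarrow> shifts M N q f \<Longrightarrow> shifts M N q (\<lambda>v. - f v)"
  using graded_module.grade_subgroup[of N] by (auto simp: shifts_def add_subgroup_def)

lemma shifts_diff_map:
  "graded_module N \<Longrightarrow> shifts M N q f \<Longrightarrow> shifts M N q g \<Longrightarrow> shifts M N q (\<lambda>v. f v - g v)"
  using shifts_add_map[of N M q f "\<lambda>v. - g v"] shifts_minus_map[of N M q g] by simp

lemma shifts_sum_map:
  "graded_module N \<Longrightarrow> (\<And>i. i \<in> A \<Longrightarrow> shifts M N q (f i)) \<Longrightarrow> shifts M N q (\<lambda>v. \<Sum>i\<in>A. f i v)"
  by (induction A rule: infinite_finite_induct) (auto intro: shifts_zero_map shifts_add_map)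

lemma shifts_alt_sign: "graded_module N \<Longrightarrow> shifts M N q f \<Longrightarrow> shifts M N q (\<lambda>v. alt_sign n (f v))"
  by (cases "even n") (simp_all add: alt_sign_def shifts_minus_map)

lemma shifts_kdiff:
  assumes "graded_module G" "graded_module X" "\<And>\<alpha>. shifts G X q (z \<alpha>)"
  shows "shifts G X (q + 1) (kdiff G X z \<alpha>)"
proof -
  have "shifts G X (1 + q) (\<lambda>v. z \<beta> (act G v (ext_var i)))" for \<beta> i
    by (intro shifts_comp[OF shifts_act_var] assms)
  then have "shifts G X (q + 1) (\<lambda>v. z \<beta> (act G v (ext_var i)))" for \<beta> i
    by (simp add: add.commute)
  then show ?thesis
    unfolding kdiff_def
    by (intro shifts_sum_map shifts_add_map shifts_alt_sign shifts_comp[OF _ shifts_act_var] assms)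
qed

text \<open>
  Contracting along \<open>x\<^sub>i\<close> removes from a cocycle all terms divisible by \<open>Y\<^sub>i\<close>, and it does not
  create new terms.
\<close>

lemma koszul_step:
  fixes X :: "('k::field, 'n::{finite,linorder}, 'm::ab_group_add) gmod"
  assumes X: "graded_module X" and z: "\<And>\<alpha>. klinear (free_gmod ds) X (z \<alpha>)"
    and cocycle: "\<forall>\<alpha>. \<forall>v\<in>carrier (free_gmod ds). mdeg \<alpha> = Suc m \<longrightarrow> kdiff (free_gmod ds) X z \<alpha> v = 0"
  shows "\<exists>h. (\<forall>\<beta>. klinear (free_gmod ds) X (h \<beta>)) \<and>
    (\<forall>q. (\<forall>\<alpha>. shifts (free_gmod ds) X q (z \<alpha>)) \<longrightarrow> (\<forall>\<beta>. shifts (free_gmod ds) X (q - 1) (h \<beta>))) \<and>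
    (\<forall>\<alpha>. \<forall>v\<in>carrier (free_gmod ds). mdeg \<alpha> = m \<longrightarrow> 0 < \<alpha> i \<longrightarrow> z \<alpha> v = kdiff (free_gmod ds) X h \<alpha> v) \<and>
    (\<forall>\<alpha>. \<forall>v\<in>carrier (free_gmod ds). mdeg \<alpha> = m \<longrightarrow> \<alpha> i = 0 \<longrightarrow>
      (\<forall>v\<in>carrier (free_gmod ds). z \<alpha> v = 0) \<longrightarrow> kdiff (free_gmod ds) X h \<alpha> v = 0)"
proof -
  let ?G = "free_gmod ds :: ('k, 'n, _) gmod"
  let ?\<delta> = "free_contr i :: (nat \<Rightarrow> ('k, 'n) exterior) \<Rightarrow> _"
  have Xe: "ext_module X" using X by (rule graded_module_ext_module)
  interpret X: ext_module X by fact
  interpret G: ext_module ?G by (rule ext_module_free)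
  note zc = klinear_closed[OF z]
  have dc: "?\<delta> v \<in> carrier ?G" if "v \<in> carrier ?G" for v
    using klinear_closed[OF klinear_contr that] .
  define h where "h \<beta> v = alt_sign m (z (raise \<beta> i) (?\<delta> v))" for \<beta> v
  \<comment> \<open>\<open>t\<close> is the summand at j of the differential of h at \<alpha>.
    \<open>u\<close> is, up to sign, the summand of the differential of z at Y_i Y^\<alpha>,
    evaluated at the contraction of v. The sum of the \<open>u\<close> vanishes by the cocycle
    condition, and by the Clifford relation \<open>t - u\<close> is z at \<alpha> for j = i and zero
    otherwise.\<close>
  define t where "t \<alpha> v j = alt_sign m (act X (z (lower (raise \<alpha> i) j) (?\<delta> v)) (ext_var j))
      + z (lower (raise \<alpha> i) j) (?\<delta> (act ?G v (ext_var j)))" for \<alpha> v j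
  define u where "u \<alpha> v j = alt_sign m (act X (z (lower (raise \<alpha> i) j) (?\<delta> v)) (ext_var j))
      - z (lower (raise \<alpha> i) j) (act ?G (?\<delta> v) (ext_var j))" for \<alpha> v j
  have act_alt: "act X (alt_sign n y) a = alt_sign n (act X y a)" if "y \<in> carrier X" for y n a
    using that by (auto simp: alt_sign_def X.act_minus_left)
  have kh: "kdiff ?G X h \<alpha> v = (\<Sum>j | 0 < \<alpha> j. t \<alpha> v j)"
    if "mdeg \<alpha> = m" "v \<in> carrier ?G" for \<alpha> v
    unfolding kdiff_def
  proof (rule sum.cong[OF refl])
    fix j assume "j \<in> {j. 0 < \<alpha> j}"
    then have "raise (lower \<alpha> j) i = lower (raise \<alpha> i) j" by (auto simp: fun_eq_iff)
    then show "act X (h (lower \<alpha> j) v) (ext_var j) + alt_sign (mdeg \<alpha>) (h (lower \<alpha> j) (act ?G v (ext_var j)))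
        = t \<alpha> v j"
      using that dc[OF that(2)] by (simp add: h_def t_def act_alt zc del: free_gmod_simps)
  qed
  have u0: "(\<Sum>j | 0 < raise \<alpha> i j. u \<alpha> v j) = 0" if "mdeg \<alpha> = m" "v \<in> carrier ?G" for \<alpha> v
  proof -
    have "(\<Sum>j | 0 < raise \<alpha> i j. u \<alpha> v j) = alt_sign m (kdiff ?G X z (raise \<alpha> i) (?\<delta> v))"
      unfolding kdiff_def u_def using that by (simp add: alt_sign_sum del: free_gmod_simps fun_upd_apply)
    also have "\<dots> = 0" using cocycle that dc by simp
    finally show ?thesis .
  qed
  have diff: "t \<alpha> v j - u \<alpha> v j = (if i = j then z \<alpha> v else 0)" if v: "v \<in> carrier ?G" for \<alpha> v j
  proof -
    have "t \<alpha> v j - u \<alpha> v j = z (lower (raise \<alpha> i) j) (act ?G (?\<delta> v) (ext_var j))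
        + z (lower (raise \<alpha> i) j) (?\<delta> (act ?G v (ext_var j)))"
      by (simp add: t_def u_def)
    also have "\<dots> = z (lower (raise \<alpha> i) j) (if i = j then v else 0)"
      using dc v G.act_closed
      by (subst klinear_add[OF z, symmetric]) (simp_all add: free_contr_act del: free_gmod_simps)
    also have "\<dots> = (if i = j then z \<alpha> v else 0)"
      using klinear_zero[OF z ext_module_free] by auto
    finally show ?thesis .
  qed
  show ?thesis
  proof (rule exI[of _ h], intro conjI allI impI ballI)
    show "klinear ?G X (h \<beta>)" for \<beta>
      unfolding h_def by (intro klinear_alt_sign Xe klinear_comp[OF klinear_contr] z)
    show "shifts ?G X (q - 1) (h \<beta>)" if "\<forall>\<alpha>. shifts ?G X q (z \<alpha>)" for q \<beta>
      using shifts_alt_sign[OF X shifts_comp[OF shifts_contr that[rule_format]], of m] by (simp add: h_def[abs_def])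
    show "z \<alpha> v = kdiff ?G X h \<alpha> v" if "v \<in> carrier ?G" "mdeg \<alpha> = m" "0 < \<alpha> i" for \<alpha> v
    proof -
      have "{j. 0 < raise \<alpha> i j} = {j. 0 < \<alpha> j}" using that by auto
      then have "kdiff ?G X h \<alpha> v = (\<Sum>j | 0 < \<alpha> j. t \<alpha> v j - u \<alpha> v j)"
        using kh[OF that(2,1)] u0[OF that(2,1)] by (simp add: sum_subtractf)
      also have "\<dots> = z \<alpha> v" unfolding diff[OF that(1)] using that by simp
      finally show ?thesis by simp
    qed
    show "kdiff ?G X h \<alpha> v = 0" if v: "v \<in> carrier ?G" and "mdeg \<alpha> = m" and "\<alpha> i = 0"
      and z0: "\<forall>v\<in>carrier ?G. z \<alpha> v = 0" for \<alpha> v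
    proof -
      \<comment> \<open>The index i occurs in the cocycle condition but not in the differential of
        h; its term involves z at \<alpha>, which is zero.\<close>
      have "{j. 0 < raise \<alpha> i j} = insert i {j. 0 < \<alpha> j}" by auto
      moreover have "u \<alpha> v i = 0"
        using dc[OF v] G.act_closed z0 by (simp add: u_def del: free_gmod_simps)
      ultimately have "(\<Sum>j | 0 < \<alpha> j. u \<alpha> v j) = 0"
        using u0[OF that(2) v] \<open>\<alpha> i = 0\<close> by simp
      then have "kdiff ?G X h \<alpha> v = (\<Sum>j | 0 < \<alpha> j. t \<alpha> v j - u \<alpha> v j)"
        using kh[OF that(2) v] by (simp add: sum_subtractf)
      also have "\<dots> = 0" unfolding diff[OF v] using \<open>\<alpha> i = 0\<close> by (intro sum.neutral) auto
      finally show ?thesis .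
    qed
  qed
qed

text \<open>Free modules have no higher extensions. The variables are treated one at a time: once
  those in A are done, a remainder can survive only at monomials without variables from A. The shift
  clause is an implication, so that the lemma also serves cochains without a degree.\<close>

lemma koszul_exact:
  fixes X :: "('k::field, 'n::{finite,linorder}, 'm::ab_group_add) gmod"
  assumes X: "graded_module X" and z: "\<And>\<alpha>. klinear (free_gmod ds) X (z \<alpha>)"
    and cocycle: "\<forall>\<alpha>. \<forall>v\<in>carrier (free_gmod ds). mdeg \<alpha> = Suc m \<longrightarrow> kdiff (free_gmod ds) X z \<alpha> v = 0"
    and m: "0 < m"
  shows "\<exists>h. (\<forall>\<beta>. klinear (free_gmod ds) X (h \<beta>)) \<and>
    (\<forall>q. (\<forall>\<alpha>. shifts (free_gmod ds) X q (z \<alpha>)) \<longrightarrow> (\<forall>\<beta>. shifts (free_gmod ds) X (q - 1) (h \<beta>))) \<and>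
    (\<forall>\<alpha>. \<forall>v\<in>carrier (free_gmod ds). mdeg \<alpha> = m \<longrightarrow> z \<alpha> v = kdiff (free_gmod ds) X h \<alpha> v)"
proof -
  let ?G = "free_gmod ds :: ('k, 'n, _) gmod"
  have Xe: "ext_module X" using X by (rule graded_module_ext_module)
  have Ge: "ext_module ?G" by (rule ext_module_free)
  have "\<exists>h. (\<forall>\<beta>. klinear ?G X (h \<beta>)) \<and>
      (\<forall>q. (\<forall>\<alpha>. shifts ?G X q (z \<alpha>)) \<longrightarrow> (\<forall>\<beta>. shifts ?G X (q - 1) (h \<beta>))) \<and>
      (\<forall>\<alpha> v. mdeg \<alpha> = m \<longrightarrow> v \<in> carrier ?G \<longrightarrow> (\<exists>i\<in>A. 0 < \<alpha> i) \<longrightarrow> z \<alpha> v = kdiff ?G X h \<alpha> v)" for A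
  proof (induction A rule: finite_induct[OF finite])
    case 1
    show ?case
      by (rule exI[of _ "\<lambda>_ _. 0"]) (simp add: klinear_zero_map Xe shifts_zero_map X)
  next
    case (2 i A)
    then obtain h where h': "\<forall>\<beta>. klinear ?G X (h \<beta>)"
      and hs: "\<forall>q. (\<forall>\<alpha>. shifts ?G X q (z \<alpha>)) \<longrightarrow> (\<forall>\<beta>. shifts ?G X (q - 1) (h \<beta>))"
      and hz: "\<forall>\<alpha> v. mdeg \<alpha> = m \<longrightarrow> v \<in> carrier ?G \<longrightarrow> (\<exists>i\<in>A. 0 < \<alpha> i) \<longrightarrow> z \<alpha> v = kdiff ?G X h \<alpha> v"
      by (elim exE conjE)
    note h = h'[rule_format]
    define z' where "z' \<alpha> v = z \<alpha> v - kdiff ?G X h \<alpha> v" for \<alpha> v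
    have dh: "klinear ?G X (kdiff ?G X h \<alpha>)" for \<alpha> by (intro klinear_kdiff h Ge Xe)
    have z': "klinear ?G X (z' \<alpha>)" for \<alpha>
      unfolding z'_def[abs_def] by (intro klinear_diff_map z dh Xe)
    have "\<forall>\<alpha>. \<forall>v\<in>carrier ?G. mdeg \<alpha> = Suc m \<longrightarrow> kdiff ?G X z' \<alpha> v = 0"
    proof (intro allI ballI impI)
      fix \<alpha> :: "'n \<Rightarrow> nat" and v assume "v \<in> carrier ?G" "mdeg \<alpha> = Suc m"
      then show "kdiff ?G X z' \<alpha> v = 0"
        unfolding z'_def[abs_def] kdiff_diff[OF Ge Xe z dh \<open>v \<in> carrier ?G\<close>]
        using cocycle kdiff_kdiff[OF Ge Xe h \<open>v \<in> carrier ?G\<close>] by simp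
    qed
    from koszul_step[OF X z' this, of i] obtain h'
      where h': "\<forall>\<beta>. klinear ?G X (h' \<beta>)"
      and hs': "\<forall>q. (\<forall>\<alpha>. shifts ?G X q (z' \<alpha>)) \<longrightarrow> (\<forall>\<beta>. shifts ?G X (q - 1) (h' \<beta>))"
      and hz': "\<forall>\<alpha>. \<forall>v\<in>carrier ?G. mdeg \<alpha> = m \<longrightarrow> 0 < \<alpha> i \<longrightarrow> z' \<alpha> v = kdiff ?G X h' \<alpha> v"
      and hz0: "\<forall>\<alpha>. \<forall>v\<in>carrier ?G. mdeg \<alpha> = m \<longrightarrow> \<alpha> i = 0 \<longrightarrow>
        (\<forall>v\<in>carrier ?G. z' \<alpha> v = 0) \<longrightarrow> kdiff ?G X h' \<alpha> v = 0"
      by (elim exE conjE)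
    define H where "H \<beta> v = h \<beta> v + h' \<beta> v" for \<beta> v
    have "klinear ?G X (H \<beta>)" for \<beta>
      unfolding H_def[abs_def] by (intro klinear_add_map h h'[rule_format] Xe)
    moreover have "shifts ?G X (q - 1) (H \<beta>)" if s: "\<forall>\<alpha>. shifts ?G X q (z \<alpha>)" for q \<beta>
    proof -
      have "shifts ?G X (q - 1 + 1) (kdiff ?G X h \<alpha>)" for \<alpha>
        by (intro shifts_kdiff graded_module_free X hs[rule_format] s[rule_format])
      then have "shifts ?G X q (z' \<alpha>)" for \<alpha>
        unfolding z'_def[abs_def] using s by (intro shifts_diff_map X) simp_all
      then show ?thesis unfolding H_def[abs_def] using s by (intro shifts_add_map X hs[rule_format] hs'[rule_format]) simp_all
    qed
    moreover have "z \<alpha> v = kdiff ?G X H \<alpha> v"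
      if "mdeg \<alpha> = m" and v: "v \<in> carrier ?G" and "\<exists>j\<in>insert i A. 0 < \<alpha> j" for \<alpha> v
    proof -
      have "z' \<alpha> v = kdiff ?G X h' \<alpha> v"
      proof (cases "0 < \<alpha> i")
        case True
        then show ?thesis using hz' that by blast
      next
        \<comment> \<open>Y_i is absent but an earlier variable occurs, so the remainder is already
          zero, and the new correction keeps it zero.\<close>
        case False
        then have "\<exists>j\<in>A. 0 < \<alpha> j" using that by auto
        then have "z' \<alpha> w = 0" if "w \<in> carrier ?G" for w
          using hz \<open>mdeg \<alpha> = m\<close> that by (simp add: z'_def)
        then show ?thesis using hz0 False v \<open>mdeg \<alpha> = m\<close> by (simp add: z'_def)
      qed
      then show ?thesis
        unfolding H_def[abs_def] kdiff_add[OF Ge Xe h h'[rule_format] v] by (simp add: z'_def algebra_simps)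
    qed
    ultimately show ?case by (intro exI[of _ H] conjI allI impI) simp_all
  qed
  from this[of UNIV] obtain h where h: "\<forall>\<beta>. klinear ?G X (h \<beta>)"
    "\<forall>q. (\<forall>\<alpha>. shifts ?G X q (z \<alpha>)) \<longrightarrow> (\<forall>\<beta>. shifts ?G X (q - 1) (h \<beta>))"
    "\<forall>\<alpha> v. mdeg \<alpha> = m \<longrightarrow> v \<in> carrier ?G \<longrightarrow> (\<exists>i\<in>UNIV. 0 < \<alpha> i) \<longrightarrow> z \<alpha> v = kdiff ?G X h \<alpha> v"
    by (elim exE conjE)
  have "\<exists>i. 0 < \<alpha> i" if "mdeg \<alpha> = m" for \<alpha> :: "'n \<Rightarrow> nat"
    using that m by (auto simp: mdeg_def intro: ccontr)
  with h show ?thesis by (intro exI[of _ h]) simp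
qed

section \<open>Vanishing of the first self-extension group\<close>

lemma graded_unique:
  assumes M: "graded_module M" and "finite A"
    and "\<And>n. c n \<in> grade M n" "\<And>n. d n \<in> grade M n"
    and "\<And>n. n \<notin> A \<Longrightarrow> c n = 0" "\<And>n. n \<notin> A \<Longrightarrow> d n = 0" and eq: "sum c A = sum d A"
  shows "c = d"
proof -
  interpret M: graded_module M by fact
  interpret M: ext_module M using M by (rule graded_module_ext_module)
  have restrict: "finite {n. e n \<noteq> 0} \<and> (\<forall>n. e n \<in> grade M n) \<and> sum e A = (\<Sum>n | e n \<noteq> 0. e n)"
    if "\<And>n. e n \<in> grade M n" "\<And>n. n \<notin> A \<Longrightarrow> e n = 0" for e
  proof (intro conjI allI that)
    have sub: "{n. e n \<noteq> 0} \<subseteq> A" using that(2) by auto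
    show "finite {n. e n \<noteq> 0}" using sub \<open>finite A\<close> by (rule finite_subset)
    show "sum e A = (\<Sum>n | e n \<noteq> 0. e n)"
      by (rule sum.mono_neutral_right) (use sub \<open>finite A\<close> in auto)
  qed
  have "sum c A \<in> carrier M"
    using assms(3) M.grade_subset by (intro M.sum_closed) blast
  from M.grade_direct_sum[OF this] restrict[OF assms(3,5)] restrict[OF assms(4,6)] eq
  show ?thesis by (metis (no_types, lifting))
qed

lemma graded_hom_klinear: "f \<in> graded_hom M N \<Longrightarrow> klinear M N f"
  and graded_hom_shifts: "f \<in> graded_hom M N \<Longrightarrow> shifts M N 0 f"
  and graded_hom_act: "f \<in> graded_hom M N \<Longrightarrow> x \<in> carrier M \<Longrightarrow> f (act M x a) = act N (f x) a"
  and graded_hom_outside: "f \<in> graded_hom M N \<Longrightarrow> x \<notin> carrier M \<Longrightarrow> f x = 0"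
  by (auto simp: graded_hom_def klinear_def shifts_def)

text \<open>A map of degree zero respects homogeneous components. This supplies homogeneous
  preimages and shows that kernels are graded.\<close>

lemma graded_hom_free_comp:
  fixes X :: "('k::field, 'n::{finite,linorder}, 'm::ab_group_add) gmod"
  assumes X: "graded_module X" and p: "p \<in> graded_hom (free_gmod ds) X"
    and v: "v \<in> carrier (free_gmod ds)" and x: "p v \<in> grade X n"
  shows "p (free_comp ds m v) = (if m = n then p v else 0)"
proof -
  let ?F = "free_gmod ds :: ('k, 'n, _) gmod"
  note pl = graded_hom_klinear[OF p]
  have Fe: "ext_module ?F" by (rule ext_module_free)
  define A where "A = insert n {m. free_comp ds m v \<noteq> 0}"
  have fin: "finite A" by (simp add: A_def free_comp_finite)
  have fc: "free_comp ds m v \<in> grade ?F m" for m by (rule free_comp_grade)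
  have "(\<Sum>m\<in>A. p (free_comp ds m v)) = p (\<Sum>m\<in>A. free_comp ds m v)"
    using fc by (intro klinear_sum[OF pl Fe, symmetric]) (auto simp: free_comp_def zero_exterior_def)
  also have "(\<Sum>m\<in>A. free_comp ds m v) = (\<Sum>m | free_comp ds m v \<noteq> 0. free_comp ds m v)"
    by (rule sum.mono_neutral_right[OF fin]) (auto simp: A_def)
  also have "\<dots> = v" using free_comp_sum[OF v] by simp
  also have "p v = (\<Sum>m\<in>A. if m = n then p v else 0)" using fin by (simp add: A_def)
  finally have eq: "(\<Sum>m\<in>A. p (free_comp ds m v)) = (\<Sum>m\<in>A. if m = n then p v else 0)" .
  have "(\<lambda>m. p (free_comp ds m v)) = (\<lambda>m. if m = n then p v else 0)"
  proof (rule graded_unique[OF X fin _ _ _ _ eq])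
    show "p (free_comp ds m v) \<in> grade X m" for m
      using graded_hom_shifts[OF p] fc[of m] unfolding shifts_def by fastforce
    show "(if m = n then p v else 0) \<in> grade X m" for m
      using x graded_module.grade_subgroup[OF X, of m] by (auto simp: add_subgroup_def)
    show "p (free_comp ds m v) = 0" if "m \<notin> A" for m
      using that klinear_zero[OF pl Fe] by (simp add: A_def)
    show "(if m = n then p v else 0) = 0" if "m \<notin> A" for m
      using that by (auto simp: A_def)
  qed
  then show ?thesis by (simp add: fun_eq_iff)
qed

abbreviation unit_exp :: "'n \<Rightarrow> 'n \<Rightarrow> nat" where
  "unit_exp i \<equiv> (\<lambda>k. if k = i then 1 else 0)"

lemma mdeg_eq_0: "mdeg \<alpha> = 0 \<longleftrightarrow> \<alpha> = (\<lambda>_. 0)"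
  by (auto simp: mdeg_def fun_eq_iff)

lemma mdeg_unit [simp]: "mdeg (unit_exp i) = Suc 0"
  by (simp add: mdeg_def)

text \<open>
  Only those first order deformations \<open>x\<^sub>i + \<epsilon> f\<^sub>i\<close> are needed in which every \<open>f\<^sub>i\<close> anticommutes with all
  indeterminates.
\<close>

definition rigid :: "('k::field, 'n::{finite,linorder}, 'm::ab_group_add) gmod \<Rightarrow> bool" where
  "rigid X \<longleftrightarrow> (\<forall>f. (\<forall>i. klinear X X (f i)) \<longrightarrow> (\<forall>i. shifts X X 1 (f i)) \<longrightarrow>
    (\<forall>i j. \<forall>x\<in>carrier X. act X (f i x) (ext_var j) + f i (act X x (ext_var j)) = 0) \<longrightarrow>
    (\<exists>g. klinear X X g \<and> shifts X X 0 g \<and>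
      (\<forall>x\<in>carrier X. \<forall>i. f i x = act X (g x) (ext_var i) - g (act X x (ext_var i)))))"

text \<open>
  A first order deformation of \<open>X\<close>, pulled back to the free module \<open>F\<^sub>0\<close>, is a Koszul cocycle of degree
  one, hence trivialised by some \<open>L : F\<^sub>0 \<rightarrow> X\<close>.  The restriction of \<open>L\<close> to the first syzygy is a
  homomorphism; subtracting an extension of it to \<open>F\<^sub>0\<close> makes \<open>L\<close> descend to \<open>X\<close>.
\<close>

lemma trivial_cocycles_rigid:
  fixes X :: "('k::field, 'n::{finite,linorder}, 'm::ab_group_add) gmod"
  assumes X: "graded_module X" and F: "free_resolution X F"
    and ext: "cocycles F 1 X \<subseteq> coboundaries F 1 X"
  shows "rigid X"
  unfolding rigid_def
proof (intro allI impI)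
  fix f :: "'n \<Rightarrow> 'm \<Rightarrow> 'm"
  assume f': "\<forall>i. klinear X X (f i)" and fs': "\<forall>i. shifts X X 1 (f i)"
    and anti: "\<forall>i j. \<forall>x\<in>carrier X. act X (f i x) (ext_var j) + f i (act X x (ext_var j)) = 0"
  note f = f'[rule_format] and fs = fs'[rule_format]
  let ?G = "res_mod F 0" and ?a = "aug F" and ?d = "diff F 0"
  have Xe: "ext_module X" using X by (rule graded_module_ext_module)
  have Ge: "ext_module ?G" by (rule ext_module_free)
  interpret X: ext_module X by fact
  interpret G: ext_module ?G by fact
  have a: "?a \<in> graded_hom ?G X" and d: "?d \<in> graded_hom (res_mod F 1) ?G"
    and dd: "diff F 1 \<in> graded_hom (res_mod F (Suc 1)) (res_mod F 1)"
    and onto: "?a ` carrier ?G = carrier X"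
    and ex0: "?d ` carrier (res_mod F 1) = {v \<in> carrier ?G. ?a v = 0}"
    and ex1: "diff F 1 ` carrier (res_mod F (Suc 1)) = {v \<in> carrier (res_mod F 1). ?d v = 0}"
    using F[unfolded free_resolution_def] by (simp_all del: free_gmod_simps)
  note al = graded_hom_klinear[OF a] and dl = graded_hom_klinear[OF d]
  note ac = klinear_closed[OF al] and dc = klinear_closed[OF dl]
  \<comment> \<open>A cochain has values at all exponents; at the exponent of Y_i the choice returns
    i.\<close>
  define z where "z \<alpha> v = f (SOME i. \<alpha> i \<noteq> 0) (?a v)" for \<alpha> :: "'n \<Rightarrow> nat" and v
  have z_unit: "z (unit_exp i) v = f i (?a v)" for i v
    by (simp add: z_def)
  have zl: "klinear ?G X (z \<alpha>)" for \<alpha>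
    unfolding z_def[abs_def] by (intro klinear_comp[OF al] f)
  have zs: "shifts ?G X 1 (z \<alpha>)" for \<alpha>
    using shifts_comp[OF graded_hom_shifts[OF a] fs] by (simp add: z_def[abs_def])
  \<comment> \<open>In degree two the sign is plus, and every summand vanishes by itself because
    each f anticommutes with all indeterminates.\<close>
  have "\<forall>\<alpha>. \<forall>v\<in>carrier ?G. mdeg \<alpha> = Suc 1 \<longrightarrow> kdiff ?G X z \<alpha> v = 0"
    using anti ac graded_hom_act[OF a]
    by (auto simp: kdiff_def alt_sign_def z_def simp del: free_gmod_simps intro!: sum.neutral)
  from koszul_exact[OF X zl this] obtain h
    where h: "\<forall>\<beta>. klinear ?G X (h \<beta>)"
      and hs: "\<forall>q. (\<forall>\<alpha>. shifts ?G X q (z \<alpha>)) \<longrightarrow> (\<forall>\<beta>. shifts ?G X (q - 1) (h \<beta>))"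
      and hz: "\<forall>\<alpha>. \<forall>v\<in>carrier ?G. mdeg \<alpha> = 1 \<longrightarrow> z \<alpha> v = kdiff ?G X h \<alpha> v"
    by auto
  \<comment> \<open>The coefficient of degree zero, whose commutator with x_i is the pullback of
    \<open>f i\<close>.\<close>
  define L where "L = h (\<lambda>_. 0)"
  have Ll: "klinear ?G X L" using h by (simp add: L_def)
  have Ls: "shifts ?G X 0 L" using hs[rule_format, of 1] zs by (simp add: L_def)
  have L: "f i (?a v) = act X (L v) (ext_var i) - L (act ?G v (ext_var i))" if "v \<in> carrier ?G" for i v
  proof -
    have "f i (?a v) = kdiff ?G X h (unit_exp i) v"
      using hz[rule_format, OF that, of "unit_exp i"] by (simp add: z_unit)
    also have "{k. 0 < unit_exp i k} = {i}" by auto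
    then have "kdiff ?G X h (unit_exp i) v =
        act X (h (lower (unit_exp i) i) v) (ext_var i) - h (lower (unit_exp i) i) (act ?G v (ext_var i))"
      unfolding kdiff_def by simp
    also have "lower (unit_exp i) i = (\<lambda>_. 0)" by auto
    finally show ?thesis by (simp add: L_def)
  qed
  define c where "c v = L (?d v)" for v
  have cl: "klinear (res_mod F 1) X c" unfolding c_def[abs_def] by (rule klinear_comp[OF dl Ll])
  have ad: "?a (?d v) = 0" if "v \<in> carrier (res_mod F 1)" for v
    using ex0 that by blast
  have "c \<circ> diff F 1 = 0"
  proof
    fix v show "(c \<circ> diff F 1) v = 0 v"
    proof (cases "v \<in> carrier (res_mod F (Suc 1))")
      case True
      then have "?d (diff F 1 v) = 0" using ex1 by blast
      then show ?thesis using klinear_zero[OF Ll Ge] by (simp add: c_def)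
    next
      case False
      then have "diff F 1 v = 0" using graded_hom_outside[OF dd] by blast
      then show ?thesis using klinear_zero[OF cl ext_module_free] by simp
    qed
  qed
  moreover have "c \<in> graded_hom (res_mod F 1) X"
    unfolding graded_hom_def
  proof (intro CollectI conjI allI ballI impI)
    show "c x \<in> carrier X" if "x \<in> carrier (res_mod F 1)" for x using klinear_closed[OF cl that] .
    show "c (x + y) = c x + c y" if "x \<in> carrier (res_mod F 1)" "y \<in> carrier (res_mod F 1)" for x y
      using klinear_add[OF cl that] .
    show "c (act (res_mod F 1) x r) = act X (c x) r" if "x \<in> carrier (res_mod F 1)" for x r
    proof (rule klinear_hom[OF ext_module_free Xe cl _ that])
      fix y i assume y: "y \<in> carrier (res_mod F 1)"
      \<comment> \<open>On the image of the differential the pullback of \<open>f i\<close>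
        vanishes, so L commutes there with the indeterminates.\<close>
      have "L (act ?G (?d y) (ext_var i)) = act X (L (?d y)) (ext_var i)"
        using L[OF dc[OF y], of i] ad[OF y] klinear_zero[OF f Xe] by simp
      then show "c (act (res_mod F 1) y (ext_var i)) = act X (c y) (ext_var i)"
        unfolding c_def graded_hom_act[OF d y] .
    qed
    show "c x \<in> grade X n" if "x \<in> grade (res_mod F 1) n" for n x
      using that shifts_comp[OF graded_hom_shifts[OF d] Ls] unfolding shifts_def c_def by fastforce
    show "c x = 0" if "x \<notin> carrier (res_mod F 1)" for x
      unfolding c_def graded_hom_outside[OF d that] by (rule klinear_zero[OF Ll Ge])
  qed
  ultimately have "c \<in> cocycles F 1 X" by (simp add: cocycles_def)
  then have "c \<in> coboundaries F 1 X" using ext by blast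
  then obtain g0 where g0: "g0 \<in> graded_hom ?G X" and g0c: "c = g0 \<circ> ?d"
    unfolding coboundaries_def One_nat_def by auto
  define N where "N v = L v - g0 v" for v
  have Nl: "klinear ?G X N"
    unfolding N_def[abs_def] by (intro klinear_diff_map Xe Ll graded_hom_klinear[OF g0])
  have Ns: "shifts ?G X 0 N"
    unfolding N_def[abs_def] by (intro shifts_diff_map X Ls graded_hom_shifts[OF g0])
  have Nvar: "f i (?a v) = act X (N v) (ext_var i) - N (act ?G v (ext_var i))" if v: "v \<in> carrier ?G" for i v
    using L[OF v] klinear_closed[OF Ll v] klinear_closed[OF graded_hom_klinear[OF g0] v]
    by (simp add: N_def graded_hom_act[OF g0 v] X.act_diff_left del: free_gmod_simps)
  have N0: "N v = 0" if "v \<in> carrier ?G" "?a v = 0" for v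
  proof -
    have "v \<in> ?d ` carrier (res_mod F 1)" unfolding ex0 using that by simp
    then obtain w where "v = ?d w" by (rule imageE)
    then have "N v = c w - (g0 \<circ> ?d) w" by (simp add: N_def c_def)
    then show ?thesis using g0c by simp
  qed
  have Neq: "N v = N w" if "v \<in> carrier ?G" "w \<in> carrier ?G" "?a v = ?a w" for v w
  proof -
    have "N (v - w) = 0"
      using that by (intro N0 G.diff_closed) (simp_all only: klinear_diff[OF al Ge] diff_self)
    then show ?thesis unfolding klinear_diff[OF Nl Ge that(1,2)] by simp
  qed
  obtain s where sl: "klinear X ?G s" and as: "\<And>x. x \<in> carrier X \<Longrightarrow> ?a (s x) = x"
    using klinear_section[OF Xe al onto] by blast
  note sc = klinear_closed[OF sl]
  define g where "g x = N (s x)" for x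
  show "\<exists>g. klinear X X g \<and> shifts X X 0 g \<and>
    (\<forall>x\<in>carrier X. \<forall>i. f i x = act X (g x) (ext_var i) - g (act X x (ext_var i)))"
  proof (intro exI[of _ g] conjI ballI allI)
    show "klinear X X g" unfolding g_def[abs_def] by (rule klinear_comp[OF sl Nl])
    show "shifts X X 0 g"
      unfolding shifts_def
    proof (intro allI ballI)
      fix n x assume x: "x \<in> grade X n"
      then have xc: "x \<in> carrier X" using graded_module.grade_subset[OF X] by blast
      \<comment> \<open>The linear section need not respect degrees. The component of degree n of
        its value is another preimage of x, and N agrees on the two.\<close>
      define w where "w = free_comp (degs F 0) n (s x)"
      have w: "w \<in> grade ?G n" unfolding w_def by (rule free_comp_grade)
      have "?a w = x"
        unfolding w_def using graded_hom_free_comp[OF X a sc[OF xc], of n n] as[OF xc] x by simp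
      then have "g x = N w" unfolding g_def using w as[OF xc] sc[OF xc] by (intro Neq) auto
      then show "g x \<in> grade X (n + 0)" using Ns w unfolding shifts_def by fastforce
    qed
    fix x i assume x: "x \<in> carrier X"
    have "N (s (act X x (ext_var i))) = N (act ?G (s x) (ext_var i))"
      using x sc X.act_closed G.act_closed as graded_hom_act[OF a sc[OF x]]
      by (intro Neq) (simp_all del: free_gmod_simps)
    then show "f i x = act X (g x) (ext_var i) - g (act X x (ext_var i))"
      using Nvar[OF sc[OF x], of i] as[OF x] by (simp add: g_def del: free_gmod_simps)
  qed
qed

text \<open>The unit of the quotient is the set of coboundaries itself. If it is the only coset, it
  contains every cocycle f, because f lies in its own coset: zero is a coboundary.\<close>

lemma trivial_Ext_cocycles:
  assumes "carrier (Ext_group 1 X Y) = {\<one>\<^bsub>Ext_group 1 X Y\<^esub>}" and Y: "graded_module Y"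
  defines "F \<equiv> (SOME F. free_resolution X F)"
  shows "cocycles F 1 Y \<subseteq> coboundaries F 1 Y"
proof
  fix f assume f: "f \<in> cocycles F 1 Y"
  let ?Z = "\<lparr>carrier = cocycles F 1 Y, monoid.mult = (+), one = 0\<rparr>"
  let ?B = "coboundaries F 1 Y"
  have "?B #>\<^bsub>?Z\<^esub> f = ?B"
    using assms(1) f unfolding Ext_group_def F_def[symmetric] Let_def FactGroup_def RCOSETS_def
    by (auto simp: set_eq_iff)
  moreover have "0 \<in> ?B"
  proof -
    have "(\<lambda>_. 0) \<in> graded_hom (res_mod F 0) Y"
      using graded_module.grade_subgroup[OF Y] graded_module_ext_module[OF Y]
      by (auto simp: graded_hom_def add_subgroup_def ext_module.zero_closed ext_module.act_zero_left)
    then have "(\<lambda>_. 0) \<circ> diff F 0 \<in> ?B" unfolding coboundaries_def One_nat_def by auto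
    then show ?thesis by (simp add: comp_def zero_fun_def)
  qed
  ultimately show "f \<in> ?B" by (force simp: r_coset_def)
qed

section \<open>Existence of minimal free resolutions\<close>

text \<open>Generators are stored with a degree as second component, from which the degree list of a
  free cover is read off.\<close>

definition act_span :: "('k::field, 'n::{finite,linorder}, 'm::ab_group_add) gmod \<Rightarrow> ('m \<times> int) set \<Rightarrow> 'm set" where
  "act_span X H = {x. \<exists>a. x = (\<Sum>p\<in>H. act X (fst p) (a p))}"

lemma act_span_closed:
  assumes X: "ext_module X" and H: "finite H" "\<And>p. p \<in> H \<Longrightarrow> fst p \<in> carrier X"
  shows "0 \<in> act_span X H"
    and "x \<in> act_span X H \<Longrightarrow> y \<in> act_span X H \<Longrightarrow> x + y \<in> act_span X H"
    and "x \<in> act_span X H \<Longrightarrow> act X x r \<in> act_span X H"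
    and "p \<in> H \<Longrightarrow> fst p \<in> act_span X H"
proof -
  interpret X: ext_module X by fact
  show "0 \<in> act_span X H"
  proof -
    have "(\<Sum>p\<in>H. act X (fst p) 0) = 0" using H(2) by (intro sum.neutral ballI X.act_zero_right)
    then show ?thesis unfolding act_span_def by (intro CollectI exI[of _ "\<lambda>_. 0"]) simp
  qed
  show "x + y \<in> act_span X H" if "x \<in> act_span X H" "y \<in> act_span X H"
  proof -
    from that obtain a b where "x = (\<Sum>p\<in>H. act X (fst p) (a p))" "y = (\<Sum>p\<in>H. act X (fst p) (b p))"
      unfolding act_span_def by blast
    then have "x + y = (\<Sum>p\<in>H. act X (fst p) (a p + b p))"
      using H by (simp add: X.act_add_right sum.distrib)
    then show ?thesis unfolding act_span_def by (intro CollectI exI[of _ "\<lambda>p. a p + b p"])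
  qed
  show "act X x r \<in> act_span X H" if "x \<in> act_span X H"
  proof -
    from that obtain a where "x = (\<Sum>p\<in>H. act X (fst p) (a p))"
      unfolding act_span_def by blast
    then have "act X x r = (\<Sum>p\<in>H. act X (fst p) (a p * r))"
      using H by (simp add: X.act_mult X.act_sum_left X.act_closed)
    then show ?thesis unfolding act_span_def by (intro CollectI exI[of _ "\<lambda>p. a p * r"])
  qed
  show "fst p \<in> act_span X H" if "p \<in> H"
  proof -
    have "(\<Sum>q\<in>H. act X (fst q) (if q = p then 1 else 0)) = (\<Sum>q\<in>H. if q = p then fst p else 0)"
      using H by (intro sum.cong) (auto simp: X.act_one X.act_zero_right)
    also have "\<dots> = fst p" using that H by simp
    finally show ?thesis unfolding act_span_def by (intro CollectI exI[of _ "\<lambda>q. if q = p then 1 else 0"]) simp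
  qed
qed

lemma act_span_sum:
  assumes "ext_module X" "finite H" "\<And>p. p \<in> H \<Longrightarrow> fst p \<in> carrier X"
    "\<And>i. i \<in> I \<Longrightarrow> f i \<in> act_span X H"
  shows "sum f I \<in> act_span X H"
  using assms(4) act_span_closed[OF assms(1-3)]
  by (induction I rule: infinite_finite_induct) auto

text \<open>Take a homogeneous generating set of least cardinality. A relation with a nonzero
  constant coefficient would express one generator through the others, and that generator could be
  dropped.\<close>

lemma minimal_cover:
  fixes X :: "('k::field, 'n::{finite,linorder}, 'm::ab_group_add) gmod"
  assumes X: "graded_module X" and fg: "finitely_generated X"
  shows "\<exists>ds p. p \<in> graded_hom (free_gmod ds) X \<and> p ` carrier (free_gmod ds) = carrier X \<and>
    (\<forall>v\<in>carrier (free_gmod ds). p v = 0 \<longrightarrow> (\<forall>j. v j \<in> ext_aug))"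
proof -
  have Xe: "ext_module X" using X by (rule graded_module_ext_module)
  interpret X: ext_module X by fact
  interpret X: graded_module X by fact
  define gen where "gen H \<longleftrightarrow> finite H \<and> (\<forall>p\<in>H. fst p \<in> grade X (snd p)) \<and> carrier X \<subseteq> act_span X H" for H
  have genc: "fst p \<in> carrier X" if "gen H" "p \<in> H" for H p
    using that X.grade_subset unfolding gen_def by blast
  have "\<exists>H. gen H"
  proof -
    obtain G where G: "finite G" "G \<subseteq> carrier X" "\<And>x. x \<in> carrier X \<Longrightarrow> \<exists>a. x = (\<Sum>g\<in>G. act X g (a g))"
      using fg unfolding finitely_generated_def by blast
    have "\<exists>c. finite {n. c n \<noteq> 0} \<and> (\<forall>n. c n \<in> grade X n) \<and> g = (\<Sum>n | c n \<noteq> 0. c n)" if "g \<in> G" for g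
      using X.grade_direct_sum[of g] that G(2) by blast
    then obtain c where c: "\<And>g. g \<in> G \<Longrightarrow> finite {n. c g n \<noteq> 0}" "\<And>g n. g \<in> G \<Longrightarrow> c g n \<in> grade X n"
      "\<And>g. g \<in> G \<Longrightarrow> g = (\<Sum>n | c g n \<noteq> 0. c g n)" by metis
    define H where "H = (\<Union>g\<in>G. (\<lambda>n. (c g n, n)) ` {n. c g n \<noteq> 0})"
    have fin: "finite H" using G(1) c(1) by (auto simp: H_def)
    have gr: "fst p \<in> grade X (snd p)" if "p \<in> H" for p using that c(2) by (auto simp: H_def)
    have Hc: "fst p \<in> carrier X" if "p \<in> H" for p using gr[OF that] X.grade_subset by blast
    note cl = act_span_closed[OF Xe fin Hc] and cs = act_span_sum[OF Xe fin Hc]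
    have "g \<in> act_span X H" if "g \<in> G" for g
    proof -
      have "(\<Sum>n | c g n \<noteq> 0. c g n) \<in> act_span X H"
      proof (rule cs)
        fix n assume "n \<in> {n. c g n \<noteq> 0}"
        then have "(c g n, n) \<in> H" using that by (auto simp: H_def)
        from cl(4)[OF _ this] show "c g n \<in> act_span X H" by simp
      qed
      then show ?thesis using c(3)[OF that] by simp
    qed
    then have "x \<in> act_span X H" if "x \<in> carrier X" for x
      using G(3)[OF that] by (auto intro!: cs cl(3))
    then have "gen H" using fin gr by (auto simp: gen_def)
    then show ?thesis by blast
  qed
  then obtain H where H: "gen H" and min: "\<And>H'. gen H' \<Longrightarrow> card H \<le> card H'"
    using ex_has_least_nat[of gen _ card] by metis
  have fin: "finite H" and span: "carrier X \<subseteq> act_span X H" using H by (auto simp: gen_def)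
  obtain L where L: "set L = H" "distinct L" using finite_distinct_list[OF fin] by blast
  define r ds g where "r = length L" and "ds = map snd L" and "g j = fst (L ! j)" for j
  have dsr [simp]: "length ds = r" by (simp add: ds_def r_def)
  let ?F = "free_gmod ds :: ('k, 'n, _) gmod"
  have gg: "g j \<in> grade X (ds ! j)" if "j < r" for j
    using H L that by (auto simp: gen_def g_def ds_def r_def)
  have gc: "g j \<in> carrier X" if "j < r" for j using gg[OF that] X.grade_subset by blast
  define p where "p v = (if v \<in> carrier ?F then \<Sum>j<r. act X (g j) (v j) else 0)" for v
  have sum_H: "(\<Sum>q\<in>H. f q) = (\<Sum>j<r. f (L ! j))" for f :: "_ \<Rightarrow> 'm"
    using sum.reindex_bij_betw[OF bij_betw_nth[OF L(2) refl refl], of f] L(1) by (simp add: r_def)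
  have hom: "p \<in> graded_hom ?F X"
    unfolding graded_hom_def
  proof (intro CollectI conjI allI ballI impI)
    fix x assume x: "x \<in> carrier ?F"
    show "p x \<in> carrier X" using x gc by (auto simp: p_def intro!: X.sum_closed X.act_closed)
    show "p (x + y) = p x + p y" if "y \<in> carrier ?F" for y
      using x that gc by (simp add: p_def X.act_add_right sum.distrib)
    show "p (act ?F x a) = act X (p x) a" for a
    proof -
      have "act X (\<Sum>j<r. act X (g j) (x j)) a = (\<Sum>j<r. act X (act X (g j) (x j)) a)"
        using gc by (intro X.act_sum_left X.act_closed) auto
      then show ?thesis using x gc by (simp add: p_def X.act_mult)
    qed
  next
    fix n x assume x: "x \<in> grade ?F n"
    then have "act X (g j) (x j) \<in> grade X n" if "j < r" for j
      using X.act_grade[OF gg[OF that], of "x j" "n - ds ! j"] that by simp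
    then have "(\<Sum>j<r. act X (g j) (x j)) \<in> grade X n"
    proof (induction r)
      case (Suc k)
      then show ?case using X.grade_subgroup[of n] by (auto simp: add_subgroup_def)
    qed (use X.grade_subgroup[of n] in \<open>auto simp: add_subgroup_def\<close>)
    then show "p x \<in> grade X n" using x by (simp add: p_def)
  qed (auto simp: p_def)
  have onto: "p ` carrier ?F = carrier X"
  proof
    show "p ` carrier ?F \<subseteq> carrier X" using klinear_closed[OF graded_hom_klinear[OF hom]] by blast
    show "carrier X \<subseteq> p ` carrier ?F"
    proof
      fix x assume "x \<in> carrier X"
      then obtain a where "x = (\<Sum>q\<in>H. act X (fst q) (a q))" using span by (auto simp: act_span_def)
      then have "x = p (\<lambda>j. if j < r then a (L ! j) else 0)" by (simp add: sum_H p_def g_def)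
      then show "x \<in> p ` carrier ?F" by (rule image_eqI[of x p]) simp
    qed
  qed
  have "v j \<in> ext_aug" if v: "v \<in> carrier ?F" "p v = 0" for v j
  proof (rule ccontr)
    assume "v j \<notin> ext_aug"
    then have \<kappa>: "coeff_ext (v j) {} \<noteq> 0" by (simp add: ext_aug_def)
    then have j: "j < r" using v(1) by (cases "j < r") auto
    define \<kappa> where "\<kappa> = coeff_ext (v j) {}"
    \<comment> \<open>The component of the relation in the degree of generator j: there the
      coefficient of this generator is the scalar \<open>\<kappa>\<close>, which is
      invertible.\<close>
    define w where "w = free_comp ds (ds ! j) v"
    have w: "w \<in> carrier ?F" using free_comp_grade[of ds "ds ! j" v] by (simp add: w_def)
    have "p v \<in> grade X (ds ! j)" using v X.grade_subgroup by (simp add: add_subgroup_def)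
    then have "p w = 0" unfolding w_def using graded_hom_free_comp[OF X hom v(1)] v(2) by simp
    have wj: "w j = ext_const \<kappa>"
      using j by (intro exterior_eqI) (auto simp: w_def free_comp_def coeff_ext_const \<kappa>_def)
    have "(\<Sum>l<r. act X (g l) (w l)) = 0" using \<open>p w = 0\<close> w by (simp add: p_def)
    then have "act X (g j) (ext_const \<kappa>) + (\<Sum>l\<in>{..<r} - {j}. act X (g l) (w l)) = 0"
      using sum.remove[of "{..<r}" j "\<lambda>l. act X (g l) (w l)"] j wj by simp
    then have eq: "act X (g j) (ext_const \<kappa>) = (\<Sum>l\<in>{..<r} - {j}. act X (g l) (- w l))"
      using gc by (simp add: X.act_minus_right sum_negf eq_neg_iff_add_eq_0)
    define H' where "H' = H - {L ! j}"
    have fin': "finite H'" using fin by (simp add: H'_def)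
    have H'c: "fst q \<in> carrier X" if "q \<in> H'" for q using genc[OF H] that by (auto simp: H'_def)
    note cl = act_span_closed[OF Xe fin' H'c] and cs = act_span_sum[OF Xe fin' H'c]
    have "g l \<in> act_span X H'" if "l < r" "l \<noteq> j" for l
    proof -
      have "L ! l \<in> H'" using that j L by (auto simp: H'_def r_def nth_eq_iff_index_eq)
      then show ?thesis using cl(4) unfolding g_def by blast
    qed
    then have "(\<Sum>l\<in>{..<r} - {j}. act X (g l) (- w l)) \<in> act_span X H'"
      by (intro cs cl(3)) auto
    then have "act X (g j) (ext_const \<kappa>) \<in> act_span X H'" by (simp add: eq)
    then have "act X (act X (g j) (ext_const \<kappa>)) (ext_const (inverse \<kappa>)) \<in> act_span X H'"
      by (rule cl(3)[rotated])
    also have "act X (act X (g j) (ext_const \<kappa>)) (ext_const (inverse \<kappa>)) = g j"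
      using \<kappa> gc[OF j] by (simp add: X.act_const_const \<kappa>_def X.act_one)
    finally have gj: "g j \<in> act_span X H'" .
    have all: "fst q \<in> act_span X H'" if "q \<in> H" for q
      using that gj cl(4)[of q] by (cases "q = L ! j") (auto simp: H'_def g_def)
    have "gen H'"
      unfolding gen_def
    proof (intro conjI fin' ballI subsetI)
      show "fst q \<in> grade X (snd q)" if "q \<in> H'" for q using that H by (auto simp: gen_def H'_def)
      fix x assume "x \<in> carrier X"
      then obtain a where "x = (\<Sum>q\<in>H. act X (fst q) (a q))" using span by (auto simp: act_span_def)
      then show "x \<in> act_span X H'" using all by (auto intro!: cs cl(3))
    qed
    then have "card H \<le> card H'" by (rule min)
    moreover have "L ! j \<in> H" using j L by (auto simp: r_def)
    ultimately show False using fin card_gt_0_iff[of H] by (auto simp: H'_def)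
  qed
  with hom onto show ?thesis by blast
qed

text \<open>Unlike a bare change of the carrier, this also cuts down the grading, as the next
  minimal cover needs a graded module.\<close>

definition free_sub :: "int list \<Rightarrow> (nat \<Rightarrow> ('k::field, 'n::{finite,linorder}) exterior) set \<Rightarrow>
    ('k, 'n, nat \<Rightarrow> ('k, 'n) exterior) gmod" where
  "free_sub ds A = (free_gmod ds)\<lparr>carrier := A, grade := \<lambda>n. grade (free_gmod ds) n \<inter> A\<rparr>"

lemma free_sub_simps [simp]:
  "carrier (free_sub ds A) = A"
  "act (free_sub ds A) = act (free_gmod ds)"
  "grade (free_sub ds A) n = grade (free_gmod ds) n \<inter> A"
  by (simp_all add: free_sub_def)

lemma ext_module_kernel:
  fixes X :: "('k::field, 'n::{finite,linorder}, 'm::ab_group_add) gmod"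
  assumes X: "ext_module X" and p: "p \<in> graded_hom (free_gmod ds) X"
  shows "ext_module ((free_gmod ds)\<lparr>carrier := {v \<in> carrier (free_gmod ds). p v = 0}\<rparr>)"
proof -
  interpret X: ext_module X by fact
  interpret F: ext_module "free_gmod ds :: ('k, 'n, _) gmod" by (rule ext_module_free)
  note pl = graded_hom_klinear[OF p]
  show ?thesis
  proof (intro ext_module.intro)
    show "add_subgroup (carrier ((free_gmod ds)\<lparr>carrier := {v \<in> carrier (free_gmod ds). p v = 0}\<rparr>))"
      using F.add_closed F.minus_closed klinear_add[OF pl] klinear_minus[OF pl ext_module_free]
        klinear_zero[OF pl ext_module_free] F.zero_closed
      by (simp add: add_subgroup_def del: free_gmod_simps)
  qed (use F.act_closed F.act_add_left F.act_add_right F.act_mult F.act_one graded_hom_act[OF p]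
      in \<open>simp_all del: free_gmod_simps\<close>)
qed

text \<open>The vectors e_j x_S, a basis over the field.\<close>

definition free_basis :: "nat \<Rightarrow> 'n set \<Rightarrow> nat \<Rightarrow> ('k::field, 'n::{finite,linorder}) exterior" where
  "free_basis j S = (\<lambda>k. if k = j then Exterior (\<lambda>T. if T = S then 1 else 0) else 0)"

lemma free_basis_expand:
  fixes v :: "nat \<Rightarrow> ('k::field, 'n::{finite,linorder}) exterior"
  assumes "v \<in> carrier (free_gmod ds)"
  shows "v = (\<Sum>j<length ds. \<Sum>S\<in>UNIV. vec_scale (coeff_ext (v j) S) (free_basis j S))"
proof (intro ext exterior_eqI)
  fix k T
  have "coeff_ext ((\<Sum>j<length ds. \<Sum>S\<in>UNIV. vec_scale (coeff_ext (v j) S) (free_basis j S)) k) T =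
      (\<Sum>j<length ds. \<Sum>S\<in>UNIV. if S = T then if j = k then coeff_ext (v k) T else 0 else 0)"
    unfolding sum_fun_apply coeff_ext_sum
    by (intro sum.cong) (auto simp: vec_scale_def free_basis_def)
  also have "\<dots> = (if k < length ds then coeff_ext (v k) T else 0)" by simp
  also have "\<dots> = coeff_ext (v k) T" using assms by auto
  finally show "coeff_ext (v k) T =
    coeff_ext ((\<Sum>j<length ds. \<Sum>S\<in>UNIV. vec_scale (coeff_ext (v j) S) (free_basis j S)) k) T" by simp
qed

text \<open>Homogeneous components of kernel elements stay in the kernel. Finite generation holds
  because the free module is finite dimensional: a basis of the kernel over the field generates
  it.\<close>

lemma kernel_module:
  fixes X :: "('k::field, 'n::{finite,linorder}, 'm::ab_group_add) gmod"
  assumes X: "graded_module X" and p: "p \<in> graded_hom (free_gmod ds) X"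
  defines "A \<equiv> {v \<in> carrier (free_gmod ds). p v = 0}"
  shows "graded_module (free_sub ds A)" and "finitely_generated (free_sub ds A)"
proof -
  let ?F = "free_gmod ds :: ('k, 'n, _) gmod"
  have Xe: "ext_module X" using X by (rule graded_module_ext_module)
  interpret K: ext_module "?F\<lparr>carrier := A\<rparr>"
    unfolding A_def by (rule ext_module_kernel[OF Xe p])
  interpret F: graded_module ?F by (rule graded_module_free)
  have Asub: "A \<subseteq> carrier ?F" by (auto simp: A_def)
  show "graded_module (free_sub ds A)"
  proof (intro graded_module.intro)
    show "add_subgroup (grade (free_sub ds A) n)" for n
      using F.grade_subgroup[of n] K.carrier_subgroup by (simp add: add_subgroup_def del: free_gmod_simps)
    fix v assume "v \<in> carrier (free_sub ds A)"
    then have v: "v \<in> A" "v \<in> carrier ?F" "p v = 0" by (auto simp: A_def)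
    have "free_comp ds n v \<in> A" for n
    proof -
      have "p v \<in> grade X n" using v graded_module.grade_subgroup[OF X] by (simp add: add_subgroup_def)
      then have "p (free_comp ds n v) = 0" using graded_hom_free_comp[OF X p v(2)] v(3) by simp
      then show ?thesis using free_comp_grade[of ds n v] F.grade_subset unfolding A_def by blast
    qed
    then show "\<exists>!c. finite {n. c n \<noteq> 0} \<and> (\<forall>n. c n \<in> grade (free_sub ds A) n) \<and> v = (\<Sum>n | c n \<noteq> 0. c n)"
      using free_comp_finite[of ds v] free_comp_grade[of ds _ v] free_comp_sum[OF v(2)]
      by (intro ex1I[of _ "\<lambda>n. free_comp ds n v"]) (simp del: free_gmod_simps, intro ext free_comp_eq, auto)
  next
    fix x m a n assume "x \<in> grade (free_sub ds A) m" "a \<in> (ext_grade n :: ('k, 'n) exterior set)"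
    then show "act (free_sub ds A) x a \<in> grade (free_sub ds A) (m + n)"
      using F.act_grade[of x m a n] K.act_closed[of x a] by (simp del: free_gmod_simps)
  qed (use K.carrier_subgroup K.act_closed K.act_add_left K.act_add_right K.act_mult K.act_one
      in \<open>simp_all del: free_gmod_simps\<close>)
  show "finitely_generated (free_sub ds A)"
  proof -
    obtain B where B: "B \<subseteq> A" "vec.independent B" "A \<subseteq> vec.span B"
      using vec.basis_exists[of A] by metis
    define E where "E = (\<lambda>(j, S). free_basis j S :: nat \<Rightarrow> ('k, 'n) exterior) ` ({..<length ds} \<times> UNIV)"
    have "finite E" by (simp add: E_def)
    have "carrier ?F \<subseteq> vec.span E"
    proof
      fix v assume "v \<in> carrier ?F"
      from free_basis_expand[OF this] show "v \<in> vec.span E"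
        by (rule ssubst) (intro vec.span_sum vec.span_scale vec.span_base, auto simp: E_def)
    qed
    then have "B \<subseteq> vec.span E" using B(1) Asub by blast
    then have fin: "finite B" using vec.independent_span_bound[OF \<open>finite E\<close> B(2)] by blast
    have "\<exists>a. x = (\<Sum>b\<in>B. act (free_sub ds A) b (a b))" if "x \<in> A" for x
    proof -
      have "x \<in> range (\<lambda>u. \<Sum>b\<in>B. vec_scale (u b) b)"
        using that B(3) unfolding vec.span_finite[OF fin] by (rule subsetD[rotated])
      then obtain u where "x = (\<Sum>b\<in>B. vec_scale (u b) b)" by (rule imageE)
      then show ?thesis by (intro exI[of _ "\<lambda>b. ext_const (u b)"]) (simp add: vec_scale_def)
    qed
    then show ?thesis unfolding finitely_generated_def using fin B(1) by (intro exI[of _ B]) simp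
  qed
qed

text \<open>Minimal covers are iterated by dependent choice. A stage is a degree list together with
  a subset of its free module, so that all syzygies have one type.\<close>

lemma minimal_free_resolution_exists:
  fixes X :: "('k::field, 'n::{finite,linorder}, 'm::ab_group_add) gmod"
  assumes X: "graded_module X" and fg: "finitely_generated X"
  shows "\<exists>F. minimal_free_resolution X F"
proof -
  obtain ds0 p where p: "p \<in> graded_hom (free_gmod ds0) X" "p ` carrier (free_gmod ds0) = carrier X"
    "\<forall>v\<in>carrier (free_gmod ds0). p v = 0 \<longrightarrow> (\<forall>j. v j \<in> ext_aug)"
    using minimal_cover[OF X fg] by blast
  define A0 where "A0 = {v \<in> carrier (free_gmod ds0). p v = 0}"
  define ok where "ok s \<longleftrightarrow> snd s \<subseteq> carrier (free_gmod (fst s)) \<and> graded_module (free_sub (fst s) (snd s)) \<and>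
    finitely_generated (free_sub (fst s) (snd s)) \<and> (\<forall>v\<in>snd s. \<forall>j. v j \<in> ext_aug)"
    for s :: "int list \<times> (nat \<Rightarrow> ('k, 'n) exterior) set"
  define step where "step s s' d \<longleftrightarrow> d \<in> graded_hom (free_gmod (fst s')) (free_gmod (fst s)) \<and>
    d ` carrier (free_gmod (fst s')) = snd s \<and> snd s' = {v \<in> carrier (free_gmod (fst s')). d v = 0}"
    for s s' :: "int list \<times> (nat \<Rightarrow> ('k, 'n) exterior) set" and d
  have ok0: "ok (ds0, A0)"
    using kernel_module[OF X p(1)] p(3) by (auto simp: ok_def A0_def)
  have next_ok: "\<exists>s'. ok s' \<and> (\<exists>d. step s s' d)" if s: "ok s" for s
  proof -
    obtain ds A where sA: "s = (ds, A)" by (cases s)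
    have K: "graded_module (free_sub ds A)" "finitely_generated (free_sub ds A)" and A: "A \<subseteq> carrier (free_gmod ds)"
      using s by (auto simp: ok_def sA)
    obtain ds' d where d: "d \<in> graded_hom (free_gmod ds') (free_sub ds A)"
      "d ` carrier (free_gmod ds') = carrier (free_sub ds A)"
      "\<forall>v\<in>carrier (free_gmod ds'). d v = 0 \<longrightarrow> (\<forall>j. v j \<in> ext_aug)"
      using minimal_cover[OF K] by blast
    define A' where "A' = {v \<in> carrier (free_gmod ds'). d v = 0}"
    have "ok (ds', A')"
      using kernel_module[OF K(1) d(1)] d(3) by (auto simp: ok_def A'_def)
    moreover have "d \<in> graded_hom (free_gmod ds') (free_gmod ds)"
      using d(1) A by (auto simp: graded_hom_def)
    ultimately have "ok (ds', A') \<and> step s (ds', A') d"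
      using d(2) by (simp add: step_def sA A'_def del: free_gmod_simps)
    then show ?thesis by blast
  qed
  obtain S where S: "\<And>n. ok (S n) \<and> (n = 0 \<longrightarrow> S n = (ds0, A0))" "\<And>n. \<exists>d. step (S n) (S (Suc n)) d"
    using dependent_nat_choice[of "\<lambda>n s. ok s \<and> (n = 0 \<longrightarrow> s = (ds0, A0))" "\<lambda>n s s'. \<exists>d. step s s' d"]
      ok0 next_ok by (metis nat.distinct(1))
  then obtain d where d: "\<And>n. step (S n) (S (Suc n)) (d n)" by metis
  have S0: "S 0 = (ds0, A0)" using S(1) by blast
  define F where "F = \<lparr>degs = \<lambda>n. fst (S n), diff = d, aug = p\<rparr>"
  have "free_resolution X F"
    unfolding free_resolution_def
  proof (intro conjI allI)
    show "aug F \<in> graded_hom (res_mod F 0) X" "aug F ` carrier (res_mod F 0) = carrier X"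
      using p by (simp_all add: F_def S0 del: free_gmod_simps)
    show "diff F i \<in> graded_hom (res_mod F (Suc i)) (res_mod F i)" for i
      using d[of i] by (simp add: F_def step_def del: free_gmod_simps)
    show "diff F 0 ` carrier (res_mod F 1) = {v \<in> carrier (res_mod F 0). aug F v = 0}"
      using d[of 0] by (simp add: F_def step_def S0 A0_def del: free_gmod_simps)
    show "diff F (Suc i) ` carrier (res_mod F (Suc (Suc i))) = {v \<in> carrier (res_mod F (Suc i)). diff F i v = 0}" for i
      using d[of "Suc i"] d[of i] by (simp add: F_def step_def del: free_gmod_simps)
  qed
  moreover have "diff F i v j \<in> ext_aug" if "v \<in> carrier (res_mod F (Suc i))" for i v j
  proof -
    have "diff F i v \<in> snd (S i)" using that d[of i] unfolding F_def step_def by auto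
    then show ?thesis using S(1)[of i] unfolding ok_def by blast
  qed
  ultimately show ?thesis unfolding minimal_free_resolution_def by blast
qed

section \<open>Growth of Betti numbers and exact linear forms\<close>

lemma homogeneous_system:
  fixes \<phi> :: "'j \<Rightarrow> 'd \<Rightarrow> 'k::field"
  assumes "finite D" "finite J" "card D < card J"
  shows "\<exists>c. (\<exists>j\<in>J. c j \<noteq> 0) \<and> (\<forall>d\<in>D. (\<Sum>j\<in>J. c j * \<phi> j d) = 0)"
  using assms
proof (induction D arbitrary: J \<phi> rule: finite_induct)
  case empty
  then obtain j where "j \<in> J" by fastforce
  then show ?case by (intro exI[of _ "\<lambda>_. 1"]) auto
next
  case (insert d D)
  show ?case
  proof (cases "\<forall>j\<in>J. \<phi> j d = 0")
    case True
    have "card D < card J" using insert by simp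
    from insert.IH[OF insert.prems(1) this, of \<phi>] show ?thesis using True by auto
  next
    case False
    then obtain i where i: "i \<in> J" "\<phi> i d \<noteq> 0" by blast
    \<comment> \<open>Elimination of the unknown i by means of equation d, which afterwards
      determines the value at i.\<close>
    define \<psi> where "\<psi> j e = \<phi> j e - \<phi> j d / \<phi> i d * \<phi> i e" for j e
    have "finite (J - {i})" "card D < card (J - {i})" using insert i by auto
    from insert.IH[OF this, of \<psi>] obtain c where c: "\<exists>j\<in>J - {i}. c j \<noteq> 0"
      "\<And>e. e \<in> D \<Longrightarrow> (\<Sum>j\<in>J - {i}. c j * \<psi> j e) = 0" by blast
    define c' where "c' = c(i := - (\<Sum>j\<in>J - {i}. c j * \<phi> j d) / \<phi> i d)"
    have sum': "(\<Sum>j\<in>J. c' j * \<phi> j e) = (\<Sum>j\<in>J - {i}. c j * \<psi> j e)" for e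
    proof -
      have "(\<Sum>j\<in>J. c' j * \<phi> j e) = c' i * \<phi> i e + (\<Sum>j\<in>J - {i}. c j * \<phi> j e)"
        using insert.prems i by (subst sum.remove[of J i]) (auto simp: c'_def intro!: sum.cong)
      also have "\<dots> = (\<Sum>j\<in>J - {i}. c j * \<psi> j e)"
        by (simp add: c'_def \<psi>_def algebra_simps sum_subtractf sum_distrib_left sum_divide_distrib sum_distrib_right)
      finally show ?thesis .
    qed
    have "\<psi> j d = 0" for j using i by (simp add: \<psi>_def)
    then show ?thesis using c sum' by (intro exI[of _ c']) (auto simp: c'_def)
  qed
qed

text \<open>Finitely many linear functions that separate points bound the dimension of the module by
  \<open>card D\<close>, although its ambient type is only a group.\<close>

definition coordinates :: "('k::field, 'n::{finite,linorder}, 'm::ab_group_add) gmod \<Rightarrow> 'd set \<Rightarrow> ('m \<Rightarrow> 'd \<Rightarrow> 'k) \<Rightarrow> bool" where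
  "coordinates X D \<kappa> \<longleftrightarrow> finite D \<and>
    (\<forall>x\<in>carrier X. \<forall>y\<in>carrier X. \<forall>e. \<kappa> (x + y) e = \<kappa> x e + \<kappa> y e) \<and>
    (\<forall>x\<in>carrier X. \<forall>c e. \<kappa> (act X x (ext_const c)) e = c * \<kappa> x e) \<and>
    (\<forall>x\<in>carrier X. (\<forall>e\<in>D. \<kappa> x e = 0) \<longrightarrow> x = 0)"

lemma coordinates_exist:
  fixes X :: "('k::field, 'n::{finite,linorder}, 'm::ab_group_add) gmod"
  assumes X: "ext_module X" and p: "klinear (free_gmod ds) X p"
    and onto: "p ` carrier (free_gmod ds) = carrier X"
  shows "\<exists>\<kappa>. coordinates X ({..<length ds} \<times> (UNIV :: 'n set set)) \<kappa>"
proof -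
  obtain s where s: "klinear X (free_gmod ds) s" "\<And>x. x \<in> carrier X \<Longrightarrow> p (s x) = x"
    using klinear_section[OF X p onto] by blast
  have "x = 0" if x: "x \<in> carrier X" and 0: "\<And>j S. j < length ds \<Longrightarrow> coeff_ext (s x j) S = 0" for x
  proof -
    have "s x j = 0" for j
      using klinear_closed[OF s(1) x] 0 by (cases "j < length ds") (auto simp: ext_eq_iff)
    then have "s x = 0" by (simp add: fun_eq_iff)
    then show ?thesis using s(2)[OF x] klinear_zero[OF p ext_module_free] by simp
  qed
  then show ?thesis
    using klinear_add[OF s(1)] klinear_const[OF s(1)]
    by (intro exI[of _ "\<lambda>x (j, S). coeff_ext (s x j) S"]) (auto simp: coordinates_def mult.commute)
qed

text \<open>The maps from B to the module form a space of dimension at most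
  \<open>card B * card D\<close>, and the family u has more members than that.\<close>

lemma coordinates_dependent:
  assumes X: "ext_module X" and \<kappa>: "coordinates X D \<kappa>" and fin: "finite J" "finite B"
    and card: "card B * card D < card J" and u: "\<forall>j\<in>J. \<forall>b\<in>B. u j b \<in> carrier X"
  shows "\<exists>c. (\<exists>j\<in>J. c j \<noteq> 0) \<and> (\<forall>b\<in>B. (\<Sum>j\<in>J. act X (u j b) (ext_const (c j))) = 0)"
proof -
  interpret X: ext_module X by fact
  have "finite (B \<times> D)" "card (B \<times> D) < card J"
    using \<kappa> fin card by (auto simp: coordinates_def card_cartesian_product)
  from homogeneous_system[OF this(1) fin(1) this(2), of "\<lambda>j (b, e). \<kappa> (u j b) e"]
  obtain c where c: "\<exists>j\<in>J. c j \<noteq> 0"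
    "\<And>b e. b \<in> B \<Longrightarrow> e \<in> D \<Longrightarrow> (\<Sum>j\<in>J. c j * \<kappa> (u j b) e) = 0" by auto
  have lin: "\<kappa> (\<Sum>j\<in>I. act X (v j) (ext_const (c j))) e = (\<Sum>j\<in>I. c j * \<kappa> (v j) e)"
    if "finite I" "\<And>j. j \<in> I \<Longrightarrow> v j \<in> carrier X" for I v e
    using that
  proof (induction I rule: finite_induct)
    case empty
    have "\<kappa> (0 + 0) e = \<kappa> 0 e + \<kappa> 0 e"
      using \<kappa> X.zero_closed unfolding coordinates_def by blast
    then have "\<kappa> 0 e = 0" by (metis add.right_neutral add_left_cancel)
    then show ?case by simp
  next
    case (insert j I)
    have "(\<Sum>j\<in>I. act X (v j) (ext_const (c j))) \<in> carrier X"
      using insert by (intro X.sum_closed X.act_closed) auto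
    then show ?case
      using insert \<kappa> X.act_closed[of "v j"] by (simp add: coordinates_def)
  qed
  have "(\<Sum>j\<in>J. act X (u j b) (ext_const (c j))) = 0" if b: "b \<in> B" for b
  proof -
    have "(\<Sum>j\<in>J. act X (u j b) (ext_const (c j))) \<in> carrier X"
      using u b by (intro X.sum_closed X.act_closed) auto
    moreover have "\<kappa> (\<Sum>j\<in>J. act X (u j b) (ext_const (c j))) e = 0" if "e \<in> D" for e
      using lin[OF fin(1), of "\<lambda>j. u j b" e] u b c(2)[OF b that] by simp
    ultimately show ?thesis using \<kappa> by (simp add: coordinates_def)
  qed
  then show ?thesis using c(1) by blast
qed

text \<open>For finite J this expresses dim Ext^m(W, X) < card J without forming the quotient: every
  family of cocycles indexed by J has a nontrivial combination that is a coboundary.\<close>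

definition cocycles_dependent :: "'j set \<Rightarrow> nat \<Rightarrow> ('k::field, 'n::{finite,linorder}, 'w::ab_group_add) gmod \<Rightarrow>
    ('k, 'n, 'm::ab_group_add) gmod \<Rightarrow> bool" where
  "cocycles_dependent J m W X \<longleftrightarrow> (\<forall>z. (\<forall>j\<in>J. \<forall>\<alpha>. klinear W X (z j \<alpha>)) \<longrightarrow>
    (\<forall>j\<in>J. \<forall>\<alpha>. \<forall>w\<in>carrier W. mdeg \<alpha> = Suc m \<longrightarrow> kdiff W X (z j) \<alpha> w = 0) \<longrightarrow>
    (\<exists>c h. (\<exists>j\<in>J. c j \<noteq> 0) \<and> (\<forall>\<alpha>. klinear W X (h \<alpha>)) \<and>
      (\<forall>\<alpha>. \<forall>w\<in>carrier W. mdeg \<alpha> = m \<longrightarrow>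
        (\<Sum>j\<in>J. act X (z j \<alpha> w) (ext_const (c j))) = kdiff W X h \<alpha> w)))"

lemma kdiff_unit:
  "kdiff G X h (unit_exp i) v = act X (h (\<lambda>_. 0) v) (ext_var i) - h (\<lambda>_. 0) (act G v (ext_var i))"
proof -
  have "{k. 0 < unit_exp i k} = {i}" "lower (unit_exp i) i = (\<lambda>_. 0)" by auto
  then show ?thesis unfolding kdiff_def by simp
qed

lemma kdiff_comp:
  assumes "\<And>i. p (act G v (ext_var i)) = act W (p v) (ext_var i)"
  shows "kdiff G X (\<lambda>\<alpha> v. z \<alpha> (p v)) \<alpha> v = kdiff W X z \<alpha> (p v)"
  using assms by (simp add: kdiff_def)

lemma kdiff_carrier: "kdiff (G\<lparr>carrier := A\<rparr>) X = kdiff G X"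
  by (intro ext) (simp add: kdiff_def)

lemma free_expand:
  assumes "v \<in> carrier (free_gmod ds)"
  shows "v = (\<Sum>l<length ds. act (free_gmod ds) (free_basis l {}) (v l))"
proof
  fix k
  have "(\<Sum>l<length ds. act (free_gmod ds) (free_basis l {}) (v l)) k = (\<Sum>l<length ds. if l = k then v k else 0)"
    unfolding sum_fun_apply
    by (intro sum.cong) (auto simp: free_basis_def ext_const_def[symmetric])
  also have "\<dots> = v k" using assms by auto
  finally show "v k = (\<Sum>l<length ds. act (free_gmod ds) (free_basis l {}) (v l)) k" by simp
qed

text \<open>Cocycles of degree zero are homomorphisms from W to X and are determined by the images
  of the generators of W. A combination that kills all generators is zero.\<close>

lemma cocycles_dependent_0:
  fixes W :: "('k::field, 'n::{finite,linorder}, 'w::ab_group_add) gmod"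
    and X :: "('k, 'n, 'm::ab_group_add) gmod" and J :: "'j set"
  assumes X: "ext_module X" and \<kappa>: "coordinates X D \<kappa>" and W: "ext_module W"
    and p: "klinear (free_gmod ds) W p" and onto: "p ` carrier (free_gmod ds) = carrier W"
    and pact: "\<And>v a. v \<in> carrier (free_gmod ds) \<Longrightarrow> p (act (free_gmod ds) v a) = act W (p v) a"
    and J: "finite J" "length ds * card D < card J"
  shows "cocycles_dependent J 0 W X"
  unfolding cocycles_dependent_def
proof (intro allI impI)
  let ?F = "free_gmod ds :: ('k, 'n, _) gmod"
  fix z :: "'j \<Rightarrow> ('n \<Rightarrow> nat) \<Rightarrow> 'w \<Rightarrow> 'm"
  assume z: "\<forall>j\<in>J. \<forall>\<alpha>. klinear W X (z j \<alpha>)"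
    and cocycle: "\<forall>j\<in>J. \<forall>\<alpha>. \<forall>w\<in>carrier W. mdeg \<alpha> = Suc 0 \<longrightarrow> kdiff W X (z j) \<alpha> w = 0"
  interpret X: ext_module X by fact
  interpret W: ext_module W by fact
  interpret F: ext_module ?F by (rule ext_module_free)
  let ?e = "\<lambda>l. free_basis l {} :: nat \<Rightarrow> ('k, 'n) exterior"
  have e: "?e l \<in> carrier ?F" if "l < length ds" for l using that by (auto simp: free_basis_def)
  note pc = klinear_closed[OF p]
  have zc: "z j \<alpha> w \<in> carrier X" if "j \<in> J" "w \<in> carrier W" for j \<alpha> w
    using klinear_closed z that by blast
  have card: "card {..<length ds} * card D < card J" using J(2) by simp
  have "\<forall>j\<in>J. \<forall>l\<in>{..<length ds}. z j (\<lambda>_. 0) (p (?e l)) \<in> carrier X"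
    using zc pc[OF e] by simp
  from coordinates_dependent[OF X \<kappa> J(1) finite_lessThan card this]
  obtain c where c: "\<exists>j\<in>J. c j \<noteq> 0"
    and c2: "\<forall>l\<in>{..<length ds}. (\<Sum>j\<in>J. act X (z j (\<lambda>_. 0) (p (?e l))) (ext_const (c j))) = 0"
    by (elim exE conjE)
  define f where "f w = (\<Sum>j\<in>J. act X (z j (\<lambda>_. 0) w) (ext_const (c j)))" for w
  have fl: "klinear W X f"
    unfolding f_def[abs_def] using z by (intro klinear_sum_map klinear_act_map X) auto
  have f_var: "f (act W w (ext_var i)) = act X (f w) (ext_var i)" if w: "w \<in> carrier W" for w i
  proof -
    have "z j (\<lambda>_. 0) (act W w (ext_var i)) = act X (z j (\<lambda>_. 0) w) (ext_var i)" if "j \<in> J" for j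
      using cocycle[rule_format, OF that w, of "unit_exp i"] by (simp add: kdiff_unit)
    then have "f (act W w (ext_var i)) =
        (\<Sum>j\<in>J. act X (act X (z j (\<lambda>_. 0) w) (ext_const (c j))) (ext_var i))"
      unfolding f_def using zc w by (intro sum.cong) (auto simp: X.act_const_commute)
    also have "\<dots> = act X (f w) (ext_var i)"
      unfolding f_def using zc w by (intro X.act_sum_left[symmetric] X.act_closed) auto
    finally show ?thesis .
  qed
  have f0: "f w = 0" if "w \<in> carrier W" for w
  proof -
    from that obtain v where v: "v \<in> carrier ?F" "w = p v" using onto by (metis imageE)
    have ev: "act ?F (?e l) (v l) \<in> carrier ?F" if "l < length ds" for l
      using e[OF that] by (rule F.act_closed)
    have "f (p v) = f (p (\<Sum>l<length ds. act ?F (?e l) (v l)))"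
      using free_expand[OF v(1)] by simp
    also have "\<dots> = (\<Sum>l<length ds. f (p (act ?F (?e l) (v l))))"
      using ev by (intro klinear_sum[OF klinear_comp[OF p fl] ext_module_free]) auto
    also have "\<dots> = 0"
    proof (intro sum.neutral ballI)
      fix l assume "l \<in> {..<length ds}"
      then have l: "l < length ds" by simp
      have "f (p (act ?F (?e l) (v l))) = act X (f (p (?e l))) (v l)"
        unfolding pact[OF e[OF l]] by (rule klinear_hom[OF W X fl f_var pc[OF e[OF l]]])
      then show "f (p (act ?F (?e l) (v l))) = 0" using c2 l by (simp add: f_def)
    qed
    finally show ?thesis using v by simp
  qed
  show "\<exists>c h. (\<exists>j\<in>J. c j \<noteq> 0) \<and> (\<forall>\<alpha>. klinear W X (h \<alpha>)) \<and>
      (\<forall>\<alpha>. \<forall>w\<in>carrier W. mdeg \<alpha> = 0 \<longrightarrow>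
        (\<Sum>j\<in>J. act X (z j \<alpha> w) (ext_const (c j))) = kdiff W X h \<alpha> w)"
  proof (intro exI[of _ c] exI[of _ "\<lambda>_ _. 0"] conjI c allI ballI impI)
    show "klinear W X (\<lambda>_. 0)" by (rule klinear_zero_map[OF X])
    fix \<alpha> :: "'n \<Rightarrow> nat" and w assume "w \<in> carrier W" "mdeg \<alpha> = 0"
    then show "(\<Sum>j\<in>J. act X (z j \<alpha> w) (ext_const (c j))) = kdiff W X (\<lambda>_ _. 0) \<alpha> w"
      using f0 by (simp add: mdeg_eq_0 f_def kdiff_def)
  qed
qed

text \<open>Dimension shifting along the syzygy \<open>\<Omega>\<close> of \<open>W\<close>.\<close>

lemma cocycles_dependent_Suc:
  fixes W :: "('k::field, 'n::{finite,linorder}, 'w::ab_group_add) gmod"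
    and X :: "('k, 'n, 'm::ab_group_add) gmod" and J :: "'j set"
  assumes X: "graded_module X" and W: "ext_module W"
    and p: "klinear (free_gmod ds) W p" and onto: "p ` carrier (free_gmod ds) = carrier W"
    and pact: "\<And>v a. v \<in> carrier (free_gmod ds) \<Longrightarrow> p (act (free_gmod ds) v a) = act W (p v) a"
    and \<Omega>: "\<Omega> = (free_gmod ds)\<lparr>carrier := {v \<in> carrier (free_gmod ds). p v = 0}\<rparr>"
    and \<Omega>e: "ext_module \<Omega>" and dep: "cocycles_dependent J m \<Omega> X"
  shows "cocycles_dependent J (Suc m) W X"
  unfolding cocycles_dependent_def
proof (intro allI impI)
  let ?F = "free_gmod ds :: ('k, 'n, _) gmod"
  fix z :: "'j \<Rightarrow> ('n \<Rightarrow> nat) \<Rightarrow> 'w \<Rightarrow> 'm"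
  assume z: "\<forall>j\<in>J. \<forall>\<alpha>. klinear W X (z j \<alpha>)"
    and cocycle: "\<forall>j\<in>J. \<forall>\<alpha>. \<forall>w\<in>carrier W. mdeg \<alpha> = Suc (Suc m) \<longrightarrow> kdiff W X (z j) \<alpha> w = 0"
  have Xe: "ext_module X" using X by (rule graded_module_ext_module)
  have Fe: "ext_module ?F" by (rule ext_module_free)
  interpret X: ext_module X by fact
  interpret W: ext_module W by fact
  interpret F: ext_module ?F by fact
  note pc = klinear_closed[OF p]
  have \<Omega>sub: "carrier \<Omega> \<subseteq> carrier ?F" and \<Omega>c: "v \<in> carrier \<Omega> \<longleftrightarrow> v \<in> carrier ?F \<and> p v = 0" for v
    by (auto simp: \<Omega>)
  have \<Omega>upd: "\<Omega> = ?F\<lparr>carrier := carrier \<Omega>\<rparr>" by (simp add: \<Omega>)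
  have k\<Omega>: "kdiff \<Omega> X = kdiff ?F X" by (simp add: \<Omega> kdiff_carrier)
  have "\<exists>h. (\<forall>\<alpha>. klinear ?F X (h \<alpha>)) \<and>
      (\<forall>\<alpha>. \<forall>v\<in>carrier ?F. mdeg \<alpha> = Suc m \<longrightarrow> z j \<alpha> (p v) = kdiff ?F X h \<alpha> v)" if j: "j \<in> J" for j
  proof -
    have zp: "klinear ?F X (\<lambda>v. z j \<alpha> (p v))" for \<alpha> using klinear_comp[OF p] z j by blast
    have "\<forall>\<alpha>. \<forall>v\<in>carrier ?F. mdeg \<alpha> = Suc (Suc m) \<longrightarrow> kdiff ?F X (\<lambda>\<alpha> v. z j \<alpha> (p v)) \<alpha> v = 0"
      using cocycle j pc by (simp add: kdiff_comp[where W = W] pact del: free_gmod_simps)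
    from koszul_exact[OF X zp this] show ?thesis by auto
  qed
  then obtain H where H: "\<And>j \<alpha>. j \<in> J \<Longrightarrow> klinear ?F X (H j \<alpha>)"
    and zH: "\<And>j \<alpha> v. j \<in> J \<Longrightarrow> v \<in> carrier ?F \<Longrightarrow> mdeg \<alpha> = Suc m \<Longrightarrow> z j \<alpha> (p v) = kdiff ?F X (H j) \<alpha> v"
    by metis
  \<comment> \<open>Inverse of the connecting map: the pullback of z to the free module is the
    differential of H, and H restricted to the syzygy is a cocycle because p vanishes there.\<close>
  have 1: "\<forall>j\<in>J. \<forall>\<alpha>. klinear \<Omega> X (H j \<alpha>)"
    using klinear_subset[OF H \<Omega>sub] \<Omega>upd by simp
  have "kdiff \<Omega> X (H j) \<alpha> w = 0" if "j \<in> J" "w \<in> carrier \<Omega>" "mdeg \<alpha> = Suc m" for j \<alpha> w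
  proof -
    have "kdiff \<Omega> X (H j) \<alpha> w = z j \<alpha> (p w)" unfolding k\<Omega> using zH[of j w \<alpha>] that \<Omega>c by simp
    also have "\<dots> = 0"
    proof -
      have "klinear W X (z j \<alpha>)" using z that by blast
      then show ?thesis using klinear_zero[OF _ W] that \<Omega>c by simp
    qed
    finally show ?thesis .
  qed
  then have 2: "\<forall>j\<in>J. \<forall>\<alpha>. \<forall>w\<in>carrier \<Omega>. mdeg \<alpha> = Suc m \<longrightarrow> kdiff \<Omega> X (H j) \<alpha> w = 0" by blast
  from dep[unfolded cocycles_dependent_def, THEN spec, of H, THEN mp, OF 1, THEN mp, OF 2]
  obtain c e where c: "\<exists>j\<in>J. c j \<noteq> 0" and e: "\<forall>\<alpha>. klinear \<Omega> X (e \<alpha>)"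
    and ce: "\<forall>\<alpha>. \<forall>w\<in>carrier \<Omega>. mdeg \<alpha> = m \<longrightarrow>
      (\<Sum>j\<in>J. act X (H j \<alpha> w) (ext_const (c j))) = kdiff \<Omega> X e \<alpha> w"
    by (elim exE conjE)
  have "\<exists>e'. klinear ?F X e' \<and> (\<forall>v\<in>carrier \<Omega>. e' v = e \<alpha> v)" for \<alpha>
    using klinear_extend[OF \<Omega>sub, folded \<Omega>upd, OF \<Omega>e e[rule_format]] by metis
  then obtain e' where e': "\<And>\<alpha>. klinear ?F X (e' \<alpha>)" and ee': "\<And>\<alpha> v. v \<in> carrier \<Omega> \<Longrightarrow> e' \<alpha> v = e \<alpha> v"
    by metis
  define A where "A \<alpha> v = (\<Sum>j\<in>J. act X (H j \<alpha> v) (ext_const (c j)))" for \<alpha> v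
  have Al: "klinear ?F X (A \<alpha>)" for \<alpha>
    unfolding A_def[abs_def] using H by (intro klinear_sum_map klinear_act_map Xe) auto
  have kel: "klinear ?F X (kdiff ?F X e' \<alpha>)" for \<alpha> by (intro klinear_kdiff Fe Xe e')
  \<comment> \<open>On the syzygy A equals the differential of e in degree m. Subtracting the
    differential of the extension e' makes it vanish there and leaves the differential of A
    unchanged.\<close>
  define h where "h \<alpha> v = A \<alpha> v - kdiff ?F X e' \<alpha> v" for \<alpha> v
  have hl: "klinear ?F X (h \<alpha>)" for \<alpha>
    unfolding h_def[abs_def] by (intro klinear_diff_map Xe Al kel)
  have h0: "h \<alpha> v = 0" if "v \<in> carrier \<Omega>" "mdeg \<alpha> = m" for \<alpha> v
  proof -
    have "kdiff \<Omega> X e' \<alpha> v = kdiff \<Omega> X e \<alpha> v"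
      by (rule kdiff_cong) (use ee' \<Omega>e that in auto)
    then show ?thesis using ce that by (simp add: h_def A_def k\<Omega>)
  qed
  obtain g where g: "klinear W ?F g" "\<And>w. w \<in> carrier W \<Longrightarrow> p (g w) = w"
    using klinear_section[OF W p onto] by blast
  note gc = klinear_closed[OF g(1)]
  \<comment> \<open>In degree m the map h vanishes on the syzygy, so its value depends only on the
    image in W and can be taken at the section.\<close>
  define h' where "h' \<alpha> w = h \<alpha> (g w)" for \<alpha> w
  have hp: "h' \<alpha> (p v) = h \<alpha> v" if "v \<in> carrier ?F" "mdeg \<alpha> = m" for \<alpha> v
  proof -
    have gpv: "g (p v) \<in> carrier ?F" by (intro gc pc that)
    then have "g (p v) - v \<in> carrier \<Omega>"
      unfolding \<Omega>c using F.diff_closed[OF gpv that(1)] klinear_diff[OF p Fe gpv that(1)] g(2)[OF pc[OF that(1)]]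
      by (simp del: free_gmod_simps)
    from h0[OF this that(2)] show ?thesis
      unfolding h'_def klinear_diff[OF hl Fe gpv that(1)] by simp
  qed
  have "(\<Sum>j\<in>J. act X (z j \<alpha> w) (ext_const (c j))) = kdiff W X h' \<alpha> w"
    if w: "w \<in> carrier W" and \<alpha>: "mdeg \<alpha> = Suc m" for \<alpha> w
  proof -
    define v where "v = g w"
    have v: "v \<in> carrier ?F" "p v = w" using gc g(2) w by (simp_all only: v_def)
    have "kdiff W X h' \<alpha> w = kdiff ?F X (\<lambda>\<alpha> v. h' \<alpha> (p v)) \<alpha> v"
      using kdiff_comp[of p ?F v W X h' \<alpha>] pact[OF v(1)] v(2) by simp
    also have "\<dots> = kdiff ?F X h \<alpha> v"
      by (rule kdiff_cong[OF _ Fe v(1)]) (use hp \<alpha> in auto)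
    also have "\<dots> = kdiff ?F X A \<alpha> v"
      unfolding h_def[abs_def] kdiff_diff[OF Fe Xe Al kel v(1)] kdiff_kdiff[OF Fe Xe e' v(1)] by simp
    also have "\<dots> = (\<Sum>j\<in>J. kdiff ?F X (\<lambda>\<alpha> v. act X (H j \<alpha> v) (ext_const (c j))) \<alpha> v)"
      unfolding A_def[abs_def] by (rule kdiff_sum[OF Fe Xe _ v(1)]) (intro klinear_act_map Xe H)
    also have "\<dots> = (\<Sum>j\<in>J. act X (z j \<alpha> w) (ext_const (c j)))"
    proof (rule sum.cong[OF refl])
      fix j assume "j \<in> J"
      then show "kdiff ?F X (\<lambda>\<alpha> v. act X (H j \<alpha> v) (ext_const (c j))) \<alpha> v = act X (z j \<alpha> w) (ext_const (c j))"
        using kdiff_const[OF Fe Xe H v(1)] zH[of j v \<alpha>] v \<alpha> by simp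
    qed
    finally show ?thesis by simp
  qed
  moreover have "klinear W X (h' \<alpha>)" for \<alpha>
    unfolding h'_def[abs_def] by (rule klinear_comp[OF g(1) hl])
  ultimately show "\<exists>c h. (\<exists>j\<in>J. c j \<noteq> 0) \<and> (\<forall>\<alpha>. klinear W X (h \<alpha>)) \<and>
      (\<forall>\<alpha>. \<forall>w\<in>carrier W. mdeg \<alpha> = Suc m \<longrightarrow>
        (\<Sum>j\<in>J. act X (z j \<alpha> w) (ext_const (c j))) = kdiff W X h \<alpha> w)"
    using c by blast
qed

text \<open>After n dimension shifts only homomorphisms out of a syzygy covered by the n-th free
  module matter, so dim Ext^n(X, X) is at most the rank of that free module times the number of
  coordinates.\<close>

lemma cocycles_dependent_resolution:
  assumes X: "graded_module X" and F: "free_resolution X F"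
    and \<kappa>: "coordinates X D \<kappa>" and J: "finite J" "length (degs F n) * card D < card J"
  shows "cocycles_dependent J n X X"
proof -
  have Xe: "ext_module X" using X by (rule graded_module_ext_module)
  have a: "aug F \<in> graded_hom (res_mod F 0) X" and onto: "aug F ` carrier (res_mod F 0) = carrier X"
    and d: "\<And>i. diff F i \<in> graded_hom (res_mod F (Suc i)) (res_mod F i)"
    and ex0: "diff F 0 ` carrier (res_mod F 1) = {v \<in> carrier (res_mod F 0). aug F v = 0}"
    and ex: "\<And>i. diff F (Suc i) ` carrier (res_mod F (Suc (Suc i))) =
      {v \<in> carrier (res_mod F (Suc i)). diff F i v = 0}"
    using F[unfolded free_resolution_def] by (simp_all del: free_gmod_simps)
  define \<Omega> where "\<Omega> i = (res_mod F i)\<lparr>carrier := diff F i ` carrier (res_mod F (Suc i))\<rparr>" for i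
  have \<Omega>0: "\<Omega> 0 = (res_mod F 0)\<lparr>carrier := {v \<in> carrier (res_mod F 0). aug F v = 0}\<rparr>"
    unfolding \<Omega>_def using ex0 by simp
  have \<Omega>S: "\<Omega> (Suc i) = (res_mod F (Suc i))\<lparr>carrier := {v \<in> carrier (res_mod F (Suc i)). diff F i v = 0}\<rparr>" for i
    unfolding \<Omega>_def using ex by simp
  have \<Omega>e: "ext_module (\<Omega> i)" for i
  proof (cases i)
    case 0
    show ?thesis unfolding 0 \<Omega>0 by (rule ext_module_kernel[OF Xe a])
  next
    case (Suc k)
    show ?thesis unfolding Suc \<Omega>S by (rule ext_module_kernel[OF ext_module_free d])
  qed
  have dl: "klinear (res_mod F (Suc i)) (\<Omega> i) (diff F i)" for i
    using graded_hom_klinear[OF d, of i] by (auto simp: klinear_def \<Omega>_def)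
  have d_act: "diff F i (act (res_mod F (Suc i)) v r) = act (\<Omega> i) (diff F i v) r"
    if "v \<in> carrier (res_mod F (Suc i))" for i v r
    using graded_hom_act[OF d that] by (simp add: \<Omega>_def)
  have d_onto: "diff F i ` carrier (res_mod F (Suc i)) = carrier (\<Omega> i)" for i by (simp add: \<Omega>_def)
  \<comment> \<open>\<open>\<Omega> i\<close> is covered by the free module of index i + 1, hence
    the index \<open>Suc i + k\<close> after k shifts.\<close>
  have main: "length (degs F (Suc i + k)) * card D < card J \<Longrightarrow> cocycles_dependent J k (\<Omega> i) X" for i k
  proof (induction k arbitrary: i)
    case 0
    then show ?case
      by (intro cocycles_dependent_0[OF Xe \<kappa> \<Omega>e dl d_onto d_act J(1)]) simp_all
  next
    case (Suc k)
    then have "cocycles_dependent J k (\<Omega> (Suc i)) X" by simp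
    then show ?case
      by (intro cocycles_dependent_Suc[OF X \<Omega>e dl d_onto d_act \<Omega>S \<Omega>e])
  qed
  show ?thesis
  proof (cases n)
    case 0
    then show ?thesis
      using J(2) unfolding 0
      by (intro cocycles_dependent_0[OF Xe \<kappa> Xe graded_hom_klinear[OF a] onto graded_hom_act[OF a] J(1)]) simp_all
  next
    case (Suc k)
    then have "cocycles_dependent J k (\<Omega> 0) X" using main[of 0 k] J(2) by simp
    then show ?thesis
      unfolding Suc by (intro cocycles_dependent_Suc[OF X Xe graded_hom_klinear[OF a] onto graded_hom_act[OF a] \<Omega>0 \<Omega>e])
  qed
qed

section \<open>Evaluating forms and nullhomotopies at a point\<close>

definition linear_form :: "('n \<Rightarrow> 'k) \<Rightarrow> ('k::comm_ring_1, 'n::{finite,linorder}) exterior" where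
  "linear_form \<theta> = (\<Sum>i\<in>UNIV. ext_var i * ext_const (\<theta> i))"

definition mono_eval :: "('n::finite \<Rightarrow> 'k::comm_ring_1) \<Rightarrow> ('n \<Rightarrow> nat) \<Rightarrow> 'k" where
  "mono_eval \<theta> \<alpha> = (\<Prod>i\<in>UNIV. \<theta> i ^ \<alpha> i)"

lemma mono_eval_lower: "0 < \<alpha> i \<Longrightarrow> mono_eval \<theta> \<alpha> = mono_eval \<theta> (lower \<alpha> i) * \<theta> i"
proof -
  assume "0 < \<alpha> i"
  then have "\<theta> i ^ \<alpha> i = \<theta> i ^ (\<alpha> i - 1) * \<theta> i" by (simp add: power_eq_if mult.commute)
  then show ?thesis
    unfolding mono_eval_def by (simp add: prod.remove[of UNIV i] mult_ac)
qed

lemma finite_mdeg: "finite {\<alpha> :: 'n::finite \<Rightarrow> nat. mdeg \<alpha> = n}"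
proof (rule finite_subset)
  show "{\<alpha> :: 'n \<Rightarrow> nat. mdeg \<alpha> = n} \<subseteq> {\<alpha>. \<forall>i. (i \<in> UNIV \<longrightarrow> \<alpha> i \<in> {..n}) \<and> (i \<notin> UNIV \<longrightarrow> \<alpha> i = 0)}"
    by (auto simp: mdeg_def intro: member_le_sum)
  show "finite {\<alpha> :: 'n \<Rightarrow> nat. \<forall>i. (i \<in> UNIV \<longrightarrow> \<alpha> i \<in> {..n}) \<and> (i \<notin> UNIV \<longrightarrow> \<alpha> i = 0)}"
    by (rule finite_set_of_finite_funs) auto
qed

lemma ext_module_act_linear_form:
  assumes "ext_module X" "x \<in> carrier X"
  shows "act X x (linear_form \<theta>) = (\<Sum>i\<in>UNIV. act X (act X x (ext_var i)) (ext_const (\<theta> i)))"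
  using assms by (simp add: linear_form_def ext_module.act_sum_right ext_module.act_mult)

text \<open>Evaluating \<open>f \<cdot> id = [Q, h]\<close> at a point \<open>\<theta>\<close>.\<close>

lemma nullhomotopic_eval:
  fixes X :: "('k::field, 'n::{finite,linorder}, 'm::ab_group_add) gmod"
  assumes X: "ext_module X" and h: "\<And>\<alpha>. klinear X X (h \<alpha>)" and n: "even n" "0 < n"
    and f: "\<And>\<alpha> w. mdeg \<alpha> = n \<Longrightarrow> w \<in> carrier X \<Longrightarrow> act X w (ext_const (f \<alpha>)) = kdiff X X h \<alpha> w"
    and nz: "(\<Sum>\<alpha> | mdeg \<alpha> = n. f \<alpha> * mono_eval \<theta> \<alpha>) \<noteq> 0"
    and w: "w \<in> carrier X" and 0: "act X w (linear_form \<theta>) = 0"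
  shows "\<exists>x\<in>carrier X. w = act X x (linear_form \<theta>)"
proof -
  interpret X: ext_module X by fact
  note hc = klinear_closed[OF h]
  let ?M = "\<lambda>n. {\<alpha> :: 'n \<Rightarrow> nat. mdeg \<alpha> = n}"
  obtain m where m: "n = Suc m" using n(2) by (cases n) auto
  \<comment> \<open>The value of h at \<theta>, obtained by substituting \<theta> i for Y_i in the
    part of degree m.\<close>
  define N where "N y = (\<Sum>\<beta>\<in>?M m. act X (h \<beta> y) (ext_const (mono_eval \<theta> \<beta>)))" for y
  have Nl: "klinear X X N"
    unfolding N_def[abs_def] by (intro klinear_sum_map klinear_act_map X h)
  note Nc = klinear_closed[OF Nl]
  define t where "t i \<beta> = act X (act X (h \<beta> w) (ext_var i) + h \<beta> (act X w (ext_var i)))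
      (ext_const (mono_eval \<theta> \<beta> * \<theta> i))" for i \<beta>
  define s where "s = (\<Sum>\<alpha>\<in>?M n. f \<alpha> * mono_eval \<theta> \<alpha>)"
  have tc: "act X (h \<beta> w) (ext_var i) + h \<beta> (act X w (ext_var i)) \<in> carrier X" for i \<beta>
    by (intro X.add_closed X.act_closed hc w)
  have "act X w (ext_const s) = (\<Sum>\<alpha>\<in>?M n. act X (act X w (ext_const (f \<alpha>))) (ext_const (mono_eval \<theta> \<alpha>)))"
  proof -
    have "(ext_const s :: ('k, 'n) exterior) = (\<Sum>\<alpha>\<in>?M n. ext_const (f \<alpha> * mono_eval \<theta> \<alpha>))"
      unfolding s_def by (rule exterior_eqI) (simp add: coeff_ext_sum coeff_ext_const)
    then have "act X w (ext_const s) = (\<Sum>\<alpha>\<in>?M n. act X w (ext_const (f \<alpha> * mono_eval \<theta> \<alpha>)))"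
      by (simp only: X.act_sum_right[OF w])
    then show ?thesis by (simp only: X.act_const_const[OF w])
  qed
  also have "\<dots> = (\<Sum>\<alpha>\<in>?M n. \<Sum>i | 0 < \<alpha> i. t i (lower \<alpha> i))"
  proof (rule sum.cong[OF refl])
    fix \<alpha> assume \<alpha>: "\<alpha> \<in> ?M n"
    \<comment> \<open>As n is even, the second term of the differential has the sign plus.\<close>
    then have "act X (act X w (ext_const (f \<alpha>))) (ext_const (mono_eval \<theta> \<alpha>)) =
        act X (\<Sum>i | 0 < \<alpha> i. act X (h (lower \<alpha> i) w) (ext_var i) + h (lower \<alpha> i) (act X w (ext_var i)))
          (ext_const (mono_eval \<theta> \<alpha>))"
      using f[of \<alpha> w] w n(1) by (simp add: kdiff_def alt_sign_def)
    also have "\<dots> = (\<Sum>i | 0 < \<alpha> i. t i (lower \<alpha> i))"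
      unfolding t_def by (subst X.act_sum_left[OF tc]) (auto simp: mono_eval_lower intro!: sum.cong)
    finally show "act X (act X w (ext_const (f \<alpha>))) (ext_const (mono_eval \<theta> \<alpha>)) =
      (\<Sum>i | 0 < \<alpha> i. t i (lower \<alpha> i))" .
  qed
  also have "\<dots> = (\<Sum>(\<alpha>, i)\<in>(SIGMA \<alpha>:?M n. {i. 0 < \<alpha> i}). t i (lower \<alpha> i))"
    by (subst sum.Sigma) (auto simp: finite_mdeg)
  \<comment> \<open>A monomial of degree n with a chosen variable dividing it corresponds to that
    variable together with the quotient monomial of degree m.\<close>
  also have "\<dots> = (\<Sum>(i, \<beta>)\<in>UNIV \<times> ?M m. t i \<beta>)"
  proof (rule sum.reindex_bij_witness[where i = "\<lambda>(i, \<beta>). (raise \<beta> i, i)" and j = "\<lambda>(\<alpha>, i). (i, lower \<alpha> i)"])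
    fix a assume "a \<in> (SIGMA \<alpha>:?M n. {i. 0 < \<alpha> i})"
    then obtain \<alpha> i where a: "a = (\<alpha>, i)" "mdeg \<alpha> = n" "0 < \<alpha> i" by auto
    then show "(case case a of (\<alpha>, i) \<Rightarrow> (i, lower \<alpha> i) of (i, \<beta>) \<Rightarrow> (raise \<beta> i, i)) = a"
      by (simp add: fun_eq_iff)
    show "(case a of (\<alpha>, i) \<Rightarrow> (i, lower \<alpha> i)) \<in> UNIV \<times> ?M m"
      using a mdeg_lower[of \<alpha> i] m by simp
  next
    fix b assume "b \<in> (UNIV :: 'n set) \<times> ?M m"
    then show "(case case b of (i, \<beta>) \<Rightarrow> (raise \<beta> i, i) of (\<alpha>, i) \<Rightarrow> (i, lower \<alpha> i)) = b"
      "(case b of (i, \<beta>) \<Rightarrow> (raise \<beta> i, i)) \<in> (SIGMA \<alpha>:?M n. {i. 0 < \<alpha> i})"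
      by (auto simp: m fun_eq_iff)
  qed (auto split: prod.splits)
  also have "\<dots> = (\<Sum>i\<in>UNIV. \<Sum>\<beta>\<in>?M m. t i \<beta>)"
    by (simp add: sum.cartesian_product)
  also have "\<dots> = (\<Sum>i\<in>UNIV. act X (act X (N w) (ext_var i) + N (act X w (ext_var i))) (ext_const (\<theta> i)))"
  proof (rule sum.cong[OF refl])
    fix i
    have "act X (N w) (ext_var i) = (\<Sum>\<beta>\<in>?M m. act X (act X (h \<beta> w) (ext_const (mono_eval \<theta> \<beta>))) (ext_var i))"
      unfolding N_def by (intro X.act_sum_left X.act_closed hc w)
    also have "\<dots> = (\<Sum>\<beta>\<in>?M m. act X (act X (h \<beta> w) (ext_var i)) (ext_const (mono_eval \<theta> \<beta>)))"
      by (intro sum.cong refl X.act_const_commute hc w)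
    finally have "act X (N w) (ext_var i) + N (act X w (ext_var i)) = (\<Sum>\<beta>\<in>?M m.
        act X (act X (h \<beta> w) (ext_var i) + h \<beta> (act X w (ext_var i))) (ext_const (mono_eval \<theta> \<beta>)))"
      unfolding N_def[of "act X w (ext_var i)"]
      by (simp add: X.act_add_left hc w X.act_closed flip: sum.distrib)
    then show "(\<Sum>\<beta>\<in>?M m. t i \<beta>) = act X (act X (N w) (ext_var i) + N (act X w (ext_var i))) (ext_const (\<theta> i))"
      using tc by (simp add: t_def X.act_sum_left X.act_closed X.act_const_const)
  qed
  also have "\<dots> = act X (N w) (linear_form \<theta>) + (\<Sum>i\<in>UNIV. N (act X (act X w (ext_var i)) (ext_const (\<theta> i))))"
    by (simp add: ext_module_act_linear_form X X.act_add_left Nc w X.act_closed sum.distrib klinear_const[OF Nl])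
  also have "(\<Sum>i\<in>UNIV. N (act X (act X w (ext_var i)) (ext_const (\<theta> i)))) = N (act X w (linear_form \<theta>))"
    using w by (simp add: ext_module_act_linear_form X klinear_sum[OF Nl X] X.act_closed)
  also have "\<dots> = 0" using 0 klinear_zero[OF Nl X] by simp
  \<comment> \<open>The anticommutator of N with \<ell> is the scalar s = f(\<theta>); applied to w
    it leaves only this term, since w \<ell> = 0.\<close>
  finally have eq: "act X w (ext_const s) = act X (N w) (linear_form \<theta>)" by simp
  have "w = act X (act X w (ext_const s)) (ext_const (inverse s))"
    using w nz by (simp add: X.act_const_const X.act_one s_def)
  also have "\<dots> = act X (act X (N w) (ext_const (inverse s))) (linear_form \<theta>)"
    unfolding eq using Nc[OF w] by (simp add: X.act_const_commute)
  finally show ?thesis using Nc[OF w] X.act_closed by blast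
qed

lemma infinite_UNIV_alg_closed: "infinite (UNIV :: 'k::alg_closed_field set)"
proof
  assume fin: "finite (UNIV :: 'k set)"
  \<comment> \<open>The product vanishes at every element of a finite field, so p has positive
    degree but takes only the value 1.\<close>
  define p :: "'k poly" where "p = (\<Prod>a\<in>UNIV. [:- a, 1:]) + 1"
  have deg: "degree (\<Prod>a\<in>(UNIV :: 'k set). [:- a, 1:]) = card (UNIV :: 'k set)"
    by (subst degree_prod_eq_sum_degree) auto
  have "card (UNIV :: 'k set) > 0" using fin by (simp add: finite_UNIV_card_ge_0)
  then have "degree p = card (UNIV :: 'k set)"
    unfolding p_def using deg by (subst degree_add_eq_left) simp_all
  then have "degree p > 0" using \<open>card (UNIV :: 'k set) > 0\<close> by simp
  then obtain x where "poly p x = 0" using alg_closed_imp_poly_has_root by blast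
  moreover have "poly (\<Prod>a\<in>(UNIV :: 'k set). [:- a, 1:]) x = 0"
    unfolding poly_prod by (rule prod_zero[OF fin]) (auto intro: bexI[of _ x])
  ultimately show False by (simp add: p_def)
qed

lemma poly_sum_nonzero:
  fixes c :: "nat \<Rightarrow> 'k::field"
  assumes "infinite (UNIV :: 'k set)" "p \<le> k" "c p \<noteq> 0"
  shows "\<exists>s. (\<Sum>i\<le>k. c i * s ^ i) \<noteq> 0"
proof -
  define P where "P = (\<Sum>i\<le>k. monom (c i) i)"
  have "coeff P p = (\<Sum>i\<le>k. if i = p then c p else 0)"
    unfolding P_def coeff_sum by (intro sum.cong) auto
  then have "P \<noteq> 0" using assms by auto
  then have "finite {s. poly P s = 0}" by (rule poly_roots_finite)
  then obtain s where "poly P s \<noteq> 0" using assms(1) by (metis (mono_tags) ex_new_if_finite mem_Collect_eq)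
  then show ?thesis by (auto simp: P_def poly_sum poly_monom)
qed

text \<open>A value of t that keeps one row of coefficients nonzero leaves a nonzero polynomial in
  s.\<close>

lemma bivariate_nonzero:
  fixes c :: "nat \<times> nat \<Rightarrow> 'k::field"
  assumes inf: "infinite (UNIV :: 'k set)" and "j \<in> {..k} \<times> {..k}" "c j \<noteq> 0"
  shows "\<exists>s t. (\<Sum>(p, q)\<in>{..k} \<times> {..k}. c (p, q) * (s ^ p * t ^ q)) \<noteq> 0"
proof -
  obtain p q where j: "j = (p, q)" "p \<le> k" "q \<le> k" using assms(2) by auto
  obtain t where t: "(\<Sum>q\<le>k. c (p, q) * t ^ q) \<noteq> 0"
    using poly_sum_nonzero[OF inf j(3), of "\<lambda>q. c (p, q)"] assms(3) j(1) by blast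
  obtain s where "(\<Sum>p\<le>k. (\<Sum>q\<le>k. c (p, q) * t ^ q) * s ^ p) \<noteq> 0"
    using poly_sum_nonzero[OF inf j(2), of "\<lambda>p. \<Sum>q\<le>k. c (p, q) * t ^ q"] t by blast
  also have "(\<Sum>p\<le>k. (\<Sum>q\<le>k. c (p, q) * t ^ q) * s ^ p) = (\<Sum>(p, q)\<in>{..k} \<times> {..k}. c (p, q) * (s ^ p * t ^ q))"
  proof -
    have "(\<Sum>p\<le>k. (\<Sum>q\<le>k. c (p, q) * t ^ q) * s ^ p) = (\<Sum>p\<le>k. \<Sum>q\<le>k. c (p, q) * (s ^ p * t ^ q))"
      by (simp add: sum_distrib_left mult_ac)
    then show ?thesis by (simp only: sum.cartesian_product)
  qed
  finally show ?thesis by blast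
qed

lemma UNIV_3: "(UNIV :: 3 set) = {0, 1, 2}"
proof -
  have "card {0, 1, 2 :: 3} = 3" by simp
  then have "card {0, 1, 2 :: 3} = CARD(3)" by simp
  then show ?thesis by (metis card_eq_UNIV_imp_eq_UNIV finite)
qed

lemma mdeg_3: "mdeg (\<alpha> :: 3 \<Rightarrow> nat) = \<alpha> 0 + \<alpha> 1 + \<alpha> 2"
  unfolding mdeg_def UNIV_3 by simp

lemma mono_eval_3: "mono_eval \<theta> (\<alpha> :: 3 \<Rightarrow> nat) = \<theta> 0 ^ \<alpha> 0 * \<theta> 1 ^ \<alpha> 1 * \<theta> 2 ^ \<alpha> 2"
  unfolding mono_eval_def UNIV_3 by (simp add: mult.assoc)

text \<open>Forms times the identity are cocycles. The (k + 1)^2 monomials with exponents p, q of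
  Y_1, Y_2 at most k outnumber the dimension bound for Ext^n, which is linear in n = 2k, so some
  nonzero form acts as zero on cohomology.\<close>

lemma exact_linear_form:
  fixes X :: "('k::alg_closed_field, 3, 'm::ab_group_add) gmod" and C :: nat
  assumes X: "graded_module X" and F: "free_resolution X F"
    and growth: "\<forall>i\<ge>1. length (degs F i) \<le> C * i"
  shows "\<exists>\<theta>. \<theta> 0 = 1 \<and> (\<forall>w\<in>carrier X. act X w (linear_form \<theta>) = 0 \<longrightarrow>
    (\<exists>x\<in>carrier X. w = act X x (linear_form \<theta>)))"
proof -
  have Xe: "ext_module X" using X by (rule graded_module_ext_module)
  interpret X: ext_module X by fact
  have "aug F \<in> graded_hom (res_mod F 0) X" and onto: "aug F ` carrier (res_mod F 0) = carrier X"
    using F[unfolded free_resolution_def] by (simp_all del: free_gmod_simps)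
  define D where "D = {..<length (degs F 0)} \<times> (UNIV :: 3 set set)"
  obtain \<kappa> where \<kappa>: "coordinates X D \<kappa>"
    using coordinates_exist[OF Xe graded_hom_klinear onto] \<open>aug F \<in> _\<close> unfolding D_def by blast
  \<comment> \<open>Makes C * n * card D equal to (k - 1) * k, which is less than k^2.\<close>
  define k where "k = Suc (2 * C * card D)"
  \<comment> \<open>Even, and large enough for Y_0 to take up the rest of the degree when p, q \<le>
    k.\<close>
  define n where "n = 2 * k"
  define J where "J = {..k} \<times> {..k}"
  define e :: "nat \<times> nat \<Rightarrow> 3 \<Rightarrow> nat"
    where "e = (\<lambda>(p, q) i. if i = 0 then n - p - q else if i = 1 then p else q)"
  have n: "even n" "0 < n" by (simp_all add: n_def k_def)
  have e_deg: "mdeg (e j) = n" if jJ: "j \<in> J" for j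
  proof -
    obtain p q where "j = (p, q)" "p \<le> k" "q \<le> k" using jJ unfolding J_def by blast
    then show ?thesis by (simp add: mdeg_3 e_def n_def)
  qed
  have "length (degs F n) * card D \<le> C * n * card D" using growth n(2) by simp
  also have "\<dots> = (2 * C * card D) * k" by (simp add: n_def)
  also have "\<dots> < k * k" by (simp add: k_def)
  also have "\<dots> \<le> card J" by (simp add: J_def card_cartesian_product)
  finally have card: "length (degs F n) * card D < card J" .
  have J: "finite J" by (simp add: J_def)
  define z where "z j \<alpha> w = (if \<alpha> = e j then w else 0)" for j \<alpha> and w :: 'm
  have zl: "\<forall>j\<in>J. \<forall>\<alpha>. klinear X X (z j \<alpha>)"
  proof (intro ballI allI)
    show "klinear X X (z j \<alpha>)" for j \<alpha>
      by (cases "\<alpha> = e j") (simp_all add: z_def[abs_def] klinear_id klinear_zero_map[OF Xe])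
  qed
  \<comment> \<open>In even degree the supercommutator with Q is the plain commutator, and the
    identity commutes with Q.\<close>
  have zd: "\<forall>j\<in>J. \<forall>\<alpha>. \<forall>w\<in>carrier X. mdeg \<alpha> = Suc n \<longrightarrow> kdiff X X (z j) \<alpha> w = 0"
    using n(1) by (auto simp: kdiff_def alt_sign_def z_def intro!: sum.neutral)
  from cocycles_dependent_resolution[OF X F \<kappa> J card, unfolded cocycles_dependent_def, THEN spec, of z, THEN mp, OF zl, THEN mp, OF zd]
  obtain c h where c: "\<exists>j\<in>J. c j \<noteq> 0" and h: "\<forall>\<alpha>. klinear X X (h \<alpha>)"
    and ch: "\<forall>\<alpha>. \<forall>w\<in>carrier X. mdeg \<alpha> = n \<longrightarrow>
      (\<Sum>j\<in>J. act X (z j \<alpha> w) (ext_const (c j))) = kdiff X X h \<alpha> w"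
    by (elim exE conjE)
  obtain s t where st: "(\<Sum>(p, q)\<in>J. c (p, q) * (s ^ p * t ^ q)) \<noteq> 0"
    using c bivariate_nonzero[OF infinite_UNIV_alg_closed] unfolding J_def by blast
  \<comment> \<open>Dehomogenised at Y_0; the coordinate 1 makes \<ell>, x_1, x_2 a basis of the
    linear forms.\<close>
  define \<theta> :: "3 \<Rightarrow> 'k" where "\<theta> i = (if i = 0 then 1 else if i = 1 then s else t)" for i
  define f where "f \<alpha> = (\<Sum>j\<in>J. if \<alpha> = e j then c j else 0)" for \<alpha>
  have f: "act X w (ext_const (f \<alpha>)) = kdiff X X h \<alpha> w" if "mdeg \<alpha> = n" "w \<in> carrier X" for \<alpha> w
  proof -
    have "(ext_const (f \<alpha>) :: ('k, 3) exterior) = (\<Sum>j\<in>J. ext_const (if \<alpha> = e j then c j else 0))"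
      unfolding f_def by (rule exterior_eqI) (simp add: coeff_ext_sum coeff_ext_const)
    then have "act X w (ext_const (f \<alpha>)) = (\<Sum>j\<in>J. act X w (ext_const (if \<alpha> = e j then c j else 0)))"
      using that(2) by (simp add: X.act_sum_right)
    also have "\<dots> = (\<Sum>j\<in>J. act X (z j \<alpha> w) (ext_const (c j)))"
      using that(2) by (intro sum.cong) (auto simp: z_def X.act_zero_right)
    finally show ?thesis using ch that by simp
  qed
  have "(\<Sum>\<alpha> | mdeg \<alpha> = n. f \<alpha> * mono_eval \<theta> \<alpha>) =
      (\<Sum>\<alpha> | mdeg \<alpha> = n. \<Sum>j\<in>J. if \<alpha> = e j then c j * mono_eval \<theta> (e j) else 0)"
    unfolding f_def sum_distrib_right by (intro sum.cong refl) auto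
  also have "\<dots> = (\<Sum>j\<in>J. \<Sum>\<alpha> | mdeg \<alpha> = n. if \<alpha> = e j then c j * mono_eval \<theta> (e j) else 0)"
    by (rule sum.swap)
  also have "\<dots> = (\<Sum>j\<in>J. c j * mono_eval \<theta> (e j))"
    using e_deg by (intro sum.cong refl) (simp add: sum.delta finite_mdeg)
  also have "\<dots> = (\<Sum>(p, q)\<in>J. c (p, q) * (s ^ p * t ^ q))"
    by (intro sum.cong refl) (auto simp: mono_eval_3 \<theta>_def e_def)
  finally have nz: "(\<Sum>\<alpha> | mdeg \<alpha> = n. f \<alpha> * mono_eval \<theta> \<alpha>) \<noteq> 0" using st by simp
  have "\<theta> 0 = 1" by (simp add: \<theta>_def)
  with nullhomotopic_eval[OF Xe h[rule_format] n f nz] show ?thesis by blast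
qed

section \<open>Rigid modules with an exact linear form\<close>

lemma linear_form_anticommute:
  "ext_var i * linear_form \<theta> = - (linear_form \<theta> * ext_var i)"
proof -
  have "ext_var i * linear_form \<theta> = (\<Sum>j\<in>UNIV. ext_var i * ext_var j * ext_const (\<theta> j))"
    by (simp add: linear_form_def sum_distrib_left mult.assoc)
  also have "\<dots> = (\<Sum>j\<in>UNIV. - (ext_var j * ext_const (\<theta> j) * ext_var i))"
    by (intro sum.cong refl) (simp add: ext_var_anticommute[of i] mult.assoc ext_const_commute)
  finally show ?thesis by (simp add: linear_form_def sum_distrib_right sum_negf)
qed

lemma linear_form_square: "linear_form \<theta> * linear_form \<theta> = 0"
proof -
  have "linear_form \<theta> * linear_form \<theta> =
      (\<Sum>i\<in>UNIV. \<Sum>j\<in>UNIV. ext_var i * ext_const (\<theta> i) * (ext_var j * ext_const (\<theta> j)))"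
    by (simp add: linear_form_def sum_product)
  also have "\<dots> = (\<Sum>(i, j)\<in>UNIV \<times> UNIV. ext_var i * ext_var j * ext_const (\<theta> i * \<theta> j))"
  proof -
    have "ext_var i * ext_const a * (ext_var j * ext_const b) = ext_var i * ext_var j * ext_const (a * b)"
      for i j :: 'b and a b :: 'a
    proof -
      have "ext_var i * ext_const a * (ext_var j * ext_const b) = ext_var i * (ext_const a * ext_var j) * ext_const b"
        by (simp only: mult.assoc)
      also have "\<dots> = ext_var i * ext_var j * ext_const (a * b)"
        by (simp only: ext_const_commute[of a "ext_var j"] ext_const_mult mult.assoc)
      finally show ?thesis .
    qed
    then show ?thesis by (simp only: sum.cartesian_product)
  qed
  also have "\<dots> = 0"
  proof (rule antisymmetric_sum)
    show "ext_var i * ext_var j * ext_const (\<theta> i * \<theta> j) = - (ext_var j * ext_var i * ext_const (\<theta> j * \<theta> i))"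
      for i j
      unfolding ext_var_anticommute[of i j] by (simp only: mult_minus_left mult.commute[of "\<theta> i"])
  qed (simp_all add: ext_var_square)
  finally show ?thesis .
qed

lemma linear_form_grade: "linear_form \<theta> \<in> ext_grade 1"
proof -
  have "ext_var i * ext_const (\<theta> i) \<in> ext_grade 1" for i
    using ext_mult_grade[OF ext_var_grade ext_const_grade] by simp
  then have "sum (\<lambda>i. ext_var i * ext_const (\<theta> i)) A \<in> ext_grade 1" for A
    using add_subgroup_ext_grade[of 1] unfolding add_subgroup_def
    by (induction A rule: infinite_finite_induct) auto
  then show ?thesis by (simp add: linear_form_def)
qed

text \<open>
  The infinitesimal coordinate change \<open>x\<^sub>i + \<epsilon> \<mu>\<^sub>i \<ell>\<close> with \<open>\<ell> = linear_form \<theta>\<close> is trivial on a rigid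
  module.  In positive characteristic it need not integrate; multiplying it with the endomorphism
  that trivialises it and iterating replaces the integration.
\<close>

lemma rigid_iterate:
  fixes X :: "('k::field, 'n::{finite,linorder}, 'm::ab_group_add) gmod"
  assumes X: "graded_module X" and rigid: "rigid X"
  shows "\<exists>u. u 0 = (\<lambda>x. x) \<and> (\<forall>n. klinear X X (u n)) \<and>
    (\<forall>n i. \<forall>x\<in>carrier X. act X (u (Suc n) x) (ext_var i) - u (Suc n) (act X x (ext_var i)) =
      act X (u n (act X x (linear_form \<theta>))) (ext_const (\<mu> i)))"
proof -
  have Xe: "ext_module X" using X by (rule graded_module_ext_module)
  interpret X: ext_module X by fact
  let ?a = "\<lambda>x. act X x (linear_form \<theta>)"
  \<comment> \<open>The last condition, that u commutes with the indeterminates on the image of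
    \<ell>, is what makes the next deformation anticommute with them, as \<open>rigid\<close>
    demands.\<close>
  define P where "P u \<longleftrightarrow> klinear X X u \<and> shifts X X 0 u \<and>
    (\<forall>x\<in>carrier X. \<forall>i. u (act X (?a x) (ext_var i)) = act X (u (?a x)) (ext_var i))" for u
  define Q where "Q u u' \<longleftrightarrow> (\<forall>i. \<forall>x\<in>carrier X. act X (u' x) (ext_var i) - u' (act X x (ext_var i)) =
      act X (u (?a x)) (ext_const (\<mu> i)))" for u u'
  have step: "\<exists>u'. P u' \<and> Q u u'" if u: "P u" for u
  proof -
    have ul: "klinear X X u" and us: "shifts X X 0 u"
      and ua: "\<And>x i. x \<in> carrier X \<Longrightarrow> u (act X (?a x) (ext_var i)) = act X (u (?a x)) (ext_var i)"
      using u by (auto simp: P_def)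
    note uc = klinear_closed[OF ul]
    define f where "f i x = act X (u (?a x)) (ext_const (\<mu> i))" for i x
    have fl: "klinear X X (f i)" for i
      unfolding f_def[abs_def] by (intro klinear_act_map klinear_comp[OF klinear_act ul] Xe)
    have fs: "shifts X X 1 (f i)" for i
    proof -
      have "shifts X X 1 ?a"
        unfolding shifts_def using linear_form_grade graded_module.act_grade[OF X] by blast
      from shifts_comp[OF this us] have "shifts X X 1 (\<lambda>x. u (?a x))" by simp
      moreover have "shifts X X 0 (\<lambda>x. act X x (ext_const (\<mu> i)))"
        unfolding shifts_def using ext_const_grade graded_module.act_grade[OF X] by blast
      ultimately show ?thesis using shifts_comp[of X X 1 "\<lambda>x. u (?a x)" X 0] by (simp add: f_def[abs_def])
    qed
    have fx: "act X (f i x) (ext_var j) + f i (act X x (ext_var j)) = 0" if x: "x \<in> carrier X" for i j x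
    proof -
      have "?a (act X x (ext_var j)) = - act X (?a x) (ext_var j)"
        using x by (simp add: linear_form_anticommute X.act_minus_right flip: X.act_mult)
      then have "u (?a (act X x (ext_var j))) = - act X (u (?a x)) (ext_var j)"
        using x by (simp add: klinear_minus[OF ul Xe] X.act_closed ua)
      then show ?thesis
        using x uc by (simp add: f_def X.act_closed X.act_minus_left X.act_const_commute)
    qed
    obtain g where g: "klinear X X g" "shifts X X 0 g"
      and gf: "\<forall>x\<in>carrier X. \<forall>i. f i x = act X (g x) (ext_var i) - g (act X x (ext_var i))"
      using rigid[unfolded rigid_def, THEN spec, of f] fl fs fx by auto
    \<comment> \<open>The condition persists: because \<ell>^2 = 0, the deformation vanishes on the
      image of \<ell>, so g commutes there with the indeterminates.\<close>
    have "g (act X (?a x) (ext_var i)) = act X (g (?a x)) (ext_var i)" if x: "x \<in> carrier X" for x i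
    proof -
      have "?a (?a x) = 0" using x by (simp add: linear_form_square X.act_zero_right flip: X.act_mult)
      then have "f i (?a x) = 0" using klinear_zero[OF ul Xe] by (simp add: f_def)
      then show ?thesis using gf X.act_closed[OF x] by simp
    qed
    then have "P g" using g by (simp add: P_def)
    moreover have "Q u g" unfolding Q_def using gf by (simp add: f_def)
    ultimately show ?thesis by blast
  qed
  have "P (\<lambda>x. x)" unfolding P_def by (simp add: klinear_id shifts_def)
  then have "\<exists>u. \<forall>n. (P (u n) \<and> (n = 0 \<longrightarrow> u n = (\<lambda>x. x))) \<and> Q (u n) (u (Suc n))"
    using step by (intro dependent_nat_choice) auto
  then obtain u where u: "\<And>n. P (u n)" "u 0 = (\<lambda>x. x)" "\<And>n. Q (u n) (u (Suc n))" by blast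
  then show ?thesis by (intro exI[of _ u]) (simp add: P_def Q_def)
qed

text \<open>
  The space of linear endomorphisms is finite dimensional, so the sequence above satisfies a linear
  relation, and its truncations are a sequence of the same kind that starts at a nonzero scalar and
  ends at zero.
\<close>

lemma rigid_chain:
  fixes X :: "('k::field, 'n::{finite,linorder}, 'm::ab_group_add) gmod"
  assumes X: "graded_module X" and rigid: "rigid X"
    and p: "klinear (free_gmod ds) X p" and onto: "p ` carrier (free_gmod ds) = carrier X"
  shows "\<exists>N M c. c \<noteq> 0 \<and> (\<forall>i. klinear X X (M i)) \<and>
    (\<forall>x\<in>carrier X. M 0 x = act X x (ext_const c) \<and> M N x = 0) \<and>
    (\<forall>i<N. \<forall>k. \<forall>x\<in>carrier X. act X (M (Suc i) x) (ext_var k) - M (Suc i) (act X x (ext_var k)) =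
      act X (M i (act X x (linear_form \<theta>))) (ext_const (\<mu> k)))"
proof -
  have Xe: "ext_module X" using X by (rule graded_module_ext_module)
  interpret X: ext_module X by fact
  let ?a = "\<lambda>x. act X x (linear_form \<theta>)"
  obtain u where u0: "u 0 = (\<lambda>x. x)" and ul: "\<forall>n. klinear X X (u n)"
    and u: "\<forall>n i. \<forall>x\<in>carrier X. act X (u (Suc n) x) (ext_var i) - u (Suc n) (act X x (ext_var i)) =
      act X (u n (?a x)) (ext_const (\<mu> i))"
    using rigid_iterate[OF X rigid, of \<theta> \<mu>] by (elim exE conjE)
  note uc = klinear_closed[OF ul[rule_format]]
  define D where "D = {..<length ds} \<times> (UNIV :: 'n set set)"
  obtain \<kappa> where \<kappa>: "coordinates X D \<kappa>"
    using coordinates_exist[OF Xe p onto] unfolding D_def by blast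
  have finD: "finite D" by (simp add: D_def)
  let ?b = "\<lambda>(j, S). free_basis j S :: nat \<Rightarrow> ('k, 'n) exterior"
  have b: "?b d \<in> carrier (free_gmod ds)" if "d \<in> D" for d
    using that by (auto simp: D_def free_basis_def)
  \<comment> \<open>The endomorphisms have dimension at most \<open>card D * card D\<close>; one
    index more forces a relation.\<close>
  define J where "J = {..card D * card D}"
  have J: "finite J" "card D * card D < card J" by (simp_all add: J_def)
  have "\<forall>n\<in>J. \<forall>d\<in>D. u n (p (?b d)) \<in> carrier X"
    using uc klinear_closed[OF p b] by blast
  from coordinates_dependent[OF Xe \<kappa> J(1) finD J(2) this]
  obtain c where c: "\<exists>n\<in>J. c n \<noteq> 0"
    and cu: "\<forall>d\<in>D. (\<Sum>n\<in>J. act X (u n (p (?b d))) (ext_const (c n))) = 0"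
    by (elim exE conjE)
  define f where "f x = (\<Sum>n\<in>J. act X (u n x) (ext_const (c n)))" for x
  have fl: "klinear X X f"
    unfolding f_def[abs_def] by (intro klinear_sum_map klinear_act_map Xe ul[rule_format])
  have f0: "f x = 0" if "x \<in> carrier X" for x
  proof -
    from that have "x \<in> p ` carrier (free_gmod ds)" unfolding onto .
    then obtain v where v: "v \<in> carrier (free_gmod ds)" "x = p v" by (elim imageE)
    have fp: "klinear (free_gmod ds) X (\<lambda>v. f (p v))" by (rule klinear_comp[OF p fl])
    have "f (p v) = f (p (\<Sum>j<length ds. \<Sum>S\<in>UNIV. vec_scale (coeff_ext (v j) S) (free_basis j S)))"
      using free_basis_expand[OF v(1)] by simp
    also have "\<dots> = (\<Sum>j<length ds. f (p (\<Sum>S\<in>UNIV. vec_scale (coeff_ext (v j) S) (free_basis j S))))"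
      by (rule klinear_sum[OF fp ext_module_free]) (auto simp: sum_fun_apply vec_scale_def free_basis_def)
    also have "\<dots> = (\<Sum>j<length ds. \<Sum>S\<in>UNIV. f (p (vec_scale (coeff_ext (v j) S) (free_basis j S))))"
      by (rule sum.cong[OF refl], rule klinear_sum[OF fp ext_module_free])
        (auto simp: vec_scale_def free_basis_def)
    also have "\<dots> = 0"
    proof (intro sum.neutral ballI)
      fix j S assume "j \<in> {..<length ds}"
      then have d: "(j, S) \<in> D" by (simp add: D_def)
      have "f (p (vec_scale (coeff_ext (v j) S) (free_basis j S))) =
          act X (f (p (free_basis j S))) (ext_const (coeff_ext (v j) S))"
        using klinear_const[OF fp b[OF d]] by (simp add: act_free_const del: free_gmod_simps)
      also have "f (p (free_basis j S)) = 0" using cu d by (auto simp: f_def)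
      finally show "f (p (vec_scale (coeff_ext (v j) S) (free_basis j S))) = 0" by simp
    qed
    finally show ?thesis using v by simp
  qed
  \<comment> \<open>The last index that occurs in the relation, so that its coefficient can serve as
    the nonzero scalar.\<close>
  define N where "N = Max {n \<in> J. c n \<noteq> 0}"
  have fin: "finite {n \<in> J. c n \<noteq> 0}" and ne: "{n \<in> J. c n \<noteq> 0} \<noteq> {}" using J(1) c by auto
  have N: "N \<in> J" "c N \<noteq> 0" using Max_in[OF fin ne] by (auto simp: N_def)
  have N_max: "c n = 0" if "n \<in> J" "N < n" for n
    using that Max_ge[OF fin, of n] by (auto simp: N_def)
  \<comment> \<open>The relation is shifted down by N - i and cut off at index 0: for i = N it is
    the full relation, hence zero, and for i = 0 only c N times the identity remains.\<close>
  define M where "M i x = (\<Sum>j\<le>i. act X (u j x) (ext_const (c (N - i + j))))" for i x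
  have "klinear X X (M i)" for i
    unfolding M_def[abs_def] by (intro klinear_sum_map klinear_act_map Xe ul[rule_format])
  moreover have "M 0 x = act X x (ext_const (c N))" for x by (simp add: M_def u0)
  moreover have "M N x = 0" if "x \<in> carrier X" for x
  proof -
    have "f x = M N x"
      unfolding f_def M_def using N N_max uc[OF that]
      by (intro sum.mono_neutral_cong_right) (auto simp: J_def X.act_zero_right not_le)
    then show ?thesis using f0[OF that] by simp
  qed
  moreover have "act X (M (Suc i) x) (ext_var k) - M (Suc i) (act X x (ext_var k)) =
      act X (M i (?a x)) (ext_const (\<mu> k))" if i: "i < N" and x: "x \<in> carrier X" for i k x
  proof -
    let ?t = "\<lambda>j. act X (u j x) (ext_var k) - u j (act X x (ext_var k))"
    have tc: "u j x \<in> carrier X" "u j (act X x (ext_var k)) \<in> carrier X" for j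
      using uc x X.act_closed by blast+
    have "act X (M (Suc i) x) (ext_var k) =
        (\<Sum>j\<le>Suc i. act X (act X (u j x) (ext_const (c (N - Suc i + j)))) (ext_var k))"
      unfolding M_def by (intro X.act_sum_left X.act_closed tc)
    then have "act X (M (Suc i) x) (ext_var k) - M (Suc i) (act X x (ext_var k)) =
        (\<Sum>j\<le>Suc i. act X (?t j) (ext_const (c (N - Suc i + j))))"
      unfolding M_def
      by (simp only: X.act_diff_left[OF X.act_closed[OF tc(1)] tc(2)] X.act_const_commute[OF tc(1)] sum_subtractf)
    \<comment> \<open>The term at 0 drops out because \<open>u 0\<close> is the identity; the others
      move down by one index.\<close>
    also have "\<dots> = (\<Sum>j\<le>i. act X (?t (Suc j)) (ext_const (c (N - i + j))))"
    proof -
      have "?t 0 = 0" by (simp add: u0)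
      moreover have "N - Suc i + Suc j = N - i + j" for j using i by simp
      ultimately show ?thesis
        by (simp only: sum.atMost_Suc_shift X.act_zero_left add_0_left)
    qed
    also have "\<dots> = (\<Sum>j\<le>i. act X (act X (u j (?a x)) (ext_const (\<mu> k))) (ext_const (c (N - i + j))))"
      using u x by simp
    also have "\<dots> = (\<Sum>j\<le>i. act X (act X (u j (?a x)) (ext_const (c (N - i + j)))) (ext_const (\<mu> k)))"
      using uc x X.act_closed by (intro sum.cong refl X.act_const_commute) auto
    also have "\<dots> = act X (M i (?a x)) (ext_const (\<mu> k))"
      unfolding M_def using uc x X.act_closed by (intro X.act_sum_left[symmetric]) auto
    finally show ?thesis .
  qed
  ultimately show ?thesis using N(2) by (intro exI[of _ N] exI[of _ M] exI[of _ "c N"]) auto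
qed

text \<open>Exactness of \<beta> on X\<alpha>, read through M i. For i = N it is trivial, for i = 0
  it will concern a scalar. In between, M i on x\<alpha> is the commutator of the next map with
  \<beta>, and both terms of the commutator turn out to be multiples of \<alpha>\<beta>.\<close>

lemma descent_first:
  assumes X: "ext_module X"
    and anti: "\<beta> * \<alpha> = - (\<alpha> * \<beta>)" and sq: "\<beta> * \<beta> = 0"
    and exact: "\<And>x. x \<in> carrier X \<Longrightarrow> act X x \<alpha> = 0 \<Longrightarrow> \<exists>y\<in>carrier X. x = act X y \<alpha>"
    and M: "\<And>i. klinear X X (M i)"
    and comm: "\<And>i x. i < N \<Longrightarrow> x \<in> carrier X \<Longrightarrow> M (Suc i) (act X x \<alpha>) = act X (M (Suc i) x) \<alpha>"
    and twist: "\<And>i x. i < N \<Longrightarrow> x \<in> carrier X \<Longrightarrow>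
      act X (M (Suc i) x) \<beta> - M (Suc i) (act X x \<beta>) = M i (act X x \<alpha>)"
    and M_N: "\<And>x. x \<in> carrier X \<Longrightarrow> M N x = 0"
    and "i \<le> N" "x \<in> carrier X" "act X x (\<alpha> * \<beta>) = 0"
  shows "\<exists>y\<in>carrier X. M i (act X x \<alpha>) = act X y (\<alpha> * \<beta>)"
  using \<open>i \<le> N\<close> assms(10,11)
proof (induction i arbitrary: x rule: inc_induct)
  interpret X: ext_module X by fact
  case base
  then show ?case using M_N X.act_closed X.zero_closed X.act_zero_left by metis
next
  interpret X: ext_module X by fact
  case (step i)
  note x = \<open>x \<in> carrier X\<close> and i = \<open>i < N\<close>
  let ?M = "M (Suc i)"
  note Mc = klinear_closed[OF M]
  \<comment> \<open>Writes x\<beta> as y\<alpha> with y\<alpha>\<beta> = x\<beta>\<beta> = 0, so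
    that the induction hypothesis covers y as well as x.\<close>
  have "act X (act X x \<beta>) \<alpha> = 0"
    using step.prems by (simp add: anti X.act_minus_right flip: X.act_mult)
  then obtain y where y: "y \<in> carrier X" "act X x \<beta> = act X y \<alpha>"
    using exact X.act_closed[OF x] by blast
  have "act X y (\<alpha> * \<beta>) = act X (act X x \<beta>) \<beta>" using y by (simp add: X.act_mult)
  also have "\<dots> = 0" using x by (simp add: sq X.act_zero_right flip: X.act_mult)
  finally obtain z where z: "z \<in> carrier X" "?M (act X y \<alpha>) = act X z (\<alpha> * \<beta>)"
    using step.IH y(1) by blast
  obtain z' where z': "z' \<in> carrier X" "?M (act X x \<alpha>) = act X z' (\<alpha> * \<beta>)"
    using step.IH step.prems by blast
  \<comment> \<open>Exactness of \<alpha> then gives the next map at x as v\<alpha> - z'\<beta>;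
    multiplying by \<beta> leaves v\<alpha>\<beta>.\<close>
  have "act X (?M x + act X z' \<beta>) \<alpha> = 0"
  proof -
    have "act X (?M x) \<alpha> = act X z' (\<alpha> * \<beta>)" using comm[OF i x] z'(2) by simp
    moreover have "act X (act X z' \<beta>) \<alpha> = - act X z' (\<alpha> * \<beta>)"
      using z'(1) by (simp add: anti X.act_minus_right flip: X.act_mult)
    ultimately show ?thesis using x z' Mc X.act_closed by (simp add: X.act_add_left)
  qed
  then obtain v where v: "v \<in> carrier X" "?M x + act X z' \<beta> = act X v \<alpha>"
    using exact X.add_closed[OF Mc[OF x] X.act_closed[OF z'(1)]] by blast
  have "act X (?M x) \<beta> = act X (act X v \<alpha> - act X z' \<beta>) \<beta>"
    by (simp only: v(2)[symmetric] add_diff_cancel_right')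
  also have "\<dots> = act X v (\<alpha> * \<beta>)"
    using v(1) z'(1) X.act_closed
    by (simp add: X.act_diff_left sq X.act_zero_right flip: X.act_mult)
  finally have "M i (act X x \<alpha>) = act X v (\<alpha> * \<beta>) - act X z (\<alpha> * \<beta>)"
    using twist[OF i x] y(2) z(2) by simp
  then have "M i (act X x \<alpha>) = act X (v - z) (\<alpha> * \<beta>)" using v z by (simp add: X.act_diff_left)
  then show ?case using X.diff_closed[OF v(1) z(1)] by blast
qed

text \<open>Successive division: w - v\<gamma> is killed by \<alpha>\<beta>, so a correction by a
  multiple of \<beta> makes it killed by \<alpha>, hence a multiple of \<alpha>. The coefficient of
  \<gamma> stays the given v.\<close>

lemma kernel_generated:
  assumes X: "ext_module X"
    and \<beta>\<alpha>: "\<beta> * \<alpha> = - (\<alpha> * \<beta>)" and \<gamma>\<alpha>: "\<gamma> * \<alpha> = - (\<alpha> * \<gamma>)" and \<gamma>\<beta>: "\<gamma> * \<beta> = - (\<beta> * \<gamma>)"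
    and exact: "\<And>x. x \<in> carrier X \<Longrightarrow> act X x \<alpha> = 0 \<Longrightarrow> \<exists>y\<in>carrier X. x = act X y \<alpha>"
    and exact2: "\<And>x. x \<in> carrier X \<Longrightarrow> act X x (\<alpha> * \<beta>) = 0 \<Longrightarrow> \<exists>y\<in>carrier X. act X x \<alpha> = act X y (\<alpha> * \<beta>)"
    and w: "w \<in> carrier X" and v: "v \<in> carrier X" and eq: "act X w (\<alpha> * \<beta>) = act X v (\<alpha> * \<beta> * \<gamma>)"
  shows "\<exists>y\<in>carrier X. \<exists>z\<in>carrier X. w = act X v \<gamma> + act X y \<beta> + act X z \<alpha>"
proof -
  interpret X: ext_module X by fact
  have \<gamma>\<alpha>\<beta>: "\<gamma> * (\<alpha> * \<beta>) = \<alpha> * \<beta> * \<gamma>"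
  proof -
    have "\<gamma> * (\<alpha> * \<beta>) = - (\<alpha> * (\<gamma> * \<beta>))" by (simp add: \<gamma>\<alpha> flip: mult.assoc)
    then show ?thesis by (simp add: \<gamma>\<beta> mult.assoc)
  qed
  have "act X (w - act X v \<gamma>) (\<alpha> * \<beta>) = 0"
    using w v eq X.act_closed by (simp add: X.act_diff_left \<gamma>\<alpha>\<beta> flip: X.act_mult)
  then obtain y where y: "y \<in> carrier X" "act X (w - act X v \<gamma>) \<alpha> = act X y (\<alpha> * \<beta>)"
    using exact2 X.diff_closed[OF w X.act_closed[OF v]] by blast
  have c: "w - act X v \<gamma> + act X y \<beta> \<in> carrier X"
    using w v y X.act_closed X.add_closed X.diff_closed by simp
  have "act X (w - act X v \<gamma> + act X y \<beta>) \<alpha> = 0"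
  proof -
    have "act X (act X y \<beta>) \<alpha> = - act X y (\<alpha> * \<beta>)"
      using y(1) by (simp add: \<beta>\<alpha> X.act_minus_right flip: X.act_mult)
    then show ?thesis using w v y X.act_closed X.diff_closed by (simp add: X.act_add_left)
  qed
  then obtain z where z: "z \<in> carrier X" "w - act X v \<gamma> + act X y \<beta> = act X z \<alpha>"
    using exact c by blast
  then have "w = act X v \<gamma> + act X (- y) \<beta> + act X z \<alpha>"
    using y(1) by (simp add: X.act_minus_left algebra_simps)
  then show ?thesis using X.minus_closed[OF y(1)] z(1) by blast
qed

text \<open>The same descent one level up, for \<gamma> on X\<alpha>\<beta>. The twist relation is
  multiplied by \<beta>, with which every M i commutes.\<close>

lemma descent_second:
  assumes X: "ext_module X"
    and \<beta>\<alpha>: "\<beta> * \<alpha> = - (\<alpha> * \<beta>)" and \<gamma>\<alpha>: "\<gamma> * \<alpha> = - (\<alpha> * \<gamma>)" and \<gamma>\<beta>: "\<gamma> * \<beta> = - (\<beta> * \<gamma>)"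
    and \<beta>\<beta>: "\<beta> * \<beta> = 0" and \<gamma>\<gamma>: "\<gamma> * \<gamma> = 0"
    and exact: "\<And>x. x \<in> carrier X \<Longrightarrow> act X x \<alpha> = 0 \<Longrightarrow> \<exists>y\<in>carrier X. x = act X y \<alpha>"
    and exact2: "\<And>x. x \<in> carrier X \<Longrightarrow> act X x (\<alpha> * \<beta>) = 0 \<Longrightarrow> \<exists>y\<in>carrier X. act X x \<alpha> = act X y (\<alpha> * \<beta>)"
    and M: "\<And>i. klinear X X (M i)"
    and comm\<alpha>: "\<And>i x. i < N \<Longrightarrow> x \<in> carrier X \<Longrightarrow> M (Suc i) (act X x \<alpha>) = act X (M (Suc i) x) \<alpha>"
    and comm\<beta>: "\<And>i x. i < N \<Longrightarrow> x \<in> carrier X \<Longrightarrow> M (Suc i) (act X x \<beta>) = act X (M (Suc i) x) \<beta>"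
    and M0: "\<And>x. x \<in> carrier X \<Longrightarrow> M 0 (act X x \<beta>) = act X (M 0 x) \<beta>"
    and twist: "\<And>i x. i < N \<Longrightarrow> x \<in> carrier X \<Longrightarrow>
      act X (M (Suc i) x) \<gamma> - M (Suc i) (act X x \<gamma>) = M i (act X x \<alpha>)"
    and M_N: "\<And>x. x \<in> carrier X \<Longrightarrow> M N x = 0"
    and "i \<le> N" "x \<in> carrier X" "act X x (\<alpha> * \<beta> * \<gamma>) = 0"
  shows "\<exists>y\<in>carrier X. M i (act X x (\<alpha> * \<beta>)) = act X y (\<alpha> * \<beta> * \<gamma>)"
  using \<open>i \<le> N\<close> assms(16,17)
proof (induction i arbitrary: x rule: inc_induct)
  interpret X: ext_module X by fact
  case base
  then show ?case using M_N X.act_closed X.zero_closed X.act_zero_left by metis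
next
  interpret X: ext_module X by fact
  case (step i)
  note x = \<open>x \<in> carrier X\<close> and i = \<open>i < N\<close>
  let ?M = "M (Suc i)"
  note Mc = klinear_closed[OF M]
  \<comment> \<open>The commutation hypothesis starts at index 1; index 0 needs
    \<open>M0\<close>.\<close>
  have Mi\<beta>: "M i (act X y \<beta>) = act X (M i y) \<beta>" if "y \<in> carrier X" for y
    using M0 comm\<beta> that i by (cases i) auto
  have r1: "\<gamma> * \<beta> * \<alpha> = - (\<alpha> * \<beta> * \<gamma>)"
  proof -
    have "\<gamma> * \<beta> * \<alpha> = - (\<gamma> * \<alpha> * \<beta>)" by (simp add: \<beta>\<alpha> mult.assoc)
    also have "\<dots> = \<alpha> * (\<gamma> * \<beta>)" by (simp add: \<gamma>\<alpha> mult.assoc)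
    finally show ?thesis by (simp add: \<gamma>\<beta> mult.assoc)
  qed
  have r2: "\<gamma> * \<beta> * \<gamma> = 0"
    by (simp add: \<gamma>\<beta> \<gamma>\<gamma> mult.assoc)
  have r3: "\<beta> * \<gamma> * \<beta> = 0"
  proof -
    have "\<beta> * \<gamma> * \<beta> = - (\<beta> * \<beta> * \<gamma>)" by (simp add: \<gamma>\<beta> mult.assoc)
    then show ?thesis by (simp add: \<beta>\<beta>)
  qed
  have r4: "\<alpha> * \<gamma> * \<beta> = - (\<alpha> * \<beta> * \<gamma>)" by (simp add: \<gamma>\<beta> mult.assoc)
  \<comment> \<open>x\<gamma>\<beta> is divided by \<alpha> and then by \<alpha>\<beta>. The
    quotient z' satisfies z'\<alpha>\<beta>\<gamma> = x\<gamma>\<beta>\<gamma> = 0, so the induction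
    hypothesis applies to it.\<close>
  have "act X (act X x (\<gamma> * \<beta>)) \<alpha> = 0"
    using step.prems by (simp add: r1 X.act_minus_right flip: X.act_mult)
  then obtain z where z: "z \<in> carrier X" "act X x (\<gamma> * \<beta>) = act X z \<alpha>"
    using exact X.act_closed[OF x] by blast
  have "act X z (\<alpha> * \<beta>) = act X (act X x (\<gamma> * \<beta>)) \<beta>" using z by (simp add: X.act_mult)
  also have "\<dots> = 0" using x by (simp add: \<beta>\<beta> mult.assoc X.act_zero_right flip: X.act_mult)
  finally obtain z' where z': "z' \<in> carrier X" "act X z \<alpha> = act X z' (\<alpha> * \<beta>)" using exact2 z(1) by blast
  have "act X z' (\<alpha> * \<beta> * \<gamma>) = act X (act X x (\<gamma> * \<beta>)) \<gamma>" using z z' by (simp add: X.act_mult)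
  also have "\<dots> = 0" using x by (simp add: r2 X.act_zero_right flip: X.act_mult)
  finally obtain s where s: "s \<in> carrier X" "?M (act X z' (\<alpha> * \<beta>)) = act X s (\<alpha> * \<beta> * \<gamma>)"
    using step.IH z'(1) by blast
  have second: "act X (?M (act X x \<gamma>)) \<beta> = act X s (\<alpha> * \<beta> * \<gamma>)"
    using comm\<beta>[OF i X.act_closed[OF x, of \<gamma>]] s(2) z(2) z'(2) x by (simp add: X.act_mult)
  obtain v where v: "v \<in> carrier X" "?M (act X x (\<alpha> * \<beta>)) = act X v (\<alpha> * \<beta> * \<gamma>)"
    using step.IH step.prems by blast
  have "act X (?M x) (\<alpha> * \<beta>) = act X v (\<alpha> * \<beta> * \<gamma>)"
    using comm\<alpha>[OF i x] comm\<beta>[OF i X.act_closed[OF x]] v(2) x Mc by (simp add: X.act_mult)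
  from kernel_generated[OF X \<beta>\<alpha> \<gamma>\<alpha> \<gamma>\<beta> exact exact2 Mc[OF x] v(1) this]
  obtain y t where yt: "y \<in> carrier X" "t \<in> carrier X" "?M x = act X v \<gamma> + act X y \<beta> + act X t \<alpha>"
    by blast
  \<comment> \<open>Of the three summands only t\<alpha> survives multiplication by \<gamma>\<beta>,
    since \<gamma>\<gamma> = 0 and \<beta>\<gamma>\<beta> = 0.\<close>
  have first: "act X (act X (?M x) \<gamma>) \<beta> = - act X t (\<alpha> * \<beta> * \<gamma>)"
    using v(1) yt(1,2) X.act_closed X.add_closed
    unfolding X.act_mult[OF Mc[OF x], symmetric] yt(3)
    by (simp add: X.act_add_left r3 r4 \<gamma>\<gamma> X.act_zero_right X.act_minus_right flip: X.act_mult)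
  have "M i (act X x (\<alpha> * \<beta>)) = act X (M i (act X x \<alpha>)) \<beta>"
    using Mi\<beta>[OF X.act_closed[OF x]] x by (simp add: X.act_mult)
  also have "\<dots> = act X (act X (?M x) \<gamma>) \<beta> - act X (?M (act X x \<gamma>)) \<beta>"
    unfolding twist[OF i x, symmetric] using Mc x X.act_closed by (simp add: X.act_diff_left)
  also have "\<dots> = act X (- t - s) (\<alpha> * \<beta> * \<gamma>)"
    unfolding first second using yt(2) s(1) X.minus_closed
    by (simp add: X.act_diff_left X.act_minus_left)
  finally show ?case using X.diff_closed[OF X.minus_closed[OF yt(2)] s(1)] by blast
qed

text \<open>The twist relation is linear in the indeterminate, and its coefficient becomes the
  pairing of \<mu> with \<eta>. Where the pairing vanishes, M' commutes with the form.\<close>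

lemma twist_linear_form:
  assumes X: "ext_module X" and M: "klinear X X M" "klinear X X M'" and x: "x \<in> carrier X"
    and y: "y \<in> carrier X"
    and twist: "\<And>k. act X (M' x) (ext_var k) - M' (act X x (ext_var k)) = act X y (ext_const (\<mu> k))"
  shows "act X (M' x) (linear_form \<eta>) - M' (act X x (linear_form \<eta>)) =
    act X y (ext_const (\<Sum>k\<in>UNIV. \<mu> k * \<eta> k))"
proof -
  interpret X: ext_module X by fact
  note c = klinear_closed[OF M(2)]
  have "act X (M' x) (linear_form \<eta>) - M' (act X x (linear_form \<eta>)) =
      (\<Sum>k\<in>UNIV. act X (act X (M' x) (ext_var k)) (ext_const (\<eta> k)) -
        M' (act X (act X x (ext_var k)) (ext_const (\<eta> k))))"
    using x c X.act_closed
    by (simp add: ext_module_act_linear_form[OF X] klinear_sum[OF M(2) X] sum_subtractf)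
  also have "\<dots> = (\<Sum>k\<in>UNIV. act X (act X y (ext_const (\<mu> k))) (ext_const (\<eta> k)))"
    unfolding twist[symmetric] using x c X.act_closed
    by (intro sum.cong refl) (simp add: X.act_diff_left klinear_const[OF M(2)])
  also have "\<dots> = (\<Sum>k\<in>UNIV. act X y (ext_const (\<mu> k * \<eta> k)))"
    using y by (simp add: X.act_const_const)
  also have "\<dots> = act X y (\<Sum>k\<in>UNIV. ext_const (\<mu> k * \<eta> k))"
    using y by (simp add: X.act_sum_right)
  also have "(\<Sum>k\<in>UNIV. ext_const (\<mu> k * \<eta> k)) = ext_const (\<Sum>k\<in>UNIV. \<mu> k * \<eta> k)"
    by (rule exterior_eqI) (simp add: coeff_ext_sum coeff_ext_const)
  finally show ?thesis .
qed

section \<open>Three indeterminates: from an exact linear form to a free module\<close>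

lemma sum_UNIV_3: "(\<Sum>k\<in>(UNIV :: 3 set). f k) = f 0 + f 1 + f 2"
  unfolding UNIV_3 by (simp add: add.assoc)

lemma act_const_cancel:
  assumes X: "ext_module X" and c: "c \<noteq> 0" and x: "x \<in> carrier X"
    and y: "y \<in> carrier X" "act X x (ext_const c) = act X y r"
  shows "\<exists>y\<in>carrier X. x = act X y r"
proof -
  interpret X: ext_module X by fact
  have "x = act X (act X x (ext_const c)) (ext_const (inverse c))"
    using c x by (simp add: X.act_const_const X.act_one)
  also have "\<dots> = act X (act X y (ext_const (inverse c))) r"
    unfolding y(2) using y(1) by (simp add: X.act_const_commute)
  finally show ?thesis using X.act_closed[OF y(1)] by blast
qed

text \<open>With \<ell> exact on X, the two descents make x_1 exact on X\<ell> and x_2 exact on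
  X\<ell>x_1. Dividing back through these three steps places x in the radical.\<close>

lemma socle_lift:
  fixes X :: "('k::field, 3, 'm::ab_group_add) gmod"
  assumes X: "graded_module X" and rigid: "rigid X"
    and p: "klinear (free_gmod ds) X p" and onto: "p ` carrier (free_gmod ds) = carrier X"
    and \<theta>: "\<theta> 0 = 1" and exact: "\<And>x. x \<in> carrier X \<Longrightarrow> act X x (linear_form \<theta>) = 0 \<Longrightarrow>
      \<exists>y\<in>carrier X. x = act X y (linear_form \<theta>)"
    and x: "x \<in> carrier X" and x0: "act X x (ext_var 0 * ext_var 1 * ext_var 2) = 0"
  shows "\<exists>u\<in>carrier X. \<exists>v\<in>carrier X. \<exists>w\<in>carrier X.
    x = act X u (ext_var 2) + act X v (ext_var 1) + act X w (linear_form \<theta>)"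
proof -
  have Xe: "ext_module X" using X by (rule graded_module_ext_module)
  interpret X: ext_module X by fact
  define \<alpha> \<beta> \<gamma> :: "('k, 3) exterior"
    where "\<alpha> = linear_form \<theta>" and "\<beta> = ext_var 1" and "\<gamma> = ext_var 2"
  have \<beta>\<alpha>: "\<beta> * \<alpha> = - (\<alpha> * \<beta>)" and \<gamma>\<alpha>: "\<gamma> * \<alpha> = - (\<alpha> * \<gamma>)" and \<gamma>\<beta>: "\<gamma> * \<beta> = - (\<beta> * \<gamma>)"
    and \<beta>\<beta>: "\<beta> * \<beta> = 0" and \<gamma>\<gamma>: "\<gamma> * \<gamma> = 0"
    unfolding \<alpha>_def \<beta>_def \<gamma>_def
    by (rule linear_form_anticommute ext_var_anticommute ext_var_square)+
  have exact1: "\<And>x. x \<in> carrier X \<Longrightarrow> act X x \<alpha> = 0 \<Longrightarrow> \<exists>y\<in>carrier X. x = act X y \<alpha>"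
    using exact by (simp add: \<alpha>_def)
  \<comment> \<open>The coordinate change adds eps \<ell> to x_i and subtracts eps \<theta>_i \<ell>
    from x_0. As \<theta>_0 = 1, it fixes \<ell>, so the chain commutes with \<alpha>.\<close>
  define \<mu> where "\<mu> i = (\<lambda>k :: 3. if k = 0 then - \<theta> i else if k = i then 1 else 0)" for i :: 3
  have \<mu>\<theta>: "(\<Sum>k\<in>UNIV. \<mu> i k * \<theta> k) = 0" if "i = 1 \<or> i = 2" for i
    using that \<theta> by (auto simp: sum_UNIV_3 \<mu>_def)
  have chain: "\<exists>N M c. c \<noteq> 0 \<and> (\<forall>i. klinear X X (M i)) \<and>
    (\<forall>x\<in>carrier X. M 0 x = act X x (ext_const c) \<and> M N x = 0) \<and>
    (\<forall>i<N. \<forall>k. \<forall>x\<in>carrier X. act X (M (Suc i) x) (ext_var k) - M (Suc i) (act X x (ext_var k)) =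
      act X (M i (act X x \<alpha>)) (ext_const (\<mu> l k)))" for l
    unfolding \<alpha>_def by (rule rigid_chain[OF X rigid p onto])
  have commute\<alpha>: "M' (act X x \<alpha>) = act X (M' x) \<alpha>"
    if M: "klinear X X M" "klinear X X M'" and x: "x \<in> carrier X" and l: "l = 1 \<or> l = 2"
      and t: "\<forall>k. act X (M' x) (ext_var k) - M' (act X x (ext_var k)) =
        act X (M (act X x \<alpha>)) (ext_const (\<mu> l k))" for M M' x l
  proof -
    have "M (act X x \<alpha>) \<in> carrier X" using klinear_closed[OF M(1)] X.act_closed x by blast
    from twist_linear_form[OF Xe M x this t[rule_format], of \<theta>]
    show ?thesis using X.act_zero_right[OF \<open>M (act X x \<alpha>) \<in> carrier X\<close>] by (simp add: \<mu>\<theta>[OF l] \<alpha>_def)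
  qed
  have exact2: "\<exists>y\<in>carrier X. act X x \<alpha> = act X y (\<alpha> * \<beta>)"
    if x: "x \<in> carrier X" and 0: "act X x (\<alpha> * \<beta>) = 0" for x
  proof -
    from chain[of 1] obtain N M c where c: "c \<noteq> 0" and M: "\<forall>i. klinear X X (M i)"
      and ends: "\<forall>x\<in>carrier X. M 0 x = act X x (ext_const c) \<and> M N x = 0"
      and tw: "\<forall>i<N. \<forall>k. \<forall>x\<in>carrier X. act X (M (Suc i) x) (ext_var k) - M (Suc i) (act X x (ext_var k)) =
        act X (M i (act X x \<alpha>)) (ext_const (\<mu> 1 k))"
      by (elim exE conjE)
    note Mc = klinear_closed[OF M[rule_format]]
    have "M (Suc i) (act X y \<alpha>) = act X (M (Suc i) y) \<alpha>" if "i < N" "y \<in> carrier X" for i y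
      using commute\<alpha>[of "M i" "M (Suc i)" y 1] M tw that by simp
    moreover have "act X (M (Suc i) y) \<beta> - M (Suc i) (act X y \<beta>) = M i (act X y \<alpha>)"
      if "i < N" "y \<in> carrier X" for i y
      using tw that Mc X.act_closed by (simp add: \<beta>_def \<mu>_def X.act_one)
    ultimately have "\<exists>y\<in>carrier X. M 0 (act X x \<alpha>) = act X y (\<alpha> * \<beta>)"
      using ends M x 0 by (intro descent_first[OF Xe \<beta>\<alpha> \<beta>\<beta> exact1, where M = M and N = N]) auto
    then obtain y where y: "y \<in> carrier X" "act X (act X x \<alpha>) (ext_const c) = act X y (\<alpha> * \<beta>)"
      using ends X.act_closed[OF x] by auto
    then show ?thesis by (rule act_const_cancel[OF Xe c X.act_closed[OF x]])
  qed
  have exact3: "\<exists>y\<in>carrier X. act X x (\<alpha> * \<beta>) = act X y (\<alpha> * \<beta> * \<gamma>)"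
    if x: "x \<in> carrier X" and 0: "act X x (\<alpha> * \<beta> * \<gamma>) = 0" for x
  proof -
    from chain[of 2] obtain N M c where c: "c \<noteq> 0" and M: "\<forall>i. klinear X X (M i)"
      and ends: "\<forall>x\<in>carrier X. M 0 x = act X x (ext_const c) \<and> M N x = 0"
      and tw: "\<forall>i<N. \<forall>k. \<forall>x\<in>carrier X. act X (M (Suc i) x) (ext_var k) - M (Suc i) (act X x (ext_var k)) =
        act X (M i (act X x \<alpha>)) (ext_const (\<mu> 2 k))"
      by (elim exE conjE)
    note Mc = klinear_closed[OF M[rule_format]]
    have "M (Suc i) (act X y \<alpha>) = act X (M (Suc i) y) \<alpha>" if "i < N" "y \<in> carrier X" for i y
      using commute\<alpha>[of "M i" "M (Suc i)" y 2] M tw that by simp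
    moreover have "M (Suc i) (act X y \<beta>) = act X (M (Suc i) y) \<beta>" if "i < N" "y \<in> carrier X" for i y
    proof -
      have "act X (M (Suc i) y) \<beta> - M (Suc i) (act X y \<beta>) = act X (M i (act X y \<alpha>)) 0"
        using tw that by (simp add: \<beta>_def \<mu>_def)
      then show ?thesis using X.act_zero_right[OF Mc[OF X.act_closed[OF that(2)]]] by simp
    qed
    moreover have "act X (M (Suc i) y) \<gamma> - M (Suc i) (act X y \<gamma>) = M i (act X y \<alpha>)"
      if "i < N" "y \<in> carrier X" for i y
      using tw that Mc X.act_closed by (simp add: \<gamma>_def \<mu>_def X.act_one)
    moreover have "M 0 (act X y \<beta>) = act X (M 0 y) \<beta>" if "y \<in> carrier X" for y
      using ends that X.act_closed by (simp add: X.act_const_commute)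
    ultimately have "\<exists>y\<in>carrier X. M 0 (act X x (\<alpha> * \<beta>)) = act X y (\<alpha> * \<beta> * \<gamma>)"
      using ends M x 0
      by (intro descent_second[OF Xe \<beta>\<alpha> \<gamma>\<alpha> \<gamma>\<beta> \<beta>\<beta> \<gamma>\<gamma> exact1 exact2, where M = M and N = N]) auto
    then obtain y where y: "y \<in> carrier X"
      "act X (act X x (\<alpha> * \<beta>)) (ext_const c) = act X y (\<alpha> * \<beta> * \<gamma>)"
      using ends X.act_closed[OF x] by auto
    then show ?thesis by (rule act_const_cancel[OF Xe c X.act_closed[OF x]])
  qed
  \<comment> \<open>The summands of \<ell> in x_1 and x_2 are killed by \<beta>\<gamma>, and x_0 has
    coefficient 1.\<close>
  have "\<alpha> * \<beta> * \<gamma> = ext_var 0 * ext_var 1 * ext_var 2"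
  proof -
    have \<alpha>: "\<alpha> = ext_var 0 + \<beta> * ext_const (\<theta> 1) + \<gamma> * ext_const (\<theta> 2)"
      by (simp add: \<alpha>_def \<beta>_def \<gamma>_def linear_form_def sum_UNIV_3 \<theta>)
    have "\<beta> * ext_const (\<theta> 1) * \<beta> * \<gamma> = 0"
      using ext_const_commute[of "\<theta> 1" \<beta>] \<beta>\<beta> by (metis mult.assoc mult_zero_left)
    moreover have "\<gamma> * ext_const (\<theta> 2) * \<beta> * \<gamma> = 0"
    proof -
      have "\<gamma> * ext_const (\<theta> 2) * \<beta> * \<gamma> = ext_const (\<theta> 2) * (\<gamma> * \<beta> * \<gamma>)"
        by (simp only: ext_const_commute[of "\<theta> 2" \<gamma>, symmetric] mult.assoc)
      also have "\<gamma> * \<beta> * \<gamma> = 0" by (simp add: \<gamma>\<beta> \<gamma>\<gamma> mult.assoc)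
      finally show ?thesis by simp
    qed
    ultimately show ?thesis unfolding \<alpha> by (simp add: distrib_right \<beta>_def \<gamma>_def)
  qed
  then have x0': "act X x (\<alpha> * \<beta> * \<gamma>) = 0" using x0 by simp
  obtain v where v: "v \<in> carrier X" "act X x (\<alpha> * \<beta>) = act X v (\<alpha> * \<beta> * \<gamma>)"
    using exact3[OF x x0'] by blast
  from kernel_generated[OF Xe \<beta>\<alpha> \<gamma>\<alpha> \<gamma>\<beta> exact1 exact2 x v]
  show ?thesis using v(1) unfolding \<alpha>_def \<beta>_def \<gamma>_def by blast
qed

text \<open>If x_i does not kill w, then w x_i is killed by x_i and, by anticommutation, still by
  every indeterminate that kills w.\<close>

lemma socle_element_exists:
  fixes v :: "nat \<Rightarrow> ('k::field, 'n::{finite,linorder}) exterior"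
  assumes K: "\<And>v i. v \<in> K \<Longrightarrow> act (free_gmod ds) v (ext_var i) \<in> K" and v: "v \<in> K" "v \<noteq> 0"
  shows "\<exists>w\<in>K. w \<noteq> 0 \<and> (\<forall>i\<in>A. act (free_gmod ds) w (ext_var i) = 0)"
proof (induction A rule: finite_induct[OF finite])
  case 1
  then show ?case using v by blast
next
  case (2 i A)
  then obtain w where w: "w \<in> K" "w \<noteq> 0" "\<forall>i\<in>A. act (free_gmod ds) w (ext_var i) = 0" by blast
  show ?case
  proof (cases "act (free_gmod ds) w (ext_var i) = 0")
    case True
    then have "\<forall>l\<in>insert i A. act (free_gmod ds) w (ext_var l) = 0" using w(3) by blast
    then show ?thesis using w(1,2) by blast
  next
    case False
    have anti: "w j * ext_var i * ext_var l = - (w j * ext_var l * ext_var i)" for j l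
      by (simp add: mult.assoc ext_var_anticommute[of i l])
    have "act (free_gmod ds) (act (free_gmod ds) w (ext_var i)) (ext_var l) = 0" if "l \<in> insert i A" for l
    proof (cases "l = i")
      case True
      then show ?thesis by (simp add: mult.assoc ext_var_square fun_eq_iff)
    next
      case False
      then have "w j * ext_var l = 0" for j using w(3) that by (simp add: fun_eq_iff)
      then show ?thesis by (simp add: anti fun_eq_iff)
    qed
    then show ?thesis using False K[OF w(1)] by blast
  qed
qed

text \<open>Only nonvanishing of the coefficient matters, so the order on the index type that
  determines its sign is left unevaluated.\<close>

lemma socle_monomial_3:
  "\<exists>\<epsilon> :: 'k::field. \<epsilon> \<noteq> 0 \<and>
    (\<forall>S. coeff_ext (ext_var 0 * ext_var 1 * ext_var 2 :: ('k, 3) exterior) S = (if S = UNIV then \<epsilon> else 0))"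
proof (intro exI conjI allI)
  let ?\<epsilon> = "ext_sign (UNIV - {2 :: 3}) {2} * (if (1 :: 3) < 0 then - 1 else 1) :: 'k"
  show "?\<epsilon> \<noteq> 0" by simp
  fix S :: "3 set"
  have "2 \<in> S \<and> S - {2} = {0, 1} \<longleftrightarrow> S = UNIV"
  proof
    assume "2 \<in> S \<and> S - {2} = {0, 1}"
    then show "S = UNIV" unfolding UNIV_3 by blast
  next
    assume "S = UNIV"
    then show "2 \<in> S \<and> S - {2} = {0, 1}" unfolding UNIV_3 by auto
  qed
  then show "coeff_ext (ext_var 0 * ext_var 1 * ext_var 2 :: ('k, 3) exterior) S = (if S = UNIV then ?\<epsilon> else 0)"
    by (auto simp: coeff_mult_var[of "ext_var 0 * ext_var 1"] coeff_ext_var_mult)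
qed

lemma aug_ideal_var: "a * ext_var i \<in> ext_aug"
  by (simp add: ext_aug_def coeff_mult_var)

lemma aug_ideal_mult:
  assumes "b \<in> ext_aug" shows "a * b \<in> ext_aug"
  using assms by (simp add: ext_aug_def times_exterior_def)

text \<open>A nonzero kernel meets the socle of the free module, whose elements are x_0 x_1 x_2
  applied to vectors of scalars. The image of such a vector lies in the radical of X by
  \<open>socle_lift\<close>, so the vector differs from a radical element by a kernel element, and
  minimality makes it zero.\<close>

lemma minimal_cover_injective:
  fixes X :: "('k::field, 3, 'm::ab_group_add) gmod"
  assumes X: "graded_module X" and rigid: "rigid X"
    and p: "p \<in> graded_hom (free_gmod ds) X" and onto: "p ` carrier (free_gmod ds) = carrier X"
    and \<theta>: "\<theta> 0 = 1" and exact: "\<And>x. x \<in> carrier X \<Longrightarrow> act X x (linear_form \<theta>) = 0 \<Longrightarrow>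
      \<exists>y\<in>carrier X. x = act X y (linear_form \<theta>)"
    and minimal: "\<And>v j. v \<in> carrier (free_gmod ds) \<Longrightarrow> p v = 0 \<Longrightarrow> v j \<in> ext_aug"
    and v: "v \<in> carrier (free_gmod ds)" "p v = 0"
  shows "v = 0"
proof (rule ccontr)
  assume "v \<noteq> 0"
  let ?F = "free_gmod ds :: ('k, 3, _) gmod"
  interpret X: ext_module X using X by (rule graded_module_ext_module)
  interpret F: ext_module ?F by (rule ext_module_free)
  note pl = graded_hom_klinear[OF p]
  define K where "K = {v \<in> carrier ?F. p v = 0}"
  have "act ?F v (ext_var i) \<in> K" if "v \<in> K" for v i
    using that F.act_closed graded_hom_act[OF p] by (simp add: K_def del: free_gmod_simps)
  moreover have "v \<in> K" using v by (simp add: K_def)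
  ultimately have "\<exists>w\<in>K. w \<noteq> 0 \<and> (\<forall>i\<in>UNIV. act ?F w (ext_var i) = 0)"
    using \<open>v \<noteq> 0\<close> by (rule socle_element_exists)
  then obtain w where w: "w \<in> carrier ?F" "p w = 0" "w \<noteq> 0" "\<And>i. act ?F w (ext_var i) = 0"
    unfolding K_def by blast
  \<comment> \<open>An element killed by all indeterminates has only top coefficients.\<close>
  have w_top: "coeff_ext (w j) S = 0" if S: "S \<noteq> UNIV" for j S
  proof -
    obtain i where i: "i \<notin> S" using S by blast
    have "coeff_ext (w j * ext_var i) (insert i S) = 0" using w(4)[of i] by (simp add: fun_eq_iff)
    then show ?thesis using i by (simp add: coeff_mult_var)
  qed
  obtain \<epsilon> :: 'k where \<epsilon>: "\<epsilon> \<noteq> 0"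
    "\<forall>S. coeff_ext (ext_var 0 * ext_var 1 * ext_var 2 :: ('k, 3) exterior) S = (if S = UNIV then \<epsilon> else 0)"
    using socle_monomial_3 by blast
  define w0 where "w0 j = (ext_const (coeff_ext (w j) UNIV / \<epsilon>) :: ('k, 3) exterior)" for j
  have w0: "w0 \<in> carrier ?F" using w(1) by (simp add: w0_def)
  have "act ?F w0 (ext_var 0 * ext_var 1 * ext_var 2) = w"
  proof
    fix j
    show "act ?F w0 (ext_var 0 * ext_var 1 * ext_var 2) j = w j"
      using \<epsilon> w_top by (intro exterior_eqI) (simp add: w0_def)
  qed
  then have "act X (p w0) (ext_var 0 * ext_var 1 * ext_var 2) = 0"
    using graded_hom_act[OF p w0, symmetric] w(2) by (simp del: free_gmod_simps)
  from socle_lift[OF X rigid pl onto \<theta> exact klinear_closed[OF pl w0] this]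
  obtain a b c where "a \<in> carrier X" "b \<in> carrier X" "c \<in> carrier X"
    and eq: "p w0 = act X a (ext_var 2) + act X b (ext_var 1) + act X c (linear_form \<theta>)" by blast
  have pre: "\<exists>y. y \<in> carrier ?F \<and> x = p y" if "x \<in> carrier X" for x
  proof -
    from that have "x \<in> p ` carrier ?F" unfolding onto .
    then show ?thesis by (elim imageE) blast
  qed
  obtain a' b' c' where abc: "a' \<in> carrier ?F" "b' \<in> carrier ?F" "c' \<in> carrier ?F"
    "a = p a'" "b = p b'" "c = p c'"
    using pre[OF \<open>a \<in> carrier X\<close>] pre[OF \<open>b \<in> carrier X\<close>] pre[OF \<open>c \<in> carrier X\<close>]
    by (elim exE conjE)
  \<comment> \<open>A radical element of the free module with the same image as
    \<open>w0\<close>.\<close>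
  define y where "y = act ?F a' (ext_var 2) + act ?F b' (ext_var 1) + act ?F c' (linear_form \<theta>)"
  have yc: "y \<in> carrier ?F" unfolding y_def by (intro F.add_closed F.act_closed abc)
  have "p y = p w0"
    unfolding y_def eq abc(4-6)
    using abc F.act_closed F.add_closed by (simp add: klinear_add[OF pl] graded_hom_act[OF p] del: free_gmod_simps)
  then have "p (w0 - y) = 0" using klinear_diff[OF pl ext_module_free w0 yc] by simp
  then have "(w0 - y) j \<in> ext_aug" for j by (intro minimal F.diff_closed w0 yc)
  moreover have "y j \<in> ext_aug" for j
  proof -
    have "linear_form \<theta> \<in> ext_aug"
      by (simp add: linear_form_def ext_aug_def coeff_ext_sum ext_var_def)
    then show ?thesis
      using aug_ideal_var[of "a' j" 2] aug_ideal_var[of "b' j" 1] aug_ideal_mult[of "linear_form \<theta>" "c' j"]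
      by (simp add: y_def ext_aug_def)
  qed
  ultimately have "coeff_ext (w0 j) {} = 0" for j by (simp add: ext_aug_def)
  then have "coeff_ext (w j) UNIV = 0" for j using \<epsilon>(1) by (simp add: w0_def coeff_ext_const)
  then have "w j = 0" for j using w_top by (intro exterior_eqI) (metis coeff_ext_zero)
  then show False using w(3) by (simp add: fun_eq_iff)
qed

text \<open>If one differential vanishes, the next is onto its free target. Its values lie in the
  ideal of the indeterminates, which contains no basis vector, so the target is zero.\<close>

lemma minimal_resolution_trivial:
  assumes F: "minimal_free_resolution X F" and inj: "\<And>v. v \<in> carrier (res_mod F 0) \<Longrightarrow> aug F v = 0 \<Longrightarrow> v = 0"
  shows "degs F (Suc i) = []"
proof -
  have res: "free_resolution X F" and min: "\<And>i v j. v \<in> carrier (res_mod F (Suc i)) \<Longrightarrow> diff F i v j \<in> ext_aug"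
    using F unfolding minimal_free_resolution_def by blast+
  have d: "\<And>i. diff F i \<in> graded_hom (res_mod F (Suc i)) (res_mod F i)"
    and ex0: "diff F 0 ` carrier (res_mod F 1) = {v \<in> carrier (res_mod F 0). aug F v = 0}"
    and ex: "\<And>i. diff F (Suc i) ` carrier (res_mod F (Suc (Suc i))) =
      {v \<in> carrier (res_mod F (Suc i)). diff F i v = 0}"
    using res[unfolded free_resolution_def] by (simp_all del: free_gmod_simps)
  have step: "degs F (Suc i) = []" if "\<And>v. v \<in> carrier (res_mod F (Suc i)) \<Longrightarrow> diff F i v = 0" for i
  proof (rule ccontr)
    assume ne: "degs F (Suc i) \<noteq> []"
    then have b: "free_basis 0 {} \<in> carrier (res_mod F (Suc i))" by (auto simp: free_basis_def)
    then have "free_basis 0 {} \<in> diff F (Suc i) ` carrier (res_mod F (Suc (Suc i)))"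
      unfolding ex using that by blast
    then obtain x where x: "free_basis 0 {} = diff F (Suc i) x" "x \<in> carrier (res_mod F (Suc (Suc i)))"
      by (rule imageE)
    from min[OF x(2), of 0] show False
      unfolding x(1)[symmetric] by (simp add: free_basis_def ext_aug_def)
  qed
  show ?thesis
  proof (induction i)
    case 0
    have "diff F 0 v \<in> {v \<in> carrier (res_mod F 0). aug F v = 0}" if "v \<in> carrier (res_mod F (Suc 0))" for v
      using that unfolding ex0[symmetric] One_nat_def by (rule imageI)
    then show ?case using inj by (intro step) blast
  next
    case (Suc i)
    have "diff F (Suc i) v = 0" if "v \<in> carrier (res_mod F (Suc (Suc i)))" for v
    proof -
      have "diff F (Suc i) v \<in> carrier (res_mod F (Suc i))"
        using klinear_closed[OF graded_hom_klinear[OF d] that] .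
      then show ?thesis by (simp add: Suc fun_eq_iff)
    qed
    then show ?case by (rule step)
  qed
qed

section \<open>Complexity and bounds on Betti numbers\<close>

lemma complexity_growth:
  assumes "complexity X = 1 \<or> complexity X = 2"
  shows "\<exists>C. \<forall>i\<ge>1. betti i X \<le> C * i"
proof -
  define S where "S = {d. \<exists>c::rat. c > 0 \<and> (\<forall>i\<ge>1. of_nat (betti i X) \<le> c * of_nat i powi (int d - 1))}"
  have cS: "complexity X = Inf (enat ` S)" by (simp add: complexity_def S_def)
  then have "S \<noteq> {}" using assms by (auto simp: Inf_enat_def one_enat_def numeral_eq_enat)
  \<comment> \<open>A nonempty set of natural numbers contains its infimum, so the defining bound is
    available for the complexity itself.\<close>
  then have "complexity X \<in> enat ` S"
    unfolding cS Inf_enat_def by (auto intro: LeastI)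
  then obtain d where d: "d \<in> S" "d = 1 \<or> d = 2"
    using assms by (auto simp: one_enat_def numeral_eq_enat)
  then obtain c :: rat where c: "c > 0" "\<And>i. i \<ge> 1 \<Longrightarrow> of_nat (betti i X) \<le> c * of_nat i powi (int d - 1)"
    unfolding S_def by blast
  have "betti i X \<le> nat \<lceil>c\<rceil> * i" if i: "i \<ge> 1" for i
  proof -
    \<comment> \<open>The exponent is 0 or 1, and i is at least 1.\<close>
    have "of_nat i powi (int d - 1) \<le> (of_nat i :: rat)" using d(2) i by auto
    then have "of_nat (betti i X) \<le> c * of_nat i"
      using c(1) c(2)[OF i] by (meson dual_order.trans less_imp_le mult_left_mono)
    also have "\<dots> \<le> of_nat (nat \<lceil>c\<rceil>) * of_nat i"
      using c(1) by (intro mult_right_mono) (simp_all add: of_nat_nat)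
    finally show ?thesis by (simp flip: of_nat_mult)
  qed
  then show ?thesis by blast
qed

lemma complexity_zero:
  assumes "\<And>i. 1 \<le> i \<Longrightarrow> betti i X = 0"
  shows "complexity X = 0"
proof -
  have "0 \<in> {d. \<exists>c::rat. c > 0 \<and> (\<forall>i\<ge>1. of_nat (betti i X) \<le> c * of_nat i powi (int d - 1))}"
    using assms by (auto intro!: exI[of _ 1])
  then have "complexity X \<le> enat 0"
    unfolding complexity_def by (intro Inf_lower imageI)
  then show ?thesis by (simp add: enat_0)
qed

theorem proposition3p6:
  fixes X :: "('k::alg_closed_field, 3, 'm::ab_group_add) gmod"
  assumes "graded_module X"
    and "finitely_generated X"
    and "indecomposable X"
    and "complexity X = 1 \<or> complexity X = 2"
  shows "carrier (Ext_group 1 X X) \<noteq> {\<one>\<^bsub>Ext_group 1 X X\<^esub>}"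
proof
  assume ext: "carrier (Ext_group 1 X X) = {\<one>\<^bsub>Ext_group 1 X X\<^esub>}"
  note X = assms(1)
  define G where "G = (SOME F. minimal_free_resolution X F)"
  \<comment> \<open>The resolution chosen for Ext may differ from the minimal one chosen for the
    Betti numbers. Rigidity is derived from F, growth and minimality from G.\<close>
  define F where "F = (SOME F. free_resolution X F)"
  have G: "minimal_free_resolution X G"
    unfolding G_def using minimal_free_resolution_exists[OF assms(1,2)] by (rule someI_ex)
  then have Gres: "free_resolution X G" by (simp add: minimal_free_resolution_def)
  then have F: "free_resolution X F" unfolding F_def by (rule someI)
  have betti: "betti i X = length (degs G i)" for i by (simp add: betti_def G_def)
  have "cocycles F 1 X \<subseteq> coboundaries F 1 X"
    unfolding F_def by (rule trivial_Ext_cocycles[OF ext X])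
  then have "rigid X" by (rule trivial_cocycles_rigid[OF X F])
  obtain C where "\<forall>i\<ge>1. betti i X \<le> C * i" using complexity_growth[OF assms(4)] by blast
  then have "\<forall>i\<ge>1. length (degs G i) \<le> C * i" by (simp add: betti)
  from exact_linear_form[OF X Gres this] obtain \<theta> where \<theta>: "\<theta> 0 = 1"
    and exact: "\<forall>w\<in>carrier X. act X w (linear_form \<theta>) = 0 \<longrightarrow> (\<exists>x\<in>carrier X. w = act X x (linear_form \<theta>))"
    by (elim exE conjE)
  have a: "aug G \<in> graded_hom (res_mod G 0) X" and onto: "aug G ` carrier (res_mod G 0) = carrier X"
    and ex0: "diff G 0 ` carrier (res_mod G 1) = {v \<in> carrier (res_mod G 0). aug G v = 0}"
    using Gres[unfolded free_resolution_def] by (simp_all del: free_gmod_simps)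
  have min: "v j \<in> ext_aug" if "v \<in> carrier (res_mod G 0)" "aug G v = 0" for v j
  proof -
    have "v \<in> diff G 0 ` carrier (res_mod G (Suc 0))"
      using that ex0 unfolding One_nat_def by simp
    then show ?thesis using G unfolding minimal_free_resolution_def by blast
  qed
  have "v = 0" if "v \<in> carrier (res_mod G 0)" "aug G v = 0" for v
  proof (rule minimal_cover_injective[where v = v and \<theta> = \<theta>, OF X \<open>rigid X\<close> a onto \<theta>])
    show "v j \<in> ext_aug" if "v \<in> carrier (res_mod G 0)" "aug G v = 0" for v j using that by (rule min)
  qed (use exact that in blast)+
  then have "degs G (Suc i) = []" for i by (rule minimal_resolution_trivial[OF G])
  then have "betti i X = 0" if "1 \<le> i" for i using that by (cases i) (simp_all add: betti)
  then have "complexity X = 0" by (rule complexity_zero)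
  then show False using assms(4) by auto
qed

end
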